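(* Let $\alpha:[0,T]\to\mathbb{R}$ and $\lambda:[0,T]\to[0,\infty)$ be deterministic measurable functions and, for $t\in[0,T]$ and $x\in\mathbb{R}$, let $$\xi^{\alpha,\lambda}_t(x)=-\mathrm{sign}(x-\alpha(t))\,\min\big(\lambda(t),|x-\alpha(t)|\big),$$ and write $\xi^{\alpha,\lambda}(X)=(\xi^{\alpha,\lambda}_t(X_t))_{t\in[0,T]}$. Then, almost surely, $$\mathrm{SURE}_\mu(X+\xi^{\alpha,\lambda}(X))=\int_0^T\gamma(t,t)\,\mu(dt)+\int_0^T|X_t-\alpha(t)|^2\wedge\lambda^2(t)\,\mu(dt)-2\int_0^T\mathbf{1}_{\{|X_t-\alpha(t)|\le\lambda(t)\}}\gamma(t,t)\,\mu(dt).$$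
   Context: Let $T>0$. Under a probability measure $\mathbb{P}_u$ (with expectation $\mathbb{E}_u$) on $\Omega$ one observes a (jointly measurable) real process $X=(X_t)_{t\in[0,T]}$ decomposed as $X_t=u_t+X^u_t$, where $X^u=(X^u_t)_{t\in[0,T]}$ is a centered Gaussian process with non-vanishing covariance function $\gamma(s,t)=\mathbb{E}_u[X^u_sX^u_t]$ and $u$ is a deterministic function belonging to the space $H$ below. Let $\mu$ be a finite Borel measure on $[0,T]$ with $\int_0^T\gamma(t,t)\mu(dt)<\infty$. "Almost surely" is with respect to $\mathbb{P}_u$. Gradient operators. Let $(\Gamma g)(t)=\int_0^Tg(s)\gamma(s,t)\mu(ds)$, $t\in[0,T]$, and let $H$ be the Hilbert space of functions on $[0,T]$ with inner product $\langle h,g\rangle_H=\langle h,\Gamma g\rangle_{L^2([0,T],d\mu)}$ (obtained from $L^2([0,T],d\mu)$ by passing to the quotient and completing). Let $X^u(h)=\int_0^TX^u_s h(s)\mu(ds)$; since $\mathbb{E}_u[X^u(h)X^u(g)]=\langle h,g\rangle_H$, the map $h\mapsto X^u(h)$ extends to an isometry $H\to L^2(\Omega,\mathbb{P}_u)$. The operator $\Gamma$ extends to $H$ by $(\Gamma h)(t)=\mathbb{E}_u[X^u(h)X^u_t]$. For cylindrical functionals $F=f_n(X^u(h_1),\dots,X^u(h_n))$, with $h_i\in H$ and $f_n$ infinitely differentiable and rapidly decreasing on $\mathbb{R}^n$, the $H$-valued Malliavin derivative is $\nabla F=\sum_{i=1}^n h_i\,\partial_if_n(X^u(h_1),\dots,X^u(h_n))$.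 The operator $\nabla$ is closable from $L^2(\Omega,\mathbb{P}_u)$ to $L^2(\Omega,\mathbb{P}_u;H)$; $\mathrm{Dom}(\nabla)$ denotes its closed domain. For $F\in\mathrm{Dom}(\nabla)$, set $D_tF:=(\Gamma\nabla F)(t)$, $t\in[0,T]$. For a process $\xi=(\xi_t)_{t\in[0,T]}$ with $\xi_t\in\mathrm{Dom}(\nabla)$ for $\mu$-almost every $t$, $$\mathrm{SURE}_\mu(X+\xi):=\int_0^T\gamma(t,t)\,\mu(dt)+\int_0^T|\xi_t|^2\,\mu(dt)+2\int_0^TD_t\xi_t\,\mu(dt).$$ Here $X+\xi^{\alpha,\lambda}(X)$ is the soft-threshold estimator. Convention: $\mathrm{sign}(0)=0$ and $a\wedge b=\min(a,b)$. *)

theory Defs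
  imports "HOL-Probability.Probability"
begin

section \<open>Gaussian processes and square-integrable functions\<close>

text \<open>Degenerate (almost surely zero) variables count as Gaussian, so that for instance
  Brownian motion started at 0 is a Gaussian process.\<close>

definition centered_gaussian :: "'w measure \<Rightarrow> ('w \<Rightarrow> real) \<Rightarrow> bool" where
  "centered_gaussian M Z \<longleftrightarrow> Z \<in> borel_measurable M \<and>
     ((\<exists>\<sigma>>0. distributed M lborel Z (normal_density 0 \<sigma>)) \<or> (AE w in M. Z w = 0))"

definition centered_gaussian_process ::
    "'w measure \<Rightarrow> real set \<Rightarrow> (real \<Rightarrow> 'w \<Rightarrow> real) \<Rightarrow> bool" where
  "centered_gaussian_process M I Y \<longleftrightarrow>
     (\<forall>J c. finite J \<and> J \<subseteq> I \<longrightarrow> centered_gaussian M (\<lambda>w. \<Sum>t\<in>J. c t * Y t w))"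

definition cov :: "'w measure \<Rightarrow> (real \<Rightarrow> 'w \<Rightarrow> real) \<Rightarrow> real \<Rightarrow> real \<Rightarrow> real" where
  "cov M Y s t = (\<integral>w. Y s w * Y t w \<partial>M)"

text \<open>Elements of \<open>L2 N\<close> are functions, not classes modulo almost everywhere equality.\<close>

definition L2 :: "'a measure \<Rightarrow> ('a \<Rightarrow> 'b::real_normed_vector) set" where
  "L2 N = {f. f \<in> borel_measurable N \<and> integrable N (\<lambda>x. (norm (f x))\<^sup>2)}"

definition L2_tendsto ::
    "'a measure \<Rightarrow> (nat \<Rightarrow> 'a \<Rightarrow> 'b::real_normed_vector) \<Rightarrow> ('a \<Rightarrow> 'b) \<Rightarrow> bool" where
  "L2_tendsto N F f \<longleftrightarrow> (\<lambda>n. \<integral>x. (norm (F n x - f x))\<^sup>2 \<partial>N) \<longlonglongrightarrow> 0"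

section \<open>The Hilbert space H\<close>

text \<open>Throughout, \<open>mu\<close> is a measure whose space is the time interval, so that integrals with
  respect to \<open>mu\<close> are integrals over that interval, and \<open>Y\<close> is the centered Gaussian process.\<close>

definition cov_op_fun ::
    "'w measure \<Rightarrow> real measure \<Rightarrow> (real \<Rightarrow> 'w \<Rightarrow> real) \<Rightarrow> (real \<Rightarrow> real) \<Rightarrow> real \<Rightarrow> real" where
  "cov_op_fun M mu Y g t = (\<integral>s. g s * cov M Y s t \<partial>mu)"

text \<open>The type \<open>'h\<close> together with \<open>emb\<close> is the Hilbert space \<open>H\<close>: the completion of the quotient
  of \<open>L2 mu\<close> by the kernel of the form \<open>\<langle>h, \<Gamma> g\<rangle>\<close>. It is determined up to isometry by the
  condition below. Since \<open>L2 mu\<close> is separable for a finite Borel measure \<open>mu\<close> with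
  \<open>\<integral> \<gamma>(t,t) mu(dt) < \<infinity>\<close> and \<open>emb\<close> is then continuous, \<open>H\<close> is separable; the sort constraint
  \<open>second_countable_topology\<close> is thus no restriction.\<close>

definition is_H_completion ::
    "'w measure \<Rightarrow> real measure \<Rightarrow> (real \<Rightarrow> 'w \<Rightarrow> real) \<Rightarrow>
     ((real \<Rightarrow> real) \<Rightarrow> 'h::{real_inner, complete_space, second_countable_topology}) \<Rightarrow> bool" where
  "is_H_completion M mu Y emb \<longleftrightarrow>
     (\<forall>f\<in>L2 mu. \<forall>g\<in>L2 mu. \<forall>a b.
        emb (\<lambda>t. a * f t + b * g t) = a *\<^sub>R emb f + b *\<^sub>R emb g) \<and>
     (\<forall>f\<in>L2 mu. \<forall>g\<in>L2 mu. inner (emb f) (emb g) = (\<integral>t. f t * cov_op_fun M mu Y g t \<partial>mu)) \<and>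
     closure (emb ` L2 mu) = UNIV"

text \<open>A function belongs to the completion \<open>H\<close> if it is the \<open>mu\<close>-a.e. limit of a sequence
  of \<open>L2 mu\<close> functions converging in \<open>H\<close>. In particular all of \<open>L2 mu\<close> qualifies.\<close>

definition function_in_H ::
    "real measure \<Rightarrow> ((real \<Rightarrow> real) \<Rightarrow> 'h::{real_inner, complete_space, second_countable_topology}) \<Rightarrow>
     (real \<Rightarrow> real) \<Rightarrow> bool" where
  "function_in_H mu emb u \<longleftrightarrow> u \<in> borel_measurable mu \<and>
     (\<exists>g. (\<forall>n. g n \<in> L2 mu) \<and> convergent (\<lambda>n. emb (g n)) \<and>
          (AE t in mu. (\<lambda>n. g n t) \<longlonglongrightarrow> u t))"

text \<open>The integral of the process against a function, and its isometric extension to \<open>H\<close>.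
  The latter takes values in classes of random variables; \<open>gauss_int\<close> picks a representative.\<close>

definition gauss_int_fun ::
    "real measure \<Rightarrow> (real \<Rightarrow> 'w \<Rightarrow> real) \<Rightarrow> (real \<Rightarrow> real) \<Rightarrow> 'w \<Rightarrow> real" where
  "gauss_int_fun mu Y h w = (\<integral>s. Y s w * h s \<partial>mu)"

definition gauss_int ::
    "'w measure \<Rightarrow> real measure \<Rightarrow> (real \<Rightarrow> 'w \<Rightarrow> real) \<Rightarrow>
     ((real \<Rightarrow> real) \<Rightarrow> 'h::{real_inner, complete_space, second_countable_topology}) \<Rightarrow>
     'h \<Rightarrow> 'w \<Rightarrow> real" where
  "gauss_int M mu Y emb \<eta> =
     (SOME Z. Z \<in> L2 M \<and>
        (\<forall>g. (\<forall>n. g n \<in> L2 mu) \<and> (\<lambda>n. emb (g n)) \<longlonglongrightarrow> \<eta> \<longrightarrow>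
             L2_tendsto M (\<lambda>n. gauss_int_fun mu Y (g n)) Z))"

definition cov_op ::
    "'w measure \<Rightarrow> real measure \<Rightarrow> (real \<Rightarrow> 'w \<Rightarrow> real) \<Rightarrow>
     ((real \<Rightarrow> real) \<Rightarrow> 'h::{real_inner, complete_space, second_countable_topology}) \<Rightarrow>
     'h \<Rightarrow> real \<Rightarrow> real" where
  "cov_op M mu Y emb \<eta> t = (\<integral>w. gauss_int M mu Y emb \<eta> w * Y t w \<partial>M)"

section \<open>Malliavin derivative\<close>

text \<open>Functions on \<open>n\<close>-dimensional space are represented as functions of a sequence that depend
  only on its first \<open>n\<close> entries.\<close>

definition partial :: "nat \<Rightarrow> ((nat \<Rightarrow> real) \<Rightarrow> real) \<Rightarrow> (nat \<Rightarrow> real) \<Rightarrow> real" where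
  "partial i f x = deriv (\<lambda>s. f (x(i := s))) (x i)"

definition schwartz :: "nat \<Rightarrow> ((nat \<Rightarrow> real) \<Rightarrow> real) \<Rightarrow> bool" where
  "schwartz n f \<longleftrightarrow>
     (\<forall>x y. (\<forall>i<n. x i = y i) \<longrightarrow> f x = f y) \<and>
     (\<forall>js. set js \<subseteq> {..<n} \<longrightarrow>
        continuous_on UNIV (foldr partial js f) \<and>
        (\<forall>i<n. \<forall>x. (\<lambda>s. foldr partial js f (x(i := s))) differentiable (at (x i))) \<and>
        (\<forall>k. \<exists>C. \<forall>x. (\<Sum>i<n. (x i)\<^sup>2) ^ k * \<bar>foldr partial js f x\<bar> \<le> C))"

text \<open>The derivative on cylindrical functionals, as a relation between \<open>F\<close> and \<open>\<nabla> F\<close>.\<close>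

definition cylindrical ::
    "'w measure \<Rightarrow> real measure \<Rightarrow> (real \<Rightarrow> 'w \<Rightarrow> real) \<Rightarrow>
     ((real \<Rightarrow> real) \<Rightarrow> 'h::{real_inner, complete_space, second_countable_topology}) \<Rightarrow>
     ('w \<Rightarrow> real) \<Rightarrow> ('w \<Rightarrow> 'h) \<Rightarrow> bool" where
  "cylindrical M mu Y emb F G \<longleftrightarrow>
     (\<exists>n f h. n \<ge> 1 \<and> schwartz n f \<and>
        F = (\<lambda>w. f (\<lambda>i. gauss_int M mu Y emb (h i) w)) \<and>
        G = (\<lambda>w. \<Sum>i<n. partial i f (\<lambda>j. gauss_int M mu Y emb (h j) w) *\<^sub>R h i))"

text \<open>The graph of the closure. Because the derivative is closable, \<open>G\<close> is determined by \<open>F\<close>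
  up to almost sure equality.\<close>

definition nabla_graph ::
    "'w measure \<Rightarrow> real measure \<Rightarrow> (real \<Rightarrow> 'w \<Rightarrow> real) \<Rightarrow>
     ((real \<Rightarrow> real) \<Rightarrow> 'h::{real_inner, complete_space, second_countable_topology}) \<Rightarrow>
     ('w \<Rightarrow> real) \<Rightarrow> ('w \<Rightarrow> 'h) \<Rightarrow> bool" where
  "nabla_graph M mu Y emb F G \<longleftrightarrow> F \<in> L2 M \<and> G \<in> L2 M \<and>
     (\<exists>Fs Gs. (\<forall>k. cylindrical M mu Y emb (Fs k) (Gs k)) \<and>
        L2_tendsto M Fs F \<and> L2_tendsto M Gs G)"

definition Dom_nabla ::
    "'w measure \<Rightarrow> real measure \<Rightarrow> (real \<Rightarrow> 'w \<Rightarrow> real) \<Rightarrow>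
     ((real \<Rightarrow> real) \<Rightarrow> 'h::{real_inner, complete_space, second_countable_topology}) \<Rightarrow>
     ('w \<Rightarrow> real) set" where
  "Dom_nabla M mu Y emb = {F. \<exists>G. nabla_graph M mu Y emb F G}"

definition nabla ::
    "'w measure \<Rightarrow> real measure \<Rightarrow> (real \<Rightarrow> 'w \<Rightarrow> real) \<Rightarrow>
     ((real \<Rightarrow> real) \<Rightarrow> 'h::{real_inner, complete_space, second_countable_topology}) \<Rightarrow>
     ('w \<Rightarrow> real) \<Rightarrow> 'w \<Rightarrow> 'h" where
  "nabla M mu Y emb F = (SOME G. nabla_graph M mu Y emb F G)"

definition malliavin_D ::
    "'w measure \<Rightarrow> real measure \<Rightarrow> (real \<Rightarrow> 'w \<Rightarrow> real) \<Rightarrow>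
     ((real \<Rightarrow> real) \<Rightarrow> 'h::{real_inner, complete_space, second_countable_topology}) \<Rightarrow>
     real \<Rightarrow> ('w \<Rightarrow> real) \<Rightarrow> 'w \<Rightarrow> real" where
  "malliavin_D M mu Y emb t F w = cov_op M mu Y emb (nabla M mu Y emb F w) t"

section \<open>Stein's unbiased risk estimate\<close>

text \<open>For each \<open>t\<close>, the variable \<open>D\<^sub>t \<xi>\<^sub>t\<close> is only defined up to a null set depending on \<open>t\<close>, so
  the integral of \<open>D\<^sub>t \<xi>\<^sub>t\<close> over \<open>t\<close> is that of a jointly measurable version. By Fubini, any
  two such versions have almost surely the same integral.\<close>

definition D_version ::
    "'w measure \<Rightarrow> real measure \<Rightarrow> (real \<Rightarrow> 'w \<Rightarrow> real) \<Rightarrow>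
     ((real \<Rightarrow> real) \<Rightarrow> 'h::{real_inner, complete_space, second_countable_topology}) \<Rightarrow>
     (real \<Rightarrow> 'w \<Rightarrow> real) \<Rightarrow> (real \<Rightarrow> 'w \<Rightarrow> real) \<Rightarrow> bool" where
  "D_version M mu Y emb \<xi> V \<longleftrightarrow>
     (\<lambda>(t, w). V t w) \<in> borel_measurable (mu \<Otimes>\<^sub>M M) \<and>
     (AE t in mu. AE w in M. V t w = malliavin_D M mu Y emb t (\<xi> t) w)"

definition D_trace ::
    "'w measure \<Rightarrow> real measure \<Rightarrow> (real \<Rightarrow> 'w \<Rightarrow> real) \<Rightarrow>
     ((real \<Rightarrow> real) \<Rightarrow> 'h::{real_inner, complete_space, second_countable_topology}) \<Rightarrow>
     (real \<Rightarrow> 'w \<Rightarrow> real) \<Rightarrow> real \<Rightarrow> 'w \<Rightarrow> real" where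
  "D_trace M mu Y emb \<xi> = (SOME V. D_version M mu Y emb \<xi> V)"

text \<open>The conditions under which \<open>SURE\<close> below is meaningful for the estimator \<open>X + \<xi>\<close>.\<close>

definition SURE_defined ::
    "'w measure \<Rightarrow> real measure \<Rightarrow> (real \<Rightarrow> 'w \<Rightarrow> real) \<Rightarrow>
     ((real \<Rightarrow> real) \<Rightarrow> 'h::{real_inner, complete_space, second_countable_topology}) \<Rightarrow>
     (real \<Rightarrow> 'w \<Rightarrow> real) \<Rightarrow> bool" where
  "SURE_defined M mu Y emb \<xi> \<longleftrightarrow>
     (\<lambda>(t, w). \<xi> t w) \<in> borel_measurable (mu \<Otimes>\<^sub>M M) \<and>
     (AE t in mu. \<xi> t \<in> Dom_nabla M mu Y emb) \<and>
     (\<exists>V. D_version M mu Y emb \<xi> V) \<and>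
     (AE w in M. integrable mu (\<lambda>t. D_trace M mu Y emb \<xi> t w))"

text \<open>\<open>SURE M mu Y emb \<xi>\<close> is the risk estimate of \<open>X + \<xi>\<close>. It is extended-real valued, since
  the integral of \<open>|\<xi>\<^sub>t|\<^sup>2\<close> may be infinite.\<close>

definition SURE ::
    "'w measure \<Rightarrow> real measure \<Rightarrow> (real \<Rightarrow> 'w \<Rightarrow> real) \<Rightarrow>
     ((real \<Rightarrow> real) \<Rightarrow> 'h::{real_inner, complete_space, second_countable_topology}) \<Rightarrow>
     (real \<Rightarrow> 'w \<Rightarrow> real) \<Rightarrow> 'w \<Rightarrow> ereal" where
  "SURE M mu Y emb \<xi> w =
     ereal (\<integral>t. cov M Y t t \<partial>mu) + enn2ereal (\<integral>\<^sup>+t. ennreal (\<bar>\<xi> t w\<bar>\<^sup>2) \<partial>mu)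
     + ereal (2 * (\<integral>t. D_trace M mu Y emb \<xi> t w \<partial>mu))"

definition soft_xi :: "(real \<Rightarrow> real) \<Rightarrow> (real \<Rightarrow> real) \<Rightarrow> real \<Rightarrow> real \<Rightarrow> real" where
  "soft_xi \<alpha> l t x = - sgn (x - \<alpha> t) * min (l t) \<bar>x - \<alpha> t\<bar>"

end

theory Submission imports Defs "HOL-Real_Asymp.Real_Asymp" begin

text \<open>For \<open>\<mu>\<close>-almost every \<open>t\<close> the variable \<open>X\<^sup>u\<^sub>t\<close> is \<open>X\<^sup>u(h)\<close> for some \<open>h \<in> H\<close>: since the process is an \<open>L2\<close>
  function on the product space, averages of it over small cells of the time interval, which are
  integrals against \<open>L2\<close> functions, converge to it. The soft threshold
  \<open>(\<bar>x - \<alpha> - \<lambda>\<bar> - \<bar>x - \<alpha> + \<lambda>\<bar>) / 2\<close> is a Lipschitz function with almost everywhere derivative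
  \<open>- 1{\<bar>x - \<alpha>\<bar> \<le> \<lambda>}\<close>; smoothing the absolute values shows that its composition with \<open>X\<^sup>u(h)\<close> lies in
  the domain of the gradient, with gradient \<open>- 1{\<bar>X\<^sub>t - \<alpha>\<bar> \<le> \<lambda>} h\<close>. As \<open>(\<Gamma> h)(t) = \<gamma>(t,t)\<close>, the formula
  follows.

  The gradient of an element of the domain is determined only because the derivative is closable.
  This rests on integration by parts for cylindrical functionals: if \<open>\<eta>\<close> is a unit vector, the residuals
  \<open>X\<^sup>u(h\<^sub>i) - \<langle>h\<^sub>i,\<eta>\<rangle> X\<^sup>u(\<eta>)\<close> are independent of \<open>X\<^sup>u(\<eta>)\<close>, and one integrates by parts against the
  normal density in that variable alone.\<close>

section \<open>Square-integrable functions\<close>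

text \<open>No continuity of the covariance or of the paths is available, so nothing can be read off
  at a single time. Gaussianity is given for finite linear combinations of values of the process,
  while \<open>H\<close> is built from integrals. The two are linked by approximation on the product
  of time and probability space, in both directions: samples turn an integral into a finite
  combination, averages turn a value into an integral. The errors are controlled only after
  integration over time, hence the restriction to almost every \<open>t\<close>.

  The kinks of the threshold are the points where the smoothed derivatives tend to the wrong value.
  A nondegenerate Gaussian variable misses them almost surely; a degenerate one belongs to
  \<open>h = 0\<close>, where the gradient vanishes whatever the derivative does.

  Integrals, gradients and the trace are chosen representatives, so every identity holds up to a
  null set. Null sets that depend on \<open>t\<close> are handled by Fubini, those that depend on a
  direction in \<open>H\<close> by separability.\<close>

lemma norm_add_square_le:
  fixes a b :: "'a::real_normed_vector"
  shows "(norm (a + b))\<^sup>2 \<le> 2 * (norm a)\<^sup>2 + 2 * (norm b)\<^sup>2"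
proof -
  have "(norm (a + b))\<^sup>2 \<le> (norm a + norm b)\<^sup>2"
    by (intro power_mono norm_triangle_ineq) simp
  also have "\<dots> \<le> 2 * (norm a)\<^sup>2 + 2 * (norm b)\<^sup>2"
    using sum_squares_bound[of "norm a" "norm b"] by (simp add: power2_sum)
  finally show ?thesis .
qed

lemma abs_mult_le_squares: "\<bar>a * b :: real\<bar> \<le> a\<^sup>2 + b\<^sup>2"
proof -
  have "2 * \<bar>a\<bar> * \<bar>b\<bar> \<le> a\<^sup>2 + b\<^sup>2"
    using sum_squares_bound[of "\<bar>a\<bar>" "\<bar>b\<bar>"] by simp
  then show ?thesis
    using mult_nonneg_nonneg[OF abs_ge_zero[of a] abs_ge_zero[of b]]
    by (simp add: abs_mult del: mult_nonneg_nonneg)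
qed

lemma L2_measurable: "f \<in> L2 N \<Longrightarrow> f \<in> borel_measurable N"
  by (simp add: L2_def)

lemma L2_integrable: "f \<in> L2 N \<Longrightarrow> integrable N (\<lambda>x. (norm (f x))\<^sup>2)"
  by (simp add: L2_def)

lemma L2_integrable_real: "f \<in> L2 N \<Longrightarrow> integrable N (\<lambda>x. (f x :: real)\<^sup>2)"
  using L2_integrable by fastforce

lemma L2_real_iff: "f \<in> L2 N \<longleftrightarrow> f \<in> borel_measurable N \<and> integrable N (\<lambda>x. (f x :: real)\<^sup>2)"
  by (simp add: L2_def)

lemma L2_AE_cong:
  assumes "f \<in> L2 N" "g \<in> borel_measurable N" "AE x in N. f x = g x"
  shows "g \<in> L2 N"
proof -
  have "integrable N (\<lambda>x. (norm (g x))\<^sup>2)"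
    using L2_integrable[OF assms(1)]
  proof (rule integrable_cong_AE_imp)
    show "(\<lambda>x. (norm (g x))\<^sup>2) \<in> borel_measurable N"
      using assms(2) by measurable
    show "AE x in N. (norm (f x))\<^sup>2 = (norm (g x))\<^sup>2" using assms(3) by auto
  qed
  then show ?thesis using assms(2) by (simp add: L2_def)
qed

lemma L2_add:
  fixes f g :: "'a \<Rightarrow> 'b::{real_normed_vector, second_countable_topology}"
  assumes "f \<in> L2 N" "g \<in> L2 N"
  shows "(\<lambda>x. f x + g x) \<in> L2 N"
proof -
  note [measurable] = L2_measurable[OF assms(1)] L2_measurable[OF assms(2)]
  have "integrable N (\<lambda>x. (norm (f x + g x))\<^sup>2)"
  proof (rule Bochner_Integration.integrable_bound)
    show "integrable N (\<lambda>x. 2 * (norm (f x))\<^sup>2 + 2 * (norm (g x))\<^sup>2)"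
      using L2_integrable[OF assms(1)] L2_integrable[OF assms(2)] by simp
    show "AE x in N. norm ((norm (f x + g x))\<^sup>2) \<le> norm (2 * (norm (f x))\<^sup>2 + 2 * (norm (g x))\<^sup>2)"
      using norm_add_square_le by (intro AE_I2) (simp add: abs_le_iff)
  qed simp
  then show ?thesis by (simp add: L2_def)
qed

lemma L2_scaleR:
  fixes f :: "'a \<Rightarrow> 'b::{real_normed_vector, second_countable_topology}"
  assumes "f \<in> L2 N"
  shows "(\<lambda>x. c *\<^sub>R f x) \<in> L2 N"
  using assms by (auto simp: L2_def power_mult_distrib)

lemma L2_mult: "f \<in> L2 N \<Longrightarrow> (\<lambda>x. c * f x :: real) \<in> L2 N"
  using L2_scaleR[of f N c] by simp

lemma L2_diff:
  fixes f g :: "'a \<Rightarrow> 'b::{real_normed_vector, second_countable_topology}"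
  assumes "f \<in> L2 N" "g \<in> L2 N"
  shows "(\<lambda>x. f x - g x) \<in> L2 N"
  using L2_add[OF assms(1) L2_scaleR[OF assms(2), of "-1"]] by simp

lemma L2_zero: "(\<lambda>x. 0) \<in> L2 N"
  by (simp add: L2_def)

lemma L2_sum:
  fixes f :: "'i \<Rightarrow> 'a \<Rightarrow> 'b::{real_normed_vector, second_countable_topology}"
  assumes "\<And>i. i \<in> J \<Longrightarrow> f i \<in> L2 N"
  shows "(\<lambda>x. \<Sum>i\<in>J. f i x) \<in> L2 N"
  using assms
proof (induction J rule: infinite_finite_induct)
  case (insert j J)
  then show ?case using L2_add[of "f j" N "\<lambda>x. \<Sum>i\<in>J. f i x"] by simp
qed (simp_all add: L2_zero)

lemma L2_mult_bounded:
  fixes f g :: "'a \<Rightarrow> real"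
  assumes "f \<in> L2 N" "g \<in> borel_measurable N" "\<And>x. x \<in> space N \<Longrightarrow> \<bar>g x\<bar> \<le> C"
  shows "(\<lambda>x. g x * f x) \<in> L2 N"
proof -
  note [measurable] = L2_measurable[OF assms(1)] assms(2)
  have "integrable N (\<lambda>x. (g x * f x)\<^sup>2)"
  proof (rule Bochner_Integration.integrable_bound)
    show "integrable N (\<lambda>x. C\<^sup>2 * (f x)\<^sup>2)"
      using L2_integrable_real[OF assms(1)] by simp
    show "AE x in N. norm ((g x * f x)\<^sup>2) \<le> norm (C\<^sup>2 * (f x)\<^sup>2)"
    proof (rule AE_I2)
      fix x assume "x \<in> space N"
      then have "(g x)\<^sup>2 \<le> C\<^sup>2" using power_mono[OF assms(3), of x 2] by simp
      then show "norm ((g x * f x)\<^sup>2) \<le> norm (C\<^sup>2 * (f x)\<^sup>2)"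
        by (simp add: power_mult_distrib mult_right_mono)
    qed
  qed simp
  then show ?thesis by (simp add: L2_real_iff)
qed

lemma (in finite_measure) L2_bounded:
  fixes f :: "'a \<Rightarrow> 'b::{real_normed_vector, second_countable_topology}"
  assumes "f \<in> borel_measurable M" "\<And>x. x \<in> space M \<Longrightarrow> norm (f x) \<le> C"
  shows "f \<in> L2 M"
proof -
  note [measurable] = assms(1)
  have "integrable M (\<lambda>x. (norm (f x))\<^sup>2)"
    using power_mono[OF assms(2), of _ 2]
    by (intro integrable_const_bound[where B = "C\<^sup>2"] AE_I2) auto
  then show ?thesis by (simp add: L2_def)
qed

lemma L2_mult_integrable:
  fixes f g :: "'a \<Rightarrow> real"
  assumes "f \<in> L2 N" "g \<in> L2 N"
  shows "integrable N (\<lambda>x. f x * g x)"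
proof (rule Bochner_Integration.integrable_bound)
  show "integrable N (\<lambda>x. (f x)\<^sup>2 + (g x)\<^sup>2)"
    using L2_integrable_real[OF assms(1)] L2_integrable_real[OF assms(2)] by simp
  show "(\<lambda>x. f x * g x) \<in> borel_measurable N"
    using L2_measurable[OF assms(1)] L2_measurable[OF assms(2)] by measurable
  show "AE x in N. norm (f x * g x) \<le> norm ((f x)\<^sup>2 + (g x)\<^sup>2)"
    using abs_mult_le_squares by (intro AE_I2) simp
qed

lemma (in finite_measure) L2_integrable_id:
  fixes f :: "'a \<Rightarrow> real"
  assumes "f \<in> L2 M" shows "integrable M f"
  by (rule square_integrable_imp_integrable[OF L2_measurable[OF assms] L2_integrable_real[OF assms]])

text \<open>The nonnegative quadratic \<open>A + 2 * t * B + t^2 * C\<close> is evaluated at its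
  minimiser \<open>- B / C\<close>, the case \<open>C = 0\<close> apart.\<close>

lemma Cauchy_Schwarz_integral:
  fixes f g :: "'a \<Rightarrow> real"
  assumes "f \<in> L2 N" "g \<in> L2 N"
  shows "(\<integral>x. f x * g x \<partial>N)\<^sup>2 \<le> (\<integral>x. (f x)\<^sup>2 \<partial>N) * (\<integral>x. (g x)\<^sup>2 \<partial>N)"
proof -
  define A B C where "A = (\<integral>x. (f x)\<^sup>2 \<partial>N)" "B = (\<integral>x. f x * g x \<partial>N)" "C = (\<integral>x. (g x)\<^sup>2 \<partial>N)"
  have *: "0 \<le> A + 2 * t * B + t\<^sup>2 * C" for t
  proof -
    have "0 \<le> (\<integral>x. (f x + t * g x)\<^sup>2 \<partial>N)" by simp
    also have "(\<lambda>x. (f x + t * g x)\<^sup>2) = (\<lambda>x. (f x)\<^sup>2 + 2 * t * (f x * g x) + t\<^sup>2 * (g x)\<^sup>2)"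
      by (simp add: power2_sum power_mult_distrib algebra_simps fun_eq_iff)
    also have "(\<integral>x. (f x)\<^sup>2 + 2 * t * (f x * g x) + t\<^sup>2 * (g x)\<^sup>2 \<partial>N) = A + 2 * t * B + t\<^sup>2 * C"
      using L2_integrable_real[OF assms(1)] L2_integrable_real[OF assms(2)]
        L2_mult_integrable[OF assms] by (simp add: A_B_C_def)
    finally show ?thesis .
  qed
  have "C \<ge> 0" by (simp add: A_B_C_def)
  have "B\<^sup>2 \<le> A * C"
  proof (cases "C = 0")
    case True
    have "B = 0"
    proof (rule ccontr)
      assume "B \<noteq> 0"
      \<comment> \<open>For \<open>C = 0\<close> the quadratic is affine, and this \<open>t\<close>
        gives it the value -1.\<close>
      then show False using *[of "- (A + 1) / (2 * B)"] True by (simp add: field_simps)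
    qed
    then show ?thesis using True by simp
  next
    case False
    then have "C > 0" using \<open>C \<ge> 0\<close> by simp
    then have "0 \<le> C * (A + 2 * (- B / C) * B + (- B / C)\<^sup>2 * C)" using *[of "- B / C"] by simp
    also have "\<dots> = A * C - B\<^sup>2" using \<open>C > 0\<close> by (simp add: field_simps power2_eq_square)
    finally show ?thesis by simp
  qed
  then show ?thesis by (simp add: A_B_C_def)
qed

section \<open>Convergence in mean square\<close>

lemma L2_tendsto_cong:
  assumes "\<And>n. AE x in N. F n x = F' n x" "AE x in N. f x = f' x"
    and "\<And>n. F n \<in> borel_measurable N" "\<And>n. F' n \<in> borel_measurable N"
    and "f \<in> borel_measurable N" "f' \<in> borel_measurable N"
    and "L2_tendsto N F f"
  shows "L2_tendsto N F' (f' :: 'a \<Rightarrow> 'b::{real_normed_vector, second_countable_topology})"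
proof -
  have "(\<integral>x. (norm (F n x - f x))\<^sup>2 \<partial>N) = (\<integral>x. (norm (F' n x - f' x))\<^sup>2 \<partial>N)" for n
  proof (rule integral_cong_AE)
    show "AE x in N. (norm (F n x - f x))\<^sup>2 = (norm (F' n x - f' x))\<^sup>2"
      using assms(1)[of n] assms(2) by auto
  qed (use assms in measurable)
  then show ?thesis using assms(7) by (simp add: L2_tendsto_def)
qed

lemma L2_tendsto_bound:
  assumes "\<And>n. (\<integral>x. (norm (F n x - f x))\<^sup>2 \<partial>N) \<le> e n" "e \<longlonglongrightarrow> 0"
  shows "L2_tendsto N F f"
  unfolding L2_tendsto_def
  by (rule tendsto_sandwich[OF _ _ tendsto_const assms(2)]) (use assms in auto)

lemma L2_dist_add_le:
  fixes f g h :: "'a \<Rightarrow> 'b::{real_normed_vector, second_countable_topology}"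
  assumes "f \<in> L2 N" "g \<in> L2 N"
  shows "(\<integral>x. (norm (f x + g x))\<^sup>2 \<partial>N) \<le> 2 * (\<integral>x. (norm (f x))\<^sup>2 \<partial>N) + 2 * (\<integral>x. (norm (g x))\<^sup>2 \<partial>N)"
proof -
  have "(\<integral>x. (norm (f x + g x))\<^sup>2 \<partial>N) \<le> (\<integral>x. 2 * (norm (f x))\<^sup>2 + 2 * (norm (g x))\<^sup>2 \<partial>N)"
    using L2_integrable[OF assms(1)] L2_integrable[OF assms(2)] L2_integrable[OF L2_add[OF assms]]
    by (intro integral_mono norm_add_square_le) auto
  then show ?thesis
    using L2_integrable[OF assms(1)] L2_integrable[OF assms(2)] by simp
qed

text \<open>The Bochner integral of a non-integrable function is 0, so \<open>L2_tendsto\<close> is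
  informative only next to membership in \<open>L2\<close>; hence the memberships among the
  assumptions.\<close>

lemma L2_tendsto_add:
  fixes f g :: "'a \<Rightarrow> 'b::{real_normed_vector, second_countable_topology}"
  assumes "L2_tendsto N F f" "L2_tendsto N G g"
    and "\<And>n. F n \<in> L2 N" "\<And>n. G n \<in> L2 N" "f \<in> L2 N" "g \<in> L2 N"
  shows "L2_tendsto N (\<lambda>n x. F n x + G n x) (\<lambda>x. f x + g x)"
proof (rule L2_tendsto_bound)
  fix n
  show "(\<integral>x. (norm (F n x + G n x - (f x + g x)))\<^sup>2 \<partial>N)
      \<le> 2 * (\<integral>x. (norm (F n x - f x))\<^sup>2 \<partial>N) + 2 * (\<integral>x. (norm (G n x - g x))\<^sup>2 \<partial>N)"
    using L2_dist_add_le[OF L2_diff[OF assms(3,5)] L2_diff[OF assms(4,6)], of n n]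
    by (simp add: algebra_simps)
next
  show "(\<lambda>n. 2 * (\<integral>x. (norm (F n x - f x))\<^sup>2 \<partial>N) + 2 * (\<integral>x. (norm (G n x - g x))\<^sup>2 \<partial>N)) \<longlonglongrightarrow> 0"
    using assms(1,2) unfolding L2_tendsto_def by (auto intro!: tendsto_eq_intros)
qed

lemma L2_tendsto_scaleR:
  assumes "L2_tendsto N F f"
  shows "L2_tendsto N (\<lambda>n x. c *\<^sub>R F n x) (\<lambda>x. c *\<^sub>R f x)"
  using tendsto_mult_left[OF assms[unfolded L2_tendsto_def], of "c\<^sup>2"]
  by (simp add: L2_tendsto_def scaleR_diff_right[symmetric] power_mult_distrib)

lemma L2_tendsto_diff:
  fixes f g :: "'a \<Rightarrow> 'b::{real_normed_vector, second_countable_topology}"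
  assumes "L2_tendsto N F f" "L2_tendsto N G g"
    and "\<And>n. F n \<in> L2 N" "\<And>n. G n \<in> L2 N" "f \<in> L2 N" "g \<in> L2 N"
  shows "L2_tendsto N (\<lambda>n x. F n x - G n x) (\<lambda>x. f x - g x)"
  using L2_tendsto_add[OF assms(1) L2_tendsto_scaleR[OF assms(2), of "-1"] assms(3)
      L2_scaleR[OF assms(4)] assms(5) L2_scaleR[OF assms(6)]] by simp

text \<open>Subtracting the two convergences makes the constant zero sequence tend to
  \<open>f - g\<close>.\<close>

lemma L2_tendsto_unique:
  fixes f g :: "'a \<Rightarrow> 'b::{real_normed_vector, second_countable_topology}"
  assumes "L2_tendsto N F f" "L2_tendsto N F g"
    and "\<And>n. F n \<in> L2 N" "f \<in> L2 N" "g \<in> L2 N"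
  shows "AE x in N. f x = g x"
proof -
  have "L2_tendsto N (\<lambda>n x. F n x - F n x) (\<lambda>x. f x - g x)"
    by (rule L2_tendsto_diff[OF assms(1,2,3,3,4,5)])
  then have "(\<integral>x. (norm (f x - g x))\<^sup>2 \<partial>N) = 0"
    by (simp add: L2_tendsto_def norm_minus_commute LIMSEQ_const_iff)
  then have "AE x in N. (norm (f x - g x))\<^sup>2 = 0"
    using L2_integrable[OF L2_diff[OF assms(4,5)]]
    by (subst (asm) integral_nonneg_eq_0_iff_AE) auto
  then show ?thesis by auto
qed

text \<open>Strong convergence implies weak convergence: Cauchy-Schwarz applied to
  \<open>F n - f\<close> and \<open>W\<close>.\<close>

lemma L2_tendsto_integral_mult:
  fixes f W :: "'a \<Rightarrow> real"
  assumes "L2_tendsto N F f" "\<And>n. F n \<in> L2 N" "f \<in> L2 N" "W \<in> L2 N"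
  shows "(\<lambda>n. \<integral>x. F n x * W x \<partial>N) \<longlonglongrightarrow> (\<integral>x. f x * W x \<partial>N)"
proof -
  have "(\<lambda>n. ((\<integral>x. F n x * W x \<partial>N) - (\<integral>x. f x * W x \<partial>N))\<^sup>2) \<longlonglongrightarrow> 0"
  proof (rule tendsto_sandwich[OF _ _ tendsto_const])
    show "\<forall>\<^sub>F n in sequentially. ((\<integral>x. F n x * W x \<partial>N) - (\<integral>x. f x * W x \<partial>N))\<^sup>2
        \<le> (\<integral>x. (norm (F n x - f x))\<^sup>2 \<partial>N) * (\<integral>x. (W x)\<^sup>2 \<partial>N)"
    proof (intro always_eventually allI)
      fix n
      have "(\<integral>x. F n x * W x \<partial>N) - (\<integral>x. f x * W x \<partial>N) = (\<integral>x. (F n x - f x) * W x \<partial>N)"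
        using L2_mult_integrable[OF assms(2,4)] L2_mult_integrable[OF assms(3,4)]
        by (simp add: left_diff_distrib)
      then show "((\<integral>x. F n x * W x \<partial>N) - (\<integral>x. f x * W x \<partial>N))\<^sup>2
        \<le> (\<integral>x. (norm (F n x - f x))\<^sup>2 \<partial>N) * (\<integral>x. (W x)\<^sup>2 \<partial>N)"
        using Cauchy_Schwarz_integral[OF L2_diff[OF assms(2,3)] assms(4), of n] by simp
    qed
    show "(\<lambda>n. (\<integral>x. (norm (F n x - f x))\<^sup>2 \<partial>N) * (\<integral>x. (W x)\<^sup>2 \<partial>N)) \<longlonglongrightarrow> 0"
      using assms(1) unfolding L2_tendsto_def by (auto intro!: tendsto_eq_intros)
  qed simp
  then have "(\<lambda>n. (\<integral>x. F n x * W x \<partial>N) - (\<integral>x. f x * W x \<partial>N)) \<longlonglongrightarrow> 0"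
    using tendsto_real_sqrt[of _ 0] by (fastforce simp: tendsto_rabs_zero_iff)
  then show ?thesis by (simp add: LIM_zero_iff)
qed

text \<open>Expanding \<open>F n = (F n - f) + f\<close> leaves the squared distance and a cross
  term against the fixed \<open>f\<close>, to which weak convergence applies.\<close>

lemma L2_tendsto_integral_square:
  fixes f :: "'a \<Rightarrow> real"
  assumes "L2_tendsto N F f" "\<And>n. F n \<in> L2 N" "f \<in> L2 N"
  shows "(\<lambda>n. \<integral>x. (F n x)\<^sup>2 \<partial>N) \<longlonglongrightarrow> (\<integral>x. (f x)\<^sup>2 \<partial>N)"
proof -
  have "(\<lambda>n. (\<integral>x. (norm (F n x - f x))\<^sup>2 \<partial>N) + 2 * (\<integral>x. F n x * f x \<partial>N) - (\<integral>x. f x * f x \<partial>N))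
    \<longlonglongrightarrow> 0 + 2 * (\<integral>x. f x * f x \<partial>N) - (\<integral>x. f x * f x \<partial>N)"
    using assms(1) unfolding L2_tendsto_def
    by (intro tendsto_intros L2_tendsto_integral_mult assms)
  moreover have "(\<integral>x. (norm (F n x - f x))\<^sup>2 \<partial>N) + 2 * (\<integral>x. F n x * f x \<partial>N) - (\<integral>x. f x * f x \<partial>N)
      = (\<integral>x. (F n x)\<^sup>2 \<partial>N)" for n
  proof -
    have "(\<integral>x. (F n x)\<^sup>2 \<partial>N) = (\<integral>x. (norm (F n x - f x))\<^sup>2 + 2 * (F n x * f x) - f x * f x \<partial>N)"
      by (intro Bochner_Integration.integral_cong refl) (simp add: power2_eq_square algebra_simps)
    then show ?thesis
      using L2_integrable[OF L2_diff[OF assms(2,3)]] L2_mult_integrable[OF assms(2,3)]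
        L2_mult_integrable[OF assms(3,3)] by simp
  qed
  ultimately show ?thesis by (simp add: power2_eq_square)
qed

lemma L2_inner:
  fixes f :: "'a \<Rightarrow> 'b::{real_inner, second_countable_topology}"
  assumes "f \<in> L2 N"
  shows "(\<lambda>x. inner (f x) \<eta>) \<in> L2 N"
proof -
  note [measurable] = L2_measurable[OF assms]
  have "integrable N (\<lambda>x. (inner (f x) \<eta>)\<^sup>2)"
  proof (rule Bochner_Integration.integrable_bound)
    show "integrable N (\<lambda>x. (norm (f x))\<^sup>2 * (norm \<eta>)\<^sup>2)"
      using L2_integrable[OF assms] by simp
    show "AE x in N. norm ((inner (f x) \<eta>)\<^sup>2) \<le> norm ((norm (f x))\<^sup>2 * (norm \<eta>)\<^sup>2)"
      using Cauchy_Schwarz_ineq[of _ \<eta>] by (intro AE_I2) (simp add: power2_norm_eq_inner)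
  qed measurable
  then show ?thesis by (simp add: L2_real_iff)
qed

lemma L2_tendsto_inner:
  fixes f :: "'a \<Rightarrow> 'b::{real_inner, second_countable_topology}"
  assumes "L2_tendsto N F f" "\<And>n. F n \<in> L2 N" "f \<in> L2 N"
  shows "L2_tendsto N (\<lambda>n x. inner (F n x) \<eta>) (\<lambda>x. inner (f x) \<eta>)"
proof (rule L2_tendsto_bound)
  fix n
  note d = L2_diff[OF assms(2,3), of n]
  have "(\<integral>x. (inner (F n x - f x) \<eta>)\<^sup>2 \<partial>N) \<le> (\<integral>x. (norm (F n x - f x))\<^sup>2 * (norm \<eta>)\<^sup>2 \<partial>N)"
    using L2_integrable[OF d] L2_integrable_real[OF L2_inner[OF d, of \<eta>]]
      Cauchy_Schwarz_ineq[of _ \<eta>] by (intro integral_mono) (auto simp: power2_norm_eq_inner)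
  then show "(\<integral>x. (norm (inner (F n x) \<eta> - inner (f x) \<eta>))\<^sup>2 \<partial>N)
      \<le> (\<integral>x. (norm (F n x - f x))\<^sup>2 \<partial>N) * (norm \<eta>)\<^sup>2"
    by (simp add: inner_diff_left)
next
  show "(\<lambda>n. (\<integral>x. (norm (F n x - f x))\<^sup>2 \<partial>N) * (norm \<eta>)\<^sup>2) \<longlonglongrightarrow> 0"
    using assms(1) unfolding L2_tendsto_def by (auto intro!: tendsto_eq_intros)
qed

lemma (in prob_space) integral_abs_square_le:
  assumes "f \<in> L2 M"
  shows "(\<integral>x. \<bar>f x\<bar> \<partial>M)\<^sup>2 \<le> (\<integral>x. (f x :: real)\<^sup>2 \<partial>M)"
proof -
  have "(\<lambda>x. \<bar>f x\<bar>) \<in> L2 M" "(\<lambda>x. 1 :: real) \<in> L2 M"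
    using assms by (auto simp: L2_real_iff)
  from Cauchy_Schwarz_integral[OF this] show ?thesis by (simp add: prob_space)
qed

section \<open>Gaussian variables\<close>

text \<open>This form of Gaussianity is visibly stable under limits in \<open>L2\<close> and covers the degenerate
  case.\<close>

definition gaussian_char :: "'w measure \<Rightarrow> ('w \<Rightarrow> real) \<Rightarrow> bool" where
  "gaussian_char M Z \<longleftrightarrow> Z \<in> L2 M \<and>
     (\<forall>u. (\<integral>w. cis (u * Z w) \<partial>M) = complex_of_real (exp (- (u\<^sup>2 * (\<integral>w. (Z w)\<^sup>2 \<partial>M)) / 2)))"

lemma norm_cis_diff_le: "norm (cis a - cis b) \<le> \<bar>a - b\<bar>"
proof -
  have "cis a - cis b = cis b * (cis (a - b) - 1)"
    by (simp add: right_diff_distrib cis_mult)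
  then have "norm (cis a - cis b) = norm (cis (a - b) - 1)"
    by (simp add: norm_mult)
  also have "\<dots> \<le> \<bar>a - b\<bar>"
    using iexp_approx1[of "a - b" 0] by (simp add: cis_conv_exp)
  finally show ?thesis .
qed

lemma cis_measurable [measurable]: "cis \<in> borel_measurable borel"
  by (intro borel_measurable_continuous_onI continuous_intros)

lemma (in finite_measure) integrable_cis:
  assumes [measurable]: "f \<in> borel_measurable M"
  shows "integrable M (\<lambda>x. cis (f x))"
  by (rule integrable_const_bound[where B = 1]) auto

context prob_space
begin

text \<open>\<open>cis\<close> is 1-Lipschitz, so the characteristic functions differ by at most a
  multiple of the L1 distance, hence of the L2 distance. The second moments converge too, and both
  sides of the defining identity pass to the limit.\<close>

lemma gaussian_char_limit:
  assumes "L2_tendsto M Z z" "\<And>n. gaussian_char M (Z n)" "z \<in> L2 M"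
  shows "gaussian_char M z"
  unfolding gaussian_char_def
proof (intro conjI allI)
  fix u
  have Zn: "Z n \<in> L2 M" for n using assms(2) by (simp add: gaussian_char_def)
  note [measurable] = L2_measurable[OF Zn] L2_measurable[OF assms(3)]
  have "(\<lambda>n. (\<integral>w. cis (u * Z n w) \<partial>M) - (\<integral>w. cis (u * z w) \<partial>M)) \<longlonglongrightarrow> 0"
  proof (rule Lim_null_comparison)
    show "\<forall>\<^sub>F n in sequentially. norm ((\<integral>w. cis (u * Z n w) \<partial>M) - (\<integral>w. cis (u * z w) \<partial>M))
        \<le> \<bar>u\<bar> * sqrt (\<integral>w. (norm (Z n w - z w))\<^sup>2 \<partial>M)"
    proof (intro always_eventually allI)
      fix n
      have "norm ((\<integral>w. cis (u * Z n w) \<partial>M) - (\<integral>w. cis (u * z w) \<partial>M))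
          = norm (\<integral>w. cis (u * Z n w) - cis (u * z w) \<partial>M)"
        by (subst Bochner_Integration.integral_diff) (auto intro!: integrable_cis)
      also have "\<dots> \<le> (\<integral>w. norm (cis (u * Z n w) - cis (u * z w)) \<partial>M)"
        by (rule integral_norm_bound)
      also have "\<dots> \<le> (\<integral>w. \<bar>u\<bar> * \<bar>Z n w - z w\<bar> \<partial>M)"
      proof (rule integral_mono)
        show "integrable M (\<lambda>w. norm (cis (u * Z n w) - cis (u * z w)))"
          by (intro integrable_norm Bochner_Integration.integrable_diff integrable_cis) auto
        show "integrable M (\<lambda>w. \<bar>u\<bar> * \<bar>Z n w - z w\<bar>)"
          using L2_integrable_id[OF L2_diff[OF Zn assms(3)]] by simp
        show "norm (cis (u * Z n w) - cis (u * z w)) \<le> \<bar>u\<bar> * \<bar>Z n w - z w\<bar>" for w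
          using norm_cis_diff_le[of "u * Z n w" "u * z w"]
          by (simp add: right_diff_distrib[symmetric] abs_mult)
      qed
      also have "\<dots> \<le> \<bar>u\<bar> * sqrt (\<integral>w. (norm (Z n w - z w))\<^sup>2 \<partial>M)"
        using integral_abs_square_le[OF L2_diff[OF Zn assms(3)], of n]
        by (auto intro!: mult_left_mono real_le_rsqrt)
      finally show "norm ((\<integral>w. cis (u * Z n w) \<partial>M) - (\<integral>w. cis (u * z w) \<partial>M))
        \<le> \<bar>u\<bar> * sqrt (\<integral>w. (norm (Z n w - z w))\<^sup>2 \<partial>M)" .
    qed
    show "(\<lambda>n. \<bar>u\<bar> * sqrt (\<integral>w. (norm (Z n w - z w))\<^sup>2 \<partial>M)) \<longlonglongrightarrow> 0"
      using assms(1) unfolding L2_tendsto_def by (auto intro!: tendsto_eq_intros)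
  qed
  then have "(\<lambda>n. \<integral>w. cis (u * Z n w) \<partial>M) \<longlonglongrightarrow> (\<integral>w. cis (u * z w) \<partial>M)"
    by (simp add: LIM_zero_iff)
  moreover have "(\<lambda>n. complex_of_real (exp (- (u\<^sup>2 * (\<integral>w. (Z n w)\<^sup>2 \<partial>M)) / 2)))
      \<longlonglongrightarrow> complex_of_real (exp (- (u\<^sup>2 * (\<integral>w. (z w)\<^sup>2 \<partial>M)) / 2))"
    by (intro tendsto_intros L2_tendsto_integral_square assms Zn) simp
  moreover have "(\<lambda>n. \<integral>w. cis (u * Z n w) \<partial>M)
      = (\<lambda>n. complex_of_real (exp (- (u\<^sup>2 * (\<integral>w. (Z n w)\<^sup>2 \<partial>M)) / 2)))"
    using assms(2) by (auto simp: gaussian_char_def)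
  ultimately show "(\<integral>w. cis (u * z w) \<partial>M) = complex_of_real (exp (- (u\<^sup>2 * (\<integral>w. (z w)\<^sup>2 \<partial>M)) / 2))"
    by (metis LIMSEQ_unique)
qed fact

lemma gaussian_char_cong:
  assumes "gaussian_char M Z" "AE w in M. Z w = Z' w" "Z' \<in> borel_measurable M"
  shows "gaussian_char M Z'"
proof -
  have "Z \<in> L2 M" using assms(1) by (simp add: gaussian_char_def)
  note [measurable] = L2_measurable[OF this] assms(3)
  have "(\<integral>w. cis (u * Z w) \<partial>M) = (\<integral>w. cis (u * Z' w) \<partial>M)" for u
    using assms(2) by (intro integral_cong_AE) auto
  moreover have "(\<integral>w. (Z w)\<^sup>2 \<partial>M) = (\<integral>w. (Z' w)\<^sup>2 \<partial>M)"
    using assms(2) by (intro integral_cong_AE) auto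
  ultimately show ?thesis
    using assms(1) L2_AE_cong[OF \<open>Z \<in> L2 M\<close> assms(3,2)] by (simp add: gaussian_char_def)
qed

lemma centered_gaussian_imp_gaussian_char:
  assumes "centered_gaussian M Z"
  shows "gaussian_char M Z"
proof -
  have [measurable]: "Z \<in> borel_measurable M" using assms by (simp add: centered_gaussian_def)
  consider (deg) "AE w in M. Z w = 0"
    | (nondeg) \<sigma> where "\<sigma> > 0" "distributed M lborel Z (normal_density 0 \<sigma>)"
    using assms by (auto simp: centered_gaussian_def)
  then show ?thesis
  proof cases
    case deg
    have "gaussian_char M (\<lambda>w. 0)"
      by (simp add: gaussian_char_def L2_zero prob_space cis_zero)
    then show ?thesis using deg by (intro gaussian_char_cong[of "\<lambda>w. 0" Z]) auto
  next
    case nondeg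
    have var: "(\<integral>w. (Z w)\<^sup>2 \<partial>M) = \<sigma>\<^sup>2"
      using normal_distributed_variance[OF nondeg] normal_distributed_expectation[OF nondeg] by simp
    have "integrable lborel (\<lambda>x. normal_density 0 \<sigma> x * x\<^sup>2)"
      using integrable_normal_moment[OF nondeg(1), of 0 2] by simp
    then have "integrable M (\<lambda>w. (Z w)\<^sup>2)"
      using distributed_integrable[OF nondeg(2), of "\<lambda>x. x\<^sup>2"] by simp
    then have L2: "Z \<in> L2 M" by (simp add: L2_real_iff)
    have S: "distributed M lborel (\<lambda>x. Z x / \<sigma>) std_normal_density"
      using normal_standard_normal_convert[OF nondeg(1), of Z 0] nondeg(2) by simp
    have "(\<integral>w. cis (u * Z w) \<partial>M) = complex_of_real (exp (- (u\<^sup>2 * \<sigma>\<^sup>2) / 2))" for u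
    proof -
      have "(\<integral>w. cis (u * Z w) \<partial>M) = (\<integral>w. iexp ((u * \<sigma>) * (Z w / \<sigma>)) \<partial>M)"
        using nondeg(1) by (simp add: cis_conv_exp)
      also have "\<dots> = (\<integral>x. iexp ((u * \<sigma>) * x) \<partial>distr M lborel (\<lambda>w. Z w / \<sigma>))"
        by (subst integral_distr) auto
      also have "distr M lborel (\<lambda>w. Z w / \<sigma>) = density lborel std_normal_density"
        using S by (simp add: distributed_def)
      also have "(\<integral>x. iexp ((u * \<sigma>) * x) \<partial>density lborel std_normal_density)
          = complex_of_real (exp (- ((u * \<sigma>)\<^sup>2) / 2))"
        using fun_cong[OF char_std_normal_distribution, of "u * \<sigma>"] by (simp add: char_def)
      finally show ?thesis by (simp add: power_mult_distrib)
    qed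
    then show ?thesis using L2 var by (simp add: gaussian_char_def)
  qed
qed

end

section \<open>Finite measures with equal characteristic functions\<close>

text \<open>Levy uniqueness concerns probability measures, whereas the weighted measures to which
  this is applied have arbitrary finite mass. At \<open>u = 0\<close> the hypothesis says that the
  total masses agree, so both measures can be divided by \<open>m\<close>; for \<open>m = 0\<close>
  both vanish.\<close>

lemma distr_eqI_char:
  fixes M1 M2 :: "'c measure"
  assumes "finite_measure M1" "finite_measure M2"
    and [measurable]: "X1 \<in> borel_measurable M1" "X2 \<in> borel_measurable M2"
    and eq: "\<And>u. (\<integral>w. cis (u * X1 w) \<partial>M1) = (\<integral>w. cis (u * X2 w) \<partial>M2)"
  shows "distr M1 borel X1 = distr M2 borel X2"
proof -
  interpret M1: finite_measure M1 by fact
  interpret M2: finite_measure M2 by fact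
  define m where "m = measure M1 (space M1)"
  have m2: "m = measure M2 (space M2)"
    using eq[of 0] by (simp add: m_def cis_zero)
  show ?thesis
  proof (cases "m = 0")
    case True
    have "emeasure M1 A = 0" for A
      using True emeasure_space[of M1 A] by (simp add: m_def M1.emeasure_eq_measure)
    moreover have "emeasure M2 A = 0" for A
      using True emeasure_space[of M2 A] by (simp add: m2 M2.emeasure_eq_measure)
    ultimately show ?thesis
      by (intro measure_eqI) (auto simp: emeasure_distr)
  next
    case False
    then have "m > 0" by (simp add: m_def zero_less_measure_iff)
    have normalise: "prob_space (density M (\<lambda>_. ennreal (1 / m)))"
      if "finite_measure M" "measure M (space M) = m" for M :: "'c measure"
    proof
      interpret finite_measure M by fact
      show "emeasure (density M (\<lambda>_. ennreal (1 / m))) (space (density M (\<lambda>_. ennreal (1 / m)))) = 1"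
        using that(2) \<open>m > 0\<close>
        by (simp add: emeasure_density emeasure_eq_measure ennreal_mult[symmetric])
    qed
    let ?D1 = "density M1 (\<lambda>_. ennreal (1 / m))" and ?D2 = "density M2 (\<lambda>_. ennreal (1 / m))"
    interpret D1: prob_space ?D1 by (rule normalise) (auto simp: m_def assms)
    interpret D2: prob_space ?D2 by (rule normalise) (auto simp: m2 assms)
    have char_density: "char (distr (density M (\<lambda>_. ennreal (1 / m))) borel X) u
        = (1 / m) *\<^sub>R (\<integral>w. cis (u * X w) \<partial>M)"
      if [measurable]: "X \<in> borel_measurable M" for M :: "'c measure" and X u
      unfolding char_def using \<open>m > 0\<close>
      by (simp add: integral_distr integral_density cis_conv_exp)
    have "distr ?D1 borel X1 = distr ?D2 borel X2"
    proof (rule Levy_uniqueness)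
      show "real_distribution (distr ?D1 borel X1)" by (rule D1.real_distribution_distr) simp
      show "real_distribution (distr ?D2 borel X2)" by (rule D2.real_distribution_distr) simp
      show "char (distr ?D1 borel X1) = char (distr ?D2 borel X2)"
        using eq by (simp add: fun_eq_iff char_density)
    qed
    then have *: "emeasure (distr ?D1 borel X1) A = emeasure (distr ?D2 borel X2) A" for A
      by simp
    have "emeasure (distr M1 borel X1) A = emeasure (distr M2 borel X2) A" if A: "A \<in> sets borel" for A
    proof -
      have "emeasure (distr (density M (\<lambda>_. ennreal (1 / m))) borel X) A
          = ennreal (1 / m) * emeasure (distr M borel X) A"
        if [measurable]: "X \<in> borel_measurable M" for M :: "'c measure" and X
        using A by (simp add: emeasure_distr emeasure_density nn_integral_cmult_indicator)
      then have "ennreal (1 / m) * emeasure (distr M1 borel X1) A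
          = ennreal (1 / m) * emeasure (distr M2 borel X2) A"
        using *[of A] by simp
      then show ?thesis using \<open>m > 0\<close> by (simp add: ennreal_mult_cancel_left)
    qed
    then show ?thesis by (intro measure_eqI) auto
  qed
qed

text \<open>The weights \<open>1 + cos (\<dots>)\<close> turn the multivariate statement into the one-dimensional one:
  they are nonnegative, and a change of measure by them keeps the characteristic function of
  the remaining variable under control.\<close>

lemma char_imp_weighted_eq:
  fixes M1 M2 :: "'c measure"
  assumes "finite_measure M1" "finite_measure M2"
    and [measurable]: "X1 \<in> borel_measurable M1" "X2 \<in> borel_measurable M2"
      "S1 \<in> borel_measurable M1" "S2 \<in> borel_measurable M2"
    and eq: "\<And>u v. (\<integral>w. cis (u * X1 w + v * S1 w) \<partial>M1) = (\<integral>w. cis (u * X2 w + v * S2 w) \<partial>M2)"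
    and B [measurable]: "B \<in> sets borel"
  shows "(\<integral>w. indicator B (X1 w) * (1 + cos (S1 w + \<theta>)) \<partial>M1)
       = (\<integral>w. indicator B (X2 w) * (1 + cos (S2 w + \<theta>)) \<partial>M2)"
proof -
  define W where "W = (\<lambda>M (S :: 'c \<Rightarrow> real). density M (\<lambda>w. ennreal (1 + cos (S w + \<theta>))))"
  have nonneg: "0 \<le> 1 + cos (s + \<theta>)" for s :: real
    using cos_ge_minus_one[of "s + \<theta>"] by linarith
  have le2: "ennreal (1 + cos s) \<le> 2" for s :: real
    using ennreal_leI[of "1 + cos s" 2] cos_le_one[of s] by simp
  have fin: "finite_measure (W M S)" if "finite_measure M" and [measurable]: "S \<in> borel_measurable M"
    for M :: "'c measure" and S
  proof
    interpret finite_measure M by fact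
    have "emeasure (W M S) (space (W M S)) \<le> (\<integral>\<^sup>+w. ennreal 2 \<partial>M)"
      unfolding W_def
      by (auto simp: emeasure_density simp del: nn_integral_const intro!: nn_integral_mono le2 split: split_indicator)
    also have "\<dots> < \<infinity>"
      using emeasure_finite by (simp add: ennreal_mult_eq_top_iff less_top[symmetric])
    finally show "emeasure (W M S) (space (W M S)) \<noteq> \<infinity>" by simp
  qed
  \<comment> \<open>Since \<open>cos y\<close> is the mean of \<open>cis y\<close> and
    \<open>cis (- y)\<close>, the characteristic function under the weighted measure combines the
    joint ones with \<open>v = 0\<close>, \<open>v = 1\<close> and \<open>v = -1\<close>, on which
    \<open>eq\<close> can act.\<close>
  have W_char: "(\<integral>w. cis (u * X w) \<partial>W M S) = (\<integral>w. cis (u * X w + 0 * S w) \<partial>M)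
      + (cis \<theta> * (\<integral>w. cis (u * X w + 1 * S w) \<partial>M) + cis (-\<theta>) * (\<integral>w. cis (u * X w + (-1) * S w) \<partial>M)) / 2"
    if "finite_measure M" and [measurable]: "S \<in> borel_measurable M" "X \<in> borel_measurable M"
    for M :: "'c measure" and S X u
  proof -
    interpret finite_measure M by fact
    have id: "complex_of_real (1 + cos (s + \<theta>)) * cis x
        = cis x + (cis \<theta> * cis (x + s) + cis (-\<theta>) * cis (x - s)) / 2" for s x
    proof -
      have "complex_of_real (cos y) = (cis y + cis (- y)) / 2" for y
        by (simp add: complex_eq_iff)
      from this[of "s + \<theta>"] have "complex_of_real (1 + cos (s + \<theta>)) * cis x
          = cis x + (cis (s + \<theta>) * cis x + cis (- (s + \<theta>)) * cis x) / 2"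
        by (simp add: algebra_simps add_divide_distrib)
      also have "\<dots> = cis x + (cis \<theta> * cis (x + s) + cis (-\<theta>) * cis (x - s)) / 2"
        unfolding cis_mult by (simp add: algebra_simps)
      finally show ?thesis .
    qed
    have "(\<integral>w. cis (u * X w) \<partial>W M S) = (\<integral>w. (1 + cos (S w + \<theta>)) *\<^sub>R cis (u * X w) \<partial>M)"
      unfolding W_def using nonneg by (intro integral_density) auto
    also have "\<dots> = (\<integral>w. cis (u * X w + 0 * S w) + (cis \<theta> * cis (u * X w + 1 * S w)
        + cis (-\<theta>) * cis (u * X w + (-1) * S w)) / 2 \<partial>M)"
      by (intro Bochner_Integration.integral_cong refl) (simp only: scaleR_conv_of_real id, simp)
    also have "\<dots> = (\<integral>w. cis (u * X w + 0 * S w) \<partial>M)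
      + (cis \<theta> * (\<integral>w. cis (u * X w + 1 * S w) \<partial>M) + cis (-\<theta>) * (\<integral>w. cis (u * X w + (-1) * S w) \<partial>M)) / 2"
    proof -
      have i: "integrable M (\<lambda>w. cis (u * X w + v * S w))" for v
        by (rule integrable_cis) measurable
      show ?thesis using i[of 0] i[of 1] i[of "-1"] by (simp add: add_divide_distrib)
    qed
    finally show ?thesis .
  qed
  have W_ind: "enn2real (emeasure (distr (W M S) borel X) B)
      = (\<integral>w. indicator B (X w) * (1 + cos (S w + \<theta>)) \<partial>M)"
    if "finite_measure M" and [measurable]: "S \<in> borel_measurable M" "X \<in> borel_measurable M"
    for M :: "'c measure" and S X
  proof -
    have "(\<integral>w. indicator B (X w) * (1 + cos (S w + \<theta>)) \<partial>M)
        = enn2real (\<integral>\<^sup>+w. ennreal (indicator B (X w) * (1 + cos (S w + \<theta>))) \<partial>M)"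
      using nonneg by (intro integral_eq_nn_integral) auto
    also have "(\<integral>\<^sup>+w. ennreal (indicator B (X w) * (1 + cos (S w + \<theta>))) \<partial>M)
        = (\<integral>\<^sup>+w. ennreal (1 + cos (S w + \<theta>)) * indicator (X -` B \<inter> space M) w \<partial>M)"
      by (intro nn_integral_cong) (auto split: split_indicator)
    also have "\<dots> = emeasure (distr (W M S) borel X) B"
      by (simp add: emeasure_distr W_def emeasure_density)
    finally show ?thesis by simp
  qed
  have "distr (W M1 S1) borel X1 = distr (W M2 S2) borel X2"
  proof (rule distr_eqI_char)
    show "X1 \<in> borel_measurable (W M1 S1)" "X2 \<in> borel_measurable (W M2 S2)"
      by (simp_all add: W_def)
  qed (use assms(1,2) eq in \<open>simp_all only: fin W_char assms(3-6)\<close>)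
  then show ?thesis
    using W_ind[OF assms(1,5,3)] W_ind[OF assms(2,6,4)] by simp
qed

text \<open>A form of the Cramer-Wold theorem, by induction on \<open>I\<close>: both measures are
  restricted to the event that coordinate \<open>k\<close> lies in \<open>A k\<close>, and this
  preserves the hypothesis on characteristic functions for the other coordinates. Hence the measures
  vary in the induction and may have any finite mass.\<close>

lemma char_imp_measure_eq:
  fixes M1 M2 :: "'b measure" and X1 X2 :: "'a \<Rightarrow> 'b \<Rightarrow> real"
  assumes "finite I" "finite_measure M1" "finite_measure M2"
    and "\<And>i. i \<in> I \<Longrightarrow> X1 i \<in> borel_measurable M1" "\<And>i. i \<in> I \<Longrightarrow> X2 i \<in> borel_measurable M2"
    and "\<And>c. (\<integral>w. cis (\<Sum>i\<in>I. c i * X1 i w) \<partial>M1) = (\<integral>w. cis (\<Sum>i\<in>I. c i * X2 i w) \<partial>M2)"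
    and "\<And>i. i \<in> I \<Longrightarrow> A i \<in> sets borel"
  shows "measure M1 {w \<in> space M1. \<forall>i\<in>I. X1 i w \<in> A i} = measure M2 {w \<in> space M2. \<forall>i\<in>I. X2 i w \<in> A i}"
  using assms
proof (induction I arbitrary: M1 M2 rule: finite_induct)
  case empty
  then show ?case by (simp add: cis_zero)
next
  case (insert k I)
  interpret M1: finite_measure M1 by fact
  interpret M2: finite_measure M2 by fact
  have [measurable]: "\<And>i. i \<in> I \<Longrightarrow> X1 i \<in> borel_measurable M1" "\<And>i. i \<in> I \<Longrightarrow> X2 i \<in> borel_measurable M2"
    "X1 k \<in> borel_measurable M1" "X2 k \<in> borel_measurable M2" "A k \<in> sets borel"
    "\<And>i. i \<in> I \<Longrightarrow> A i \<in> sets borel"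
    using insert.prems by auto
  note [measurable] = \<open>finite I\<close>
  define D where "D = (\<lambda>M (X :: 'a \<Rightarrow> 'b \<Rightarrow> real). density M (\<lambda>w. indicator (A k) (X k w) :: ennreal))"
  have fin: "finite_measure (D M X)" if "finite_measure M" and [measurable]: "X k \<in> borel_measurable M"
    for M :: "'b measure" and X
  proof
    interpret finite_measure M by fact
    have "emeasure (D M X) (space (D M X)) \<le> (\<integral>\<^sup>+w. 1 \<partial>M)"
      unfolding D_def by (auto simp: emeasure_density simp del: nn_integral_const intro!: nn_integral_mono split: split_indicator)
    then show "emeasure (D M X) (space (D M X)) \<noteq> \<infinity>"
      using finite_emeasure_space by (auto simp: top_unique)
  qed
  have D_meas: "measure (D M X) {w \<in> space (D M X). \<forall>i\<in>I. X i w \<in> A i}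
      = measure M {w \<in> space M. \<forall>i\<in>insert k I. X i w \<in> A i}"
    if [measurable]: "\<And>i. i \<in> I \<Longrightarrow> X i \<in> borel_measurable M" "X k \<in> borel_measurable M"
    for M :: "'b measure" and X
  proof -
    have "emeasure (D M X) {w \<in> space (D M X). \<forall>i\<in>I. X i w \<in> A i}
      = (\<integral>\<^sup>+w. indicator (A k) (X k w) * indicator {w \<in> space M. \<forall>i\<in>I. X i w \<in> A i} w \<partial>M)"
      unfolding D_def by (subst emeasure_density) auto
    also have "\<dots> = (\<integral>\<^sup>+w. indicator {w \<in> space M. \<forall>i\<in>insert k I. X i w \<in> A i} w \<partial>M)"
      by (intro nn_integral_cong) (auto split: split_indicator)
    also have "\<dots> = emeasure M {w \<in> space M. \<forall>i\<in>insert k I. X i w \<in> A i}"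
      by (subst nn_integral_indicator) auto
    finally show ?thesis by (simp add: measure_def)
  qed
  have D_int: "(\<integral>w. cis (S w) \<partial>D M X) = (\<integral>w. indicator (A k) (X k w) *\<^sub>R cis (S w) \<partial>M)"
    if [measurable]: "X k \<in> borel_measurable M" "S \<in> borel_measurable M"
    for M :: "'b measure" and X S
    using integral_density[of "\<lambda>w. cis (S w)" M "\<lambda>w. indicator (A k) (X k w)"]
    by (simp add: D_def ennreal_indicator)
  have "measure (D M1 X1) {w \<in> space (D M1 X1). \<forall>i\<in>I. X1 i w \<in> A i}
      = measure (D M2 X2) {w \<in> space (D M2 X2). \<forall>i\<in>I. X2 i w \<in> A i}"
  proof (rule insert.IH)
    show "finite_measure (D M1 X1)" "finite_measure (D M2 X2)" by (auto intro!: fin insert.prems)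
    show "X1 i \<in> borel_measurable (D M1 X1)" "X2 i \<in> borel_measurable (D M2 X2)" if "i \<in> I" for i
      using that insert.prems by (simp_all add: D_def)
    fix c :: "'a \<Rightarrow> real"
    define S1 S2 where "S1 = (\<lambda>w. \<Sum>i\<in>I. c i * X1 i w)" "S2 = (\<lambda>w. \<Sum>i\<in>I. c i * X2 i w)"
    have [measurable]: "S1 \<in> borel_measurable M1" "S2 \<in> borel_measurable M2"
      unfolding S1_S2_def by measurable
    \<comment> \<open>Coefficient \<open>u\<close> on the coordinate \<open>k\<close> and
      \<open>v * c i\<close> on the others give the joint characteristic function of coordinate
      \<open>k\<close> and the sum over \<open>I\<close>.\<close>
    have joint: "(\<integral>w. cis (u * X1 k w + v * S1 w) \<partial>M1) = (\<integral>w. cis (u * X2 k w + v * S2 w) \<partial>M2)" for u v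
    proof -
      have "(\<Sum>i\<in>insert k I. (if i = k then u else v * c i) * X i w)
          = u * X k w + v * (\<Sum>i\<in>I. c i * X i w)" for X :: "'a \<Rightarrow> 'b \<Rightarrow> real" and w
      proof -
        have "(\<Sum>i\<in>I. (if i = k then u else v * c i) * X i w) = (\<Sum>i\<in>I. v * (c i * X i w))"
          using \<open>k \<notin> I\<close> by (intro sum.cong) auto
        then show ?thesis using insert.hyps by (simp add: sum_distrib_left)
      qed
      then show ?thesis
        using insert.prems(5)[of "\<lambda>i. if i = k then u else v * c i"] by (simp add: S1_S2_def)
    qed
    have weighted: "(\<integral>w. indicator (A k) (X1 k w) * (1 + cos (S1 w + \<theta>)) \<partial>M1)
       = (\<integral>w. indicator (A k) (X2 k w) * (1 + cos (S2 w + \<theta>)) \<partial>M2)" for \<theta>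
      by (rule char_imp_weighted_eq[OF insert.prems(1,2) _ _ _ _ joint]) auto
    \<comment> \<open>With \<open>S = 0\<close> and phase 0 the weight is the constant 2, so the
      masses of the event agree; subtracting them from \<open>weighted\<close> leaves the cosine
      alone.\<close>
    have const: "(\<integral>w. indicator (A k) (X1 k w) * (1 + cos (0 + 0)) \<partial>M1)
       = (\<integral>w. indicator (A k) (X2 k w) * (1 + cos (0 + 0 :: real)) \<partial>M2)"
      using joint[of _ 0] by (intro char_imp_weighted_eq[OF insert.prems(1,2)]) auto
    have split: "(\<integral>w. indicator (A k) (X w) * (1 + cos (S w + \<theta>)) \<partial>M)
        = (\<integral>w. indicator (A k) (X w) \<partial>M) + (\<integral>w. indicator (A k) (X w) * cos (S w + \<theta>) \<partial>M)"
      and cisint: "integrable M (\<lambda>w. indicator (A k) (X w) *\<^sub>R cis (S w))"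
      if "finite_measure M" and [measurable]: "X \<in> borel_measurable M" "S \<in> borel_measurable M"
      for M :: "'b measure" and X S and \<theta> :: real
    proof -
      interpret finite_measure M by fact
      have a: "integrable M (\<lambda>w. indicator (A k) (X w) :: real)"
        by (rule integrable_const_bound[where B = 1]) (auto split: split_indicator)
      have b: "integrable M (\<lambda>w. indicator (A k) (X w) * cos (S w + \<theta>))"
        by (rule integrable_const_bound[where B = 1]) (auto split: split_indicator)
      show "(\<integral>w. indicator (A k) (X w) * (1 + cos (S w + \<theta>)) \<partial>M)
        = (\<integral>w. indicator (A k) (X w) \<partial>M) + (\<integral>w. indicator (A k) (X w) * cos (S w + \<theta>) \<partial>M)"
        using a b by (simp add: distrib_left)
      show "integrable M (\<lambda>w. indicator (A k) (X w) *\<^sub>R cis (S w))"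
        by (rule integrable_const_bound[where B = 1]) (auto split: split_indicator)
    qed
    have cos_eq: "(\<integral>w. indicator (A k) (X1 k w) * cos (S1 w + \<theta>) \<partial>M1)
       = (\<integral>w. indicator (A k) (X2 k w) * cos (S2 w + \<theta>) \<partial>M2)" for \<theta>
      using weighted[of \<theta>] const split[of M1 "X1 k" S1 \<theta>] split[of M2 "X2 k" S2 \<theta>] insert.prems(1,2)
      by simp
    have "(\<integral>w. indicator (A k) (X1 k w) *\<^sub>R cis (S1 w) \<partial>M1)
        = (\<integral>w. indicator (A k) (X2 k w) *\<^sub>R cis (S2 w) \<partial>M2)" (is "?l = ?r")
    proof (rule complex_eqI)
      \<comment> \<open>The phases \<open>0\<close> and \<open>- pi / 2\<close> in
        \<open>cos_eq\<close> yield the real and the imaginary part.\<close>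
      have sin: "sin s = cos (s + (- pi / 2))" for s :: real
        by (simp add: cos_diff)
      note c1 = cisint[of M1 "X1 k" S1] and c2 = cisint[of M2 "X2 k" S2]
      show "Re ?l = Re ?r"
        using cos_eq[of 0] insert.prems(1,2) by (simp add: integral_Re[symmetric] c1 c2)
      show "Im ?l = Im ?r"
        using cos_eq[of "- pi / 2"] insert.prems(1,2)
        by (simp only: integral_Im[symmetric] c1 c2 \<open>X1 k \<in> borel_measurable M1\<close>
            \<open>X2 k \<in> borel_measurable M2\<close> \<open>S1 \<in> borel_measurable M1\<close> \<open>S2 \<in> borel_measurable M2\<close>
            scaleR_complex.sel cis.sel sin)
    qed
    then show "(\<integral>w. cis (\<Sum>i\<in>I. c i * X1 i w) \<partial>D M1 X1) = (\<integral>w. cis (\<Sum>i\<in>I. c i * X2 i w) \<partial>D M2 X2)"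
      using D_int[of X1 M1 S1] D_int[of X2 M2 S2] by (simp add: S1_S2_def)
  qed (use insert.prems in auto)
  then show ?case
    using D_meas[of X1 M1] D_meas[of X2 M2] insert.prems by simp
qed

text \<open>Boxes determine a finite measure on a finite product. Coordinates outside
  \<open>I\<close> are set to 0 because elements of \<open>PiM I\<close> are undefined there, while
  \<open>\<Psi>\<close> expects a full sequence.\<close>

lemma char_imp_integral_eq:
  fixes X1 X2 :: "nat \<Rightarrow> 'b \<Rightarrow> real" and \<Psi> :: "(nat \<Rightarrow> real) \<Rightarrow> real"
  assumes fin: "finite I" "finite_measure M1" "finite_measure M2"
    and X: "\<And>i. i \<in> I \<Longrightarrow> X1 i \<in> borel_measurable M1" "\<And>i. i \<in> I \<Longrightarrow> X2 i \<in> borel_measurable M2"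
    and eq: "\<And>c. (\<integral>w. cis (\<Sum>i\<in>I. c i * X1 i w) \<partial>M1) = (\<integral>w. cis (\<Sum>i\<in>I. c i * X2 i w) \<partial>M2)"
    and \<Psi> [measurable]: "\<Psi> \<in> borel_measurable borel"
  shows "(\<integral>w. \<Psi> (\<lambda>i. if i \<in> I then X1 i w else 0) \<partial>M1) = (\<integral>w. \<Psi> (\<lambda>i. if i \<in> I then X2 i w else 0) \<partial>M2)"
proof -
  let ?P = "PiM I (\<lambda>_. borel :: real measure)"
  interpret M1: finite_measure M1 by fact
  interpret M2: finite_measure M2 by fact
  have m1 [measurable]: "(\<lambda>w. \<lambda>i\<in>I. X1 i w) \<in> measurable M1 ?P"
    using X by (intro measurable_restrict) auto
  have m2 [measurable]: "(\<lambda>w. \<lambda>i\<in>I. X2 i w) \<in> measurable M2 ?P"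
    using X by (intro measurable_restrict) auto
  have "distr M1 ?P (\<lambda>w. \<lambda>i\<in>I. X1 i w) = distr M2 ?P (\<lambda>w. \<lambda>i\<in>I. X2 i w)"
  proof (rule measure_eqI_PiM_finite[OF fin(1), where A = "\<lambda>_::nat. space ?P"])
    fix A :: "nat \<Rightarrow> real set" assume A: "\<And>i. i \<in> I \<Longrightarrow> A i \<in> sets borel"
    have "emeasure (distr M1 ?P (\<lambda>w. \<lambda>i\<in>I. X1 i w)) (Pi\<^sub>E I A)
        = emeasure M1 {w \<in> space M1. \<forall>i\<in>I. X1 i w \<in> A i}"
      using A fin by (subst emeasure_distr) (auto intro!: arg_cong[where f = "emeasure M1"] sets_PiM_I_finite)
    moreover have "emeasure (distr M2 ?P (\<lambda>w. \<lambda>i\<in>I. X2 i w)) (Pi\<^sub>E I A)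
        = emeasure M2 {w \<in> space M2. \<forall>i\<in>I. X2 i w \<in> A i}"
      using A fin by (subst emeasure_distr) (auto intro!: arg_cong[where f = "emeasure M2"] sets_PiM_I_finite)
    ultimately show "emeasure (distr M1 ?P (\<lambda>w. \<lambda>i\<in>I. X1 i w)) (Pi\<^sub>E I A)
        = emeasure (distr M2 ?P (\<lambda>w. \<lambda>i\<in>I. X2 i w)) (Pi\<^sub>E I A)"
      using char_imp_measure_eq[OF fin X eq A]
      by (simp add: M1.emeasure_eq_measure M2.emeasure_eq_measure)
  next
    show "range (\<lambda>_::nat. space ?P) \<subseteq> prod_algebra I (\<lambda>_. borel)"
      using fin(1) by (auto simp: space_PiM intro!: prod_algebraI_finite)
    show "emeasure (distr M1 ?P (\<lambda>w. \<lambda>i\<in>I. X1 i w)) (space ?P) \<noteq> \<infinity>" for i :: nat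
      using M1.emeasure_finite by (subst emeasure_distr) auto
  qed auto
  moreover have [measurable]: "(\<lambda>x. \<Psi> (\<lambda>i. if i \<in> I then x i else 0)) \<in> borel_measurable ?P"
  proof -
    have "(\<lambda>x i. if i \<in> I then x i else 0) \<in> measurable ?P (borel :: (nat \<Rightarrow> real) measure)"
    proof (rule measurable_coordinatewise_then_product)
      show "(\<lambda>x. if i \<in> I then x i else 0) \<in> borel_measurable ?P" for i
        by (cases "i \<in> I") auto
    qed
    then show ?thesis by measurable
  qed
  ultimately have "(\<integral>x. \<Psi> (\<lambda>i. if i \<in> I then x i else 0) \<partial>distr M1 ?P (\<lambda>w. \<lambda>i\<in>I. X1 i w))
      = (\<integral>x. \<Psi> (\<lambda>i. if i \<in> I then x i else 0) \<partial>distr M2 ?P (\<lambda>w. \<lambda>i\<in>I. X2 i w))" by simp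
  moreover have "(\<lambda>i. if i \<in> I then (\<lambda>i\<in>I. x i) i else 0) = (\<lambda>i. if i \<in> I then x i else 0)" for x :: "nat \<Rightarrow> real"
    by auto
  ultimately show ?thesis by (simp add: integral_distr cong: if_cong)
qed

section \<open>Gaussian integration by parts\<close>

lemma std_normal_density_deriv:
  "(std_normal_density has_real_derivative - x * std_normal_density x) (at x)"
  unfolding std_normal_density_def[abs_def]
  by (auto intro!: derivative_eq_intros simp: field_simps)

lemma std_normal_density_at_top: "(std_normal_density \<longlongrightarrow> 0) at_top"
  unfolding std_normal_density_def[abs_def] by real_asymp

lemma std_normal_density_at_bot: "(std_normal_density \<longlongrightarrow> 0) at_bot"
  unfolding std_normal_density_def[abs_def] by real_asymp

text \<open>Stein's identity. The derivative of the density is \<open>- x\<close> times the density,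
  so the difference of the integrands is the derivative of the density times \<open>\<psi>\<close>,
  which vanishes at both infinities because \<open>\<psi>\<close> is bounded.\<close>

lemma std_normal_integration_by_parts:
  fixes \<psi> \<psi>' :: "real \<Rightarrow> real"
  assumes deriv: "\<And>x. (\<psi> has_real_derivative \<psi>' x) (at x)"
    and cont: "continuous_on UNIV \<psi>'"
    and bound: "\<And>x. \<bar>\<psi> x\<bar> \<le> C" "\<And>x. \<bar>\<psi>' x\<bar> \<le> C"
  shows "(\<integral>x. std_normal_density x * (x * \<psi> x) \<partial>lborel) = (\<integral>x. std_normal_density x * \<psi>' x \<partial>lborel)"
proof -
  have cont\<psi>: "continuous_on UNIV \<psi>"
    using deriv by (auto intro!: continuous_at_imp_continuous_on DERIV_isCont)
  have [measurable]: "\<psi> \<in> borel_measurable borel" "\<psi>' \<in> borel_measurable borel"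
    using cont\<psi> cont by (auto intro: borel_measurable_continuous_onI)
  have contd: "continuous_on UNIV std_normal_density"
    using std_normal_density_deriv by (auto intro!: continuous_at_imp_continuous_on DERIV_isCont)
  have i1: "integrable lborel (\<lambda>x. std_normal_density x * \<psi>' x)"
  proof (rule Bochner_Integration.integrable_bound)
    show "integrable lborel (\<lambda>x. C * std_normal_density x)" by simp
    show "AE x in lborel. norm (std_normal_density x * \<psi>' x) \<le> norm (C * std_normal_density x)"
    proof (rule AE_I2)
      fix x
      have "std_normal_density x * \<bar>\<psi>' x\<bar> \<le> std_normal_density x * \<bar>C\<bar>"
        using order_trans[OF bound(2) abs_ge_self] by (intro mult_left_mono) auto
      then show "norm (std_normal_density x * \<psi>' x) \<le> norm (C * std_normal_density x)"
        by (simp add: abs_mult mult_ac)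
    qed
  qed simp
  have i2: "integrable lborel (\<lambda>x. std_normal_density x * (x * \<psi> x))"
  proof (rule Bochner_Integration.integrable_bound)
    show "integrable lborel (\<lambda>x. C * (std_normal_density x * \<bar>x\<bar>))"
      using integrable_std_normal_moment_abs[of 1] by simp
    show "AE x in lborel. norm (std_normal_density x * (x * \<psi> x)) \<le> norm (C * (std_normal_density x * \<bar>x\<bar>))"
    proof (rule AE_I2)
      fix x
      have "std_normal_density x * \<bar>x\<bar> * \<bar>\<psi> x\<bar> \<le> std_normal_density x * \<bar>x\<bar> * \<bar>C\<bar>"
        using order_trans[OF bound(1) abs_ge_self] by (intro mult_left_mono) auto
      then show "norm (std_normal_density x * (x * \<psi> x)) \<le> norm (C * (std_normal_density x * \<bar>x\<bar>))"
        by (simp add: abs_mult mult_ac)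
    qed
  qed simp
  define h where "h = (\<lambda>x. std_normal_density x * \<psi>' x - std_normal_density x * (x * \<psi> x))"
  have lim: "((\<lambda>x. std_normal_density x * \<psi> x) \<longlongrightarrow> 0) F"
    if "(std_normal_density \<longlongrightarrow> 0) F" for F
  proof (rule Lim_null_comparison)
    show "\<forall>\<^sub>F x in F. norm (std_normal_density x * \<psi> x) \<le> std_normal_density x * C"
      using bound(1) by (intro always_eventually) (auto simp: abs_mult intro!: mult_left_mono)
    show "((\<lambda>x. std_normal_density x * C) \<longlongrightarrow> 0) F"
      using tendsto_mult_right[OF that, of C] by simp
  qed
  have "(LBINT x=-\<infinity>..\<infinity>. h x) = 0 - 0"
  proof (rule interval_integral_FTC_integrable)
    show "((\<lambda>x. std_normal_density x * \<psi> x) has_vector_derivative h x) (at x)" for x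
      unfolding has_real_derivative_iff_has_vector_derivative[symmetric] h_def
      by (auto intro!: derivative_eq_intros std_normal_density_deriv deriv simp: algebra_simps)
    show "isCont h x" for x
      unfolding h_def using cont cont\<psi> contd
      by (auto intro!: continuous_intros simp: continuous_on_eq_continuous_at)
    show "set_integrable lborel (einterval (- \<infinity>) \<infinity>) h"
      using i1 i2 by (simp add: set_integrable_def h_def)
    show "(((\<lambda>x. std_normal_density x * \<psi> x) \<circ> real_of_ereal) \<longlongrightarrow> 0) (at_right (- \<infinity>))"
      using lim[OF std_normal_density_at_bot] by (simp add: ereal_tendsto_simps)
    show "(((\<lambda>x. std_normal_density x * \<psi> x) \<circ> real_of_ereal) \<longlongrightarrow> 0) (at_left \<infinity>)"
      using lim[OF std_normal_density_at_top] by (simp add: ereal_tendsto_simps)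
  qed simp
  then have "(\<integral>x. h x \<partial>lborel) = 0"
    by (simp add: interval_lebesgue_integral_def set_lebesgue_integral_def)
  then show ?thesis using i1 i2 by (simp add: h_def)
qed

text \<open>The hypothesis on characteristic functions says that \<open>N\<close> is standard normal and
  independent of the residuals \<open>V i - a i * N\<close>.\<close>

lemma (in prob_space) gaussian_integration_by_parts:
  fixes N :: "'a \<Rightarrow> real" and V :: "nat \<Rightarrow> 'a \<Rightarrow> real" and \<phi> d\<phi> :: "(nat \<Rightarrow> real) \<Rightarrow> real"
  assumes [measurable]: "N \<in> borel_measurable M" "\<And>i. V i \<in> borel_measurable M"
    and joint: "\<And>u c. (\<integral>w. cis (u * N w + (\<Sum>i<L. c i * (V i w - a i * N w))) \<partial>M)
      = complex_of_real (exp (- u\<^sup>2 / 2)) * (\<integral>w. cis (\<Sum>i<L. c i * (V i w - a i * N w)) \<partial>M)"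
    and dep: "\<And>x y. (\<And>i. i < L \<Longrightarrow> x i = y i) \<Longrightarrow> \<phi> x = \<phi> y"
      "\<And>x y. (\<And>i. i < L \<Longrightarrow> x i = y i) \<Longrightarrow> d\<phi> x = d\<phi> y"
    and cont: "continuous_on UNIV \<phi>" "continuous_on UNIV d\<phi>"
    and bound: "\<And>x. \<bar>\<phi> x\<bar> \<le> C" "\<And>x. \<bar>d\<phi> x\<bar> \<le> C"
    and deriv: "\<And>x s. ((\<lambda>s. \<phi> (\<lambda>i. x i + s * a i)) has_real_derivative d\<phi> (\<lambda>i. x i + s * a i)) (at s)"
  shows "(\<integral>w. N w * \<phi> (\<lambda>i. V i w) \<partial>M) = (\<integral>w. d\<phi> (\<lambda>i. V i w) \<partial>M)"
proof -
  let ?G = "density lborel std_normal_density"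
  interpret G: prob_space ?G by (rule prob_space_normal_density) simp
  interpret P: pair_prob_space ?G M ..
  let ?Q = "?G \<Otimes>\<^sub>M M"
  have [measurable]: "\<phi> \<in> borel_measurable borel" "d\<phi> \<in> borel_measurable borel"
    using cont by (auto intro: borel_measurable_continuous_onI)
  have vec: "f \<in> borel_measurable K"
    if "\<And>i. (\<lambda>x. f x i) \<in> borel_measurable K" for f :: "'k \<Rightarrow> nat \<Rightarrow> real" and K
    using that by (rule measurable_coordinatewise_then_product)
  \<comment> \<open>Index \<open>L\<close> carries \<open>N\<close> in \<open>X1\<close> and a fresh
    standard normal variable, the first coordinate of \<open>?Q\<close>, in \<open>X2\<close>; the
    indices below \<open>L\<close> carry the residuals. Both families live on \<open>?Q\<close>, as
    the comparison of laws asks for spaces of one type.\<close>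
  define X1 X2 :: "nat \<Rightarrow> real \<times> 'a \<Rightarrow> real" where
    "X1 = (\<lambda>i (x, w). if i = L then N w else V i w - a i * N w)"
    "X2 = (\<lambda>i (x, w). if i = L then x else V i w - a i * N w)"
  have mX [measurable]: "X1 i \<in> borel_measurable ?Q" "X2 i \<in> borel_measurable ?Q" for i
    by (cases "i = L"; simp add: X1_X2_def case_prod_beta)+
  have int_snd: "(\<integral>z. f (snd z) \<partial>?Q) = (\<integral>w. f w \<partial>M)"
    if "f \<in> borel_measurable M" for f :: "'a \<Rightarrow> 'k::{banach, second_countable_topology}"
  proof -
    have "distr ?Q M snd = M"
    proof (rule measure_eqI)
      fix A assume "A \<in> sets (distr ?Q M snd)"
      then have A: "A \<in> sets M" by simp
      have "emeasure (distr ?Q M snd) A = emeasure ?Q (space ?G \<times> A)"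
        using A sets.sets_into_space[OF A]
        by (subst emeasure_distr) (auto simp: space_pair_measure intro!: arg_cong[where f = "emeasure ?Q"])
      also have "\<dots> = emeasure M A"
        using A by (subst emeasure_pair_measure_Times) (auto simp: G.emeasure_space_1[simplified])
      finally show "emeasure (distr ?Q M snd) A = emeasure M A" .
    qed simp
    then have "(\<integral>w. f w \<partial>M) = (\<integral>w. f w \<partial>distr ?Q M snd)" by simp
    also have "\<dots> = (\<integral>z. f (snd z) \<partial>?Q)" using that by (intro integral_distr) auto
    finally show ?thesis by simp
  qed
  \<comment> \<open>The characteristic function of \<open>X2\<close> factorises by Fubini;
    \<open>joint\<close> says that the one of \<open>X1\<close> has the same factors.\<close>
  have char: "(\<integral>z. cis (\<Sum>i\<in>{..L}. c i * X1 i z) \<partial>?Q) = (\<integral>z. cis (\<Sum>i\<in>{..L}. c i * X2 i z) \<partial>?Q)" for c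
  proof -
    define S where "S = (\<lambda>w. \<Sum>i<L. c i * (V i w - a i * N w))"
    have [measurable]: "S \<in> borel_measurable M" unfolding S_def by measurable
    have s1: "(\<Sum>i\<in>{..L}. c i * X1 i z) = c L * N (snd z) + S (snd z)" for z
      by (simp add: X1_X2_def S_def lessThan_Suc_atMost[symmetric] case_prod_beta)
    have s2: "(\<Sum>i\<in>{..L}. c i * X2 i z) = c L * fst z + S (snd z)" for z
      by (simp add: X1_X2_def S_def lessThan_Suc_atMost[symmetric] case_prod_beta)
    have "(\<integral>z. cis (c L * fst z + S (snd z)) \<partial>?Q)
        = (\<integral>z. (case z of (x, w) \<Rightarrow> cis (c L * x) * cis (S w)) \<partial>?Q)"
      by (simp add: cis_mult case_prod_beta)
    also have "\<dots> = (\<integral>x. (\<integral>w. cis (c L * x) * cis (S w) \<partial>M) \<partial>?G)"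
      by (rule P.integral_fst[symmetric], rule P.integrable_const_bound[where B = 1])
        (auto simp: norm_mult)
    also have "\<dots> = (\<integral>x. cis (c L * x) \<partial>?G) * (\<integral>w. cis (S w) \<partial>M)"
      by simp
    also have "(\<integral>x. cis (c L * x) \<partial>?G) = complex_of_real (exp (- (c L)\<^sup>2 / 2))"
      using fun_cong[OF char_std_normal_distribution, of "c L"] by (simp add: char_def cis_conv_exp)
    also have "\<dots> * (\<integral>w. cis (S w) \<partial>M) = (\<integral>w. cis (c L * N w + S w) \<partial>M)"
      using joint[of "c L" c] by (simp add: S_def)
    also have "\<dots> = (\<integral>z. cis (c L * N (snd z) + S (snd z)) \<partial>?Q)"
      by (rule int_snd[symmetric]) measurable
    finally show ?thesis by (simp add: s1 s2)
  qed
  have law: "(\<integral>z. \<Psi> (\<lambda>i. if i \<in> {..L} then X1 i z else 0) \<partial>?Q)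
      = (\<integral>z. \<Psi> (\<lambda>i. if i \<in> {..L} then X2 i z else 0) \<partial>?Q)"
    if "\<Psi> \<in> borel_measurable borel" for \<Psi> :: "(nat \<Rightarrow> real) \<Rightarrow> real"
    by (rule char_imp_integral_eq[OF _ P.finite_measure_axioms P.finite_measure_axioms _ _ char that]) auto
  \<comment> \<open>\<open>V i\<close> is the residual plus \<open>N * a i\<close>, so a function of
    \<open>N\<close> and \<open>V\<close> is a function \<open>\<Psi>\<close> of the coordinates of
    \<open>X1\<close>; equality of laws then replaces \<open>N\<close> by the free variable
    \<open>fst z\<close>.\<close>
  have fibre: "(\<integral>w. k (N w) (\<lambda>i. V i w) \<partial>M) = (\<integral>z. k (fst z) (\<lambda>i. V i (snd z) - a i * N (snd z) + fst z * a i) \<partial>?Q)"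
    if k: "(\<lambda>(x, y). k x y) \<in> borel_measurable (borel \<Otimes>\<^sub>M borel)"
      and kdep: "\<And>s x y. (\<And>i. i < L \<Longrightarrow> x i = y i) \<Longrightarrow> k s x = k s y"
    for k :: "real \<Rightarrow> (nat \<Rightarrow> real) \<Rightarrow> real"
  proof -
    define \<Psi> where "\<Psi> = (\<lambda>x :: nat \<Rightarrow> real. k (x L) (\<lambda>i. x i + x L * a i))"
    have coord [measurable]: "(\<lambda>x :: nat \<Rightarrow> real. x i) \<in> borel_measurable borel" for i
      by (intro borel_measurable_continuous_onI continuous_on_product_coordinates)
    have [measurable]: "(\<lambda>x :: nat \<Rightarrow> real. \<lambda>i. x i + x L * a i) \<in> borel_measurable borel"
      by (rule vec) measurable
    have m\<Psi>: "\<Psi> \<in> borel_measurable borel"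
    proof -
      have "(\<lambda>x :: nat \<Rightarrow> real. (x L, \<lambda>i. x i + x L * a i)) \<in> measurable borel (borel \<Otimes>\<^sub>M borel)"
        by (intro measurable_Pair) measurable
      from measurable_compose[OF this k] show ?thesis by (simp add: \<Psi>_def)
    qed
    have [measurable]: "(\<lambda>w. k (N w) (\<lambda>i. V i w)) \<in> borel_measurable M"
    proof -
      have [measurable]: "(\<lambda>w i. V i w) \<in> borel_measurable M" by (rule vec) simp
      have "(\<lambda>w. (N w, \<lambda>i. V i w)) \<in> measurable M (borel \<Otimes>\<^sub>M borel)"
        by (intro measurable_Pair) measurable
      from measurable_compose[OF this k] show ?thesis by simp
    qed
    have "(\<integral>w. k (N w) (\<lambda>i. V i w) \<partial>M) = (\<integral>z. k (N (snd z)) (\<lambda>i. V i (snd z)) \<partial>?Q)"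
      by (rule int_snd[symmetric]) simp
    also have "\<dots> = (\<integral>z. \<Psi> (\<lambda>i. if i \<in> {..L} then X1 i z else 0) \<partial>?Q)"
      by (intro Bochner_Integration.integral_cong refl)
        (auto simp: \<Psi>_def X1_X2_def case_prod_beta intro!: kdep)
    also have "\<dots> = (\<integral>z. \<Psi> (\<lambda>i. if i \<in> {..L} then X2 i z else 0) \<partial>?Q)"
      by (rule law[OF m\<Psi>])
    also have "\<dots> = (\<integral>z. k (fst z) (\<lambda>i. V i (snd z) - a i * N (snd z) + fst z * a i) \<partial>?Q)"
      by (intro Bochner_Integration.integral_cong refl)
        (auto simp: \<Psi>_def X1_X2_def case_prod_beta intro!: kdep)
    finally show ?thesis .
  qed
  define R where "R = (\<lambda>w i. V i w - a i * N w)"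
  have [measurable]: "(\<lambda>z. \<lambda>i. R (snd z) i + fst z * a i) \<in> borel_measurable ?Q"
    by (rule vec) (simp add: R_def)
  have "(\<integral>w. N w * \<phi> (\<lambda>i. V i w) \<partial>M) = (\<integral>z. fst z * \<phi> (\<lambda>i. R (snd z) i + fst z * a i) \<partial>?Q)"
    unfolding R_def
  proof (rule fibre[of "\<lambda>s y. s * \<phi> y"])
    show "s * \<phi> x = s * \<phi> y" if "\<And>i. i < L \<Longrightarrow> x i = y i" for s x y
      using dep(1)[OF that] by simp
  qed measurable
  also have "\<dots> = (\<integral>w. (\<integral>x. x * \<phi> (\<lambda>i. R w i + x * a i) \<partial>?G) \<partial>M)"
  proof (subst P.integral_snd)
    have "integrable ?G (\<lambda>x. \<bar>x\<bar>)"
      using integrable_std_normal_moment_abs[of 1] by (simp add: integrable_density)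
    then have "integrable (distr ?Q ?G fst) (\<lambda>x. \<bar>x\<bar>)"
      by (subst distr_pair_fst) auto
    then have "integrable ?Q (\<lambda>z. \<bar>fst z\<bar>)"
      by (rule integrable_distr[rotated]) simp
    then have *: "integrable ?Q (\<lambda>z. C * \<bar>fst z\<bar>)" by simp
    show "integrable ?Q (\<lambda>(x, w). x * \<phi> (\<lambda>i. R w i + x * a i))"
    proof (rule Bochner_Integration.integrable_bound[OF *])
      show "(\<lambda>(x, w). x * \<phi> (\<lambda>i. R w i + x * a i)) \<in> borel_measurable ?Q"
        by (simp add: case_prod_beta)
      have "\<bar>x\<bar> * \<bar>\<phi> y\<bar> \<le> \<bar>C\<bar> * \<bar>x\<bar>" for x :: real and y
        using mult_right_mono[OF order_trans[OF bound(1)[of y] abs_ge_self], of "\<bar>x\<bar>"]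
        by (simp only: mult.commute abs_ge_zero)
      then show "AE z in ?Q. norm (case z of (x, w) \<Rightarrow> x * \<phi> (\<lambda>i. R w i + x * a i)) \<le> norm (C * \<bar>fst z\<bar>)"
        by (intro AE_I2) (simp add: case_prod_beta abs_mult)
    qed
  qed (simp add: case_prod_beta')
  \<comment> \<open>For fixed \<open>w\<close> the residuals are constants, and this is the
    one-dimensional identity along the line with direction \<open>a\<close>.\<close>
  also have "\<dots> = (\<integral>w. (\<integral>x. d\<phi> (\<lambda>i. R w i + x * a i) \<partial>?G) \<partial>M)"
  proof (rule Bochner_Integration.integral_cong[OF refl])
    fix w
    have c: "continuous_on UNIV (\<lambda>x. \<lambda>i. R w i + x * a i)"
      by (intro continuous_on_coordinatewise_then_product continuous_intros)
    have [measurable]: "(\<lambda>x. \<lambda>i. R w i + x * a i) \<in> borel_measurable borel"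
      by (rule vec) simp
    have "(\<integral>x. x * \<phi> (\<lambda>i. R w i + x * a i) \<partial>?G)
        = (\<integral>x. std_normal_density x * (x * \<phi> (\<lambda>i. R w i + x * a i)) \<partial>lborel)"
      by (subst integral_density) auto
    also have "\<dots> = (\<integral>x. std_normal_density x * d\<phi> (\<lambda>i. R w i + x * a i) \<partial>lborel)"
      by (rule std_normal_integration_by_parts[OF deriv _ bound])
        (rule continuous_on_compose2[OF cont(2) c], simp)
    also have "\<dots> = (\<integral>x. d\<phi> (\<lambda>i. R w i + x * a i) \<partial>?G)"
      by (subst integral_density) auto
    finally show "(\<integral>x. x * \<phi> (\<lambda>i. R w i + x * a i) \<partial>?G) = (\<integral>x. d\<phi> (\<lambda>i. R w i + x * a i) \<partial>?G)" .
  qed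
  also have "\<dots> = (\<integral>z. d\<phi> (\<lambda>i. R (snd z) i + fst z * a i) \<partial>?Q)"
  proof (subst P.integral_snd)
    show "integrable ?Q (\<lambda>(x, w). d\<phi> (\<lambda>i. R w i + x * a i))"
      by (rule P.integrable_const_bound[where B = C]) (auto simp: case_prod_beta bound)
  qed (simp add: case_prod_beta')
  also have "\<dots> = (\<integral>w. d\<phi> (\<lambda>i. V i w) \<partial>M)"
    unfolding R_def
  proof (rule fibre[of "\<lambda>s y. d\<phi> y", symmetric])
    show "d\<phi> x = d\<phi> y" if "\<And>i. i < L \<Longrightarrow> x i = y i" for x y
      by (rule dep(2)[OF that])
  qed measurable
  finally show ?thesis .
qed

section \<open>Piecewise constant approximation on a product space\<close>

text \<open>The level sets of \<open>q\<close> are the finitely many pieces on which the approximating functions are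
  constant in the first variable.\<close>

definition cell_approx :: "'a measure \<Rightarrow> 'b measure \<Rightarrow> ('a \<times> 'b \<Rightarrow> real) \<Rightarrow> bool" where
  "cell_approx A B V \<longleftrightarrow> V \<in> borel_measurable (A \<Otimes>\<^sub>M B) \<and>
     (\<forall>e>0. \<exists>q b. q \<in> measurable A (count_space (UNIV :: nat set)) \<and> finite (range q) \<and>
        (\<forall>i. b i \<in> borel_measurable B) \<and>
        (\<integral>\<^sup>+z. ennreal ((V z - b (q (fst z)) (snd z))\<^sup>2) \<partial>(A \<Otimes>\<^sub>M B)) < e)"

lemma cell_approxE:
  assumes "cell_approx A B V" "e > 0"
  obtains q b where "q \<in> measurable A (count_space (UNIV :: nat set))" "finite (range q)"
    "\<And>i. b i \<in> borel_measurable B"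
    "(\<integral>\<^sup>+z. ennreal ((V z - b (q (fst z)) (snd z))\<^sup>2) \<partial>(A \<Otimes>\<^sub>M B)) < e"
  using assms unfolding cell_approx_def by blast

lemma cell_approx_measurable: "cell_approx A B V \<Longrightarrow> V \<in> borel_measurable (A \<Otimes>\<^sub>M B)"
  by (simp add: cell_approx_def)

text \<open>The cell number takes countably many values, so measurability can be checked for each
  fixed cell.\<close>

lemma cell_fun_measurable:
  assumes "q \<in> measurable A (count_space (UNIV :: nat set))" "\<And>i. b i \<in> borel_measurable B"
  shows "(\<lambda>z. b (q (fst z)) (snd z) :: real) \<in> borel_measurable (A \<Otimes>\<^sub>M B)"
proof (rule measurable_compose_countable)
  show "(\<lambda>z. q (fst z)) \<in> measurable (A \<Otimes>\<^sub>M B) (count_space UNIV)"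
    using assms(1) by measurable
  show "(\<lambda>z. b i (snd z)) \<in> borel_measurable (A \<Otimes>\<^sub>M B)" for i
    using assms(2)[of i] by measurable
qed

lemma nn_integral_square_add_le:
  fixes f g :: "'a \<Rightarrow> real"
  assumes [measurable]: "f \<in> borel_measurable N" "g \<in> borel_measurable N"
  shows "(\<integral>\<^sup>+z. ennreal ((f z + g z)\<^sup>2) \<partial>N) \<le> 2 * (\<integral>\<^sup>+z. ennreal ((f z)\<^sup>2) \<partial>N) + 2 * (\<integral>\<^sup>+z. ennreal ((g z)\<^sup>2) \<partial>N)"
proof -
  have "(\<integral>\<^sup>+z. ennreal ((f z + g z)\<^sup>2) \<partial>N) \<le> (\<integral>\<^sup>+z. 2 * ennreal ((f z)\<^sup>2) + 2 * ennreal ((g z)\<^sup>2) \<partial>N)"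
  proof (rule nn_integral_mono)
    fix z
    have "ennreal ((f z + g z)\<^sup>2) \<le> ennreal (2 * (f z)\<^sup>2 + 2 * (g z)\<^sup>2)"
      using norm_add_square_le[of "f z" "g z"] by (intro ennreal_leI) simp
    then show "ennreal ((f z + g z)\<^sup>2) \<le> 2 * ennreal ((f z)\<^sup>2) + 2 * ennreal ((g z)\<^sup>2)"
      by (simp add: ennreal_mult)
  qed
  also have "\<dots> = 2 * (\<integral>\<^sup>+z. ennreal ((f z)\<^sup>2) \<partial>N) + 2 * (\<integral>\<^sup>+z. ennreal ((g z)\<^sup>2) \<partial>N)"
    by (simp add: nn_integral_add nn_integral_cmult)
  finally show ?thesis .
qed

text \<open>The 4 absorbs the factor 2 of \<open>nn_integral_square_add_le\<close> and the two
  summands. The error \<open>e\<close> ranges over \<open>ennreal\<close> and may be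
  infinite.\<close>

lemma ennreal_quarter_split:
  fixes a b e :: ennreal
  assumes "a < e / 4" "b < e / 4"
  shows "2 * a + 2 * b < e"
proof (cases "e = \<top>")
  case True
  moreover have "a < \<top>" "b < \<top>" using assms by (auto intro: order.strict_trans2)
  ultimately show ?thesis by (simp add: ennreal_mult_less_top)
next
  case False
  then obtain r where r: "e = ennreal r" "0 \<le> r" by (cases e) auto
  have e4: "e / 4 = ennreal (r / 4)"
    using r by (simp add: divide_ennreal[symmetric])
  obtain s where s: "a = ennreal s" "0 \<le> s" using assms(1) by (cases a) (auto simp: e4)
  obtain t where t: "b = ennreal t" "0 \<le> t" using assms(2) by (cases b) (auto simp: e4)
  have "s < r / 4" "t < r / 4"
    using assms s(2) t(2) unfolding r(1) e4[unfolded r(1)] s(1) t(1) by (auto simp: ennreal_less_iff)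
  then have "2 * s + 2 * t < r" by simp
  then have "ennreal (2 * s + 2 * t) < ennreal r" using s t by (intro ennreal_lessI) auto
  then show ?thesis using r s t by (simp add: ennreal_mult)
qed

lemma ennreal_quarter_pos: "0 < (e :: ennreal) \<Longrightarrow> 0 < e / 4"
  by (simp add: ennreal_zero_less_divide)

lemma cell_approx_add:
  assumes V: "cell_approx A B V" and W: "cell_approx A B W"
  shows "cell_approx A B (\<lambda>z. V z + W z)"
  unfolding cell_approx_def
proof (intro conjI allI impI)
  note [measurable] = cell_approx_measurable[OF V] cell_approx_measurable[OF W]
  show "(\<lambda>z. V z + W z) \<in> borel_measurable (A \<Otimes>\<^sub>M B)" by measurable
  fix e :: ennreal assume "e > 0"
  obtain q b where
    qb: "q \<in> measurable A (count_space (UNIV :: nat set))" "finite (range q)"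
    "\<And>i. b i \<in> borel_measurable B"
    "(\<integral>\<^sup>+z. ennreal ((V z - b (q (fst z)) (snd z))\<^sup>2) \<partial>(A \<Otimes>\<^sub>M B)) < e / 4" by (rule cell_approxE[OF V ennreal_quarter_pos[OF \<open>e > 0\<close>]]) (rule that)
  obtain r c where
    rc: "r \<in> measurable A (count_space (UNIV :: nat set))" "finite (range r)"
    "\<And>i. c i \<in> borel_measurable B"
    "(\<integral>\<^sup>+z. ennreal ((W z - c (r (fst z)) (snd z))\<^sup>2) \<partial>(A \<Otimes>\<^sub>M B)) < e / 4" by (rule cell_approxE[OF W ennreal_quarter_pos[OF \<open>e > 0\<close>]]) (rule that)
  define b' c' where "b' = (\<lambda>z. b (q (fst z)) (snd z))" "c' = (\<lambda>z. c (r (fst z)) (snd z))"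
  have [measurable]: "b' \<in> borel_measurable (A \<Otimes>\<^sub>M B)" "c' \<in> borel_measurable (A \<Otimes>\<^sub>M B)"
    unfolding b'_c'_def by (rule cell_fun_measurable[OF qb(1,3)], rule cell_fun_measurable[OF rc(1,3)])
  have b': "(\<integral>\<^sup>+z. ennreal ((V z - b' z)\<^sup>2) \<partial>(A \<Otimes>\<^sub>M B)) < e / 4"
    and c': "(\<integral>\<^sup>+z. ennreal ((W z - c' z)\<^sup>2) \<partial>(A \<Otimes>\<^sub>M B)) < e / 4"
    using qb(4) rc(4) by (simp_all add: b'_c'_def)
  note [measurable] = qb(1) rc(1) qb(3) rc(3)
  show "\<exists>q b. q \<in> measurable A (count_space (UNIV :: nat set)) \<and> finite (range q) \<and>
        (\<forall>i. b i \<in> borel_measurable B) \<and>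
        (\<integral>\<^sup>+z. ennreal ((V z + W z - b (q (fst z)) (snd z))\<^sup>2) \<partial>(A \<Otimes>\<^sub>M B)) < e"
  proof (intro exI conjI allI)
    \<comment> \<open>The common refinement of the two partitions, each pair of cell numbers coded
      as one number.\<close>
    show "(\<lambda>t. prod_encode (q t, r t)) \<in> measurable A (count_space UNIV)"
      by measurable
    have "finite (prod_encode ` (range q \<times> range r))" using qb(2) rc(2) by simp
    then show "finite (range (\<lambda>t. prod_encode (q t, r t)))"
      by (rule finite_subset[rotated]) auto
    show "(\<lambda>w. b (fst (prod_decode i)) w + c (snd (prod_decode i)) w) \<in> borel_measurable B" for i
      by measurable
    have "(\<integral>\<^sup>+z. ennreal ((V z - b' z + (W z - c' z))\<^sup>2) \<partial>(A \<Otimes>\<^sub>M B)) < e"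
      by (rule order_le_less_trans[OF nn_integral_square_add_le
            ennreal_quarter_split[OF b' c']]) measurable
    then show "(\<integral>\<^sup>+z. ennreal ((V z + W z - (b (fst (prod_decode (prod_encode (q (fst z), r (fst z))))) (snd z)
        + c (snd (prod_decode (prod_encode (q (fst z), r (fst z))))) (snd z)))\<^sup>2) \<partial>(A \<Otimes>\<^sub>M B)) < e"
      by (simp add: algebra_simps b'_c'_def)
  qed
qed

lemma cell_approx_close:
  assumes [measurable]: "V \<in> borel_measurable (A \<Otimes>\<^sub>M B)"
    and close: "\<And>e. e > 0 \<Longrightarrow> \<exists>W. cell_approx A B W \<and> (\<integral>\<^sup>+z. ennreal ((V z - W z)\<^sup>2) \<partial>(A \<Otimes>\<^sub>M B)) < e"
  shows "cell_approx A B V"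
  unfolding cell_approx_def
proof (intro conjI allI impI)
  fix e :: ennreal assume "e > 0"
  from close[OF ennreal_quarter_pos[OF \<open>e > 0\<close>]] obtain W where
    W: "cell_approx A B W" "(\<integral>\<^sup>+z. ennreal ((V z - W z)\<^sup>2) \<partial>(A \<Otimes>\<^sub>M B)) < e / 4" by blast
  obtain q b where
    qb: "q \<in> measurable A (count_space (UNIV :: nat set))" "finite (range q)"
    "\<And>i. b i \<in> borel_measurable B"
    "(\<integral>\<^sup>+z. ennreal ((W z - b (q (fst z)) (snd z))\<^sup>2) \<partial>(A \<Otimes>\<^sub>M B)) < e / 4" by (rule cell_approxE[OF W(1) ennreal_quarter_pos[OF \<open>e > 0\<close>]]) (rule that)
  define b' where "b' = (\<lambda>z. b (q (fst z)) (snd z))"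
  have [measurable]: "b' \<in> borel_measurable (A \<Otimes>\<^sub>M B)"
    unfolding b'_def by (rule cell_fun_measurable[OF qb(1,3)])
  have b': "(\<integral>\<^sup>+z. ennreal ((W z - b' z)\<^sup>2) \<partial>(A \<Otimes>\<^sub>M B)) < e / 4"
    using qb(4) by (simp add: b'_def)
  note [measurable] = cell_approx_measurable[OF W(1)]
  have "(\<integral>\<^sup>+z. ennreal ((V z - W z + (W z - b' z))\<^sup>2) \<partial>(A \<Otimes>\<^sub>M B)) < e"
    by (rule order_le_less_trans[OF nn_integral_square_add_le
          ennreal_quarter_split[OF W(2) b']]) measurable
  then show "\<exists>q b. q \<in> measurable A (count_space (UNIV :: nat set)) \<and> finite (range q) \<and>
        (\<forall>i. b i \<in> borel_measurable B) \<and>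
        (\<integral>\<^sup>+z. ennreal ((V z - b (q (fst z)) (snd z))\<^sup>2) \<partial>(A \<Otimes>\<^sub>M B)) < e"
    using qb by (auto simp: b'_def)
qed (fact assms)

lemma cell_approx_cong:
  assumes "cell_approx A B V" "\<And>z. z \<in> space (A \<Otimes>\<^sub>M B) \<Longrightarrow> V z = W z"
  shows "cell_approx A B W"
proof (rule cell_approx_close)
  show "W \<in> borel_measurable (A \<Otimes>\<^sub>M B)"
    by (rule iffD1[OF measurable_cong[of "A \<Otimes>\<^sub>M B" V W borel, OF assms(2)] cell_approx_measurable[OF assms(1)]])
  have "(\<integral>\<^sup>+z. ennreal ((W z - V z)\<^sup>2) \<partial>(A \<Otimes>\<^sub>M B)) = (\<integral>\<^sup>+z. 0 \<partial>(A \<Otimes>\<^sub>M B))"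
    using assms(2) by (intro nn_integral_cong) simp
  then show "\<exists>V. cell_approx A B V \<and> (\<integral>\<^sup>+z. ennreal ((W z - V z)\<^sup>2) \<partial>(A \<Otimes>\<^sub>M B)) < e" if "e > 0" for e
    using assms(1) that by auto
qed

text \<open>Serves twice: for countable disjoint unions of sets and for the passage from simple
  functions to a general \<open>V\<close>.\<close>

lemma cell_approx_dominated:
  assumes V [measurable]: "V \<in> borel_measurable (A \<Otimes>\<^sub>M B)"
    and S: "\<And>n. cell_approx A B (S n)"
    and conv: "\<And>z. z \<in> space (A \<Otimes>\<^sub>M B) \<Longrightarrow> (\<lambda>n. S n z) \<longlonglongrightarrow> V z"
    and dom: "\<And>n z. z \<in> space (A \<Otimes>\<^sub>M B) \<Longrightarrow> \<bar>V z - S n z\<bar> \<le> D z"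
    and [measurable]: "D \<in> borel_measurable (A \<Otimes>\<^sub>M B)"
    and fin: "(\<integral>\<^sup>+z. ennreal ((D z)\<^sup>2) \<partial>(A \<Otimes>\<^sub>M B)) < \<infinity>"
  shows "cell_approx A B V"
proof (rule cell_approx_close[OF V])
  fix e :: ennreal assume "e > 0"
  note [measurable] = cell_approx_measurable[OF S]
  have "(\<lambda>n. \<integral>\<^sup>+z. ennreal ((V z - S n z)\<^sup>2) \<partial>(A \<Otimes>\<^sub>M B)) \<longlonglongrightarrow> (\<integral>\<^sup>+z. 0 \<partial>(A \<Otimes>\<^sub>M B))"
  proof (rule nn_integral_dominated_convergence[where w = "\<lambda>z. ennreal ((D z)\<^sup>2)"])
    show "AE z in A \<Otimes>\<^sub>M B. ennreal ((V z - S n z)\<^sup>2) \<le> ennreal ((D z)\<^sup>2)" for n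
      using power_mono[OF dom, of _ n 2] by (intro AE_I2 ennreal_leI) simp
    show "AE z in A \<Otimes>\<^sub>M B. (\<lambda>n. ennreal ((V z - S n z)\<^sup>2)) \<longlonglongrightarrow> 0"
    proof (rule AE_I2)
      fix z assume "z \<in> space (A \<Otimes>\<^sub>M B)"
      then have "(\<lambda>n. ennreal ((V z - S n z)\<^sup>2)) \<longlonglongrightarrow> ennreal ((V z - V z)\<^sup>2)"
        by (intro tendsto_intros conv)
      then show "(\<lambda>n. ennreal ((V z - S n z)\<^sup>2)) \<longlonglongrightarrow> 0" by simp
    qed
  qed (use fin in simp_all)
  then have "\<forall>\<^sub>F n in sequentially. (\<integral>\<^sup>+z. ennreal ((V z - S n z)\<^sup>2) \<partial>(A \<Otimes>\<^sub>M B)) < e"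
    using \<open>e > 0\<close> by (intro order_tendstoD(2)) auto
  then show "\<exists>W. cell_approx A B W \<and> (\<integral>\<^sup>+z. ennreal ((V z - W z)\<^sup>2) \<partial>(A \<Otimes>\<^sub>M B)) < e"
    using S eventually_happens'[OF sequentially_bot] by blast
qed

lemma cell_approx_zero: "cell_approx A B (\<lambda>z. 0)"
  unfolding cell_approx_def by (auto intro!: exI[of _ "\<lambda>_. 0"] exI[of _ "\<lambda>_ _. 0"])

lemma cell_approx_cmult:
  assumes V: "cell_approx A B V"
  shows "cell_approx A B (\<lambda>z. c * V z)"
proof (cases "c = 0")
  case True
  then show ?thesis using cell_approx_zero by simp
next
  case False
  note [measurable] = cell_approx_measurable[OF V]
  show ?thesis
    unfolding cell_approx_def
  proof (intro conjI allI impI)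
    fix e :: ennreal assume "e > 0"
    have "c\<^sup>2 > 0" using False by simp
    then have e': "e / ennreal (c\<^sup>2) > 0" using \<open>e > 0\<close> by (simp add: ennreal_zero_less_divide)
    obtain q b where
      qb: "q \<in> measurable A (count_space (UNIV :: nat set))" "finite (range q)"
      "\<And>i. b i \<in> borel_measurable B"
      "(\<integral>\<^sup>+z. ennreal ((V z - b (q (fst z)) (snd z))\<^sup>2) \<partial>(A \<Otimes>\<^sub>M B)) < e / ennreal (c\<^sup>2)" by (rule cell_approxE[OF V e']) (rule that)
    define b' where "b' = (\<lambda>z. b (q (fst z)) (snd z))"
    have [measurable]: "b' \<in> borel_measurable (A \<Otimes>\<^sub>M B)"
      unfolding b'_def by (rule cell_fun_measurable[OF qb(1,3)])
    have b': "(\<integral>\<^sup>+z. ennreal ((V z - b' z)\<^sup>2) \<partial>(A \<Otimes>\<^sub>M B)) < e / ennreal (c\<^sup>2)"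
      using qb(4) by (simp add: b'_def)
    note [measurable] = qb(3)
    have "(\<integral>\<^sup>+z. ennreal ((c * V z - c * b' z)\<^sup>2) \<partial>(A \<Otimes>\<^sub>M B))
        = ennreal (c\<^sup>2) * (\<integral>\<^sup>+z. ennreal ((V z - b' z)\<^sup>2) \<partial>(A \<Otimes>\<^sub>M B))"
      by (simp add: right_diff_distrib[symmetric] power_mult_distrib ennreal_mult nn_integral_cmult)
    also have "\<dots> < ennreal (c\<^sup>2) * (e / ennreal (c\<^sup>2))"
      using b' \<open>c\<^sup>2 > 0\<close> by (intro ennreal_mult_strict_left_mono) auto
    also have "\<dots> = e"
      using \<open>c\<^sup>2 > 0\<close> by (simp add: ennreal_times_divide mult.commute mult_divide_eq_ennreal del: zero_less_power2)
    finally have "(\<integral>\<^sup>+z. ennreal ((c * V z - c * b' z)\<^sup>2) \<partial>(A \<Otimes>\<^sub>M B)) < e" .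
    then show "\<exists>q b. q \<in> measurable A (count_space (UNIV :: nat set)) \<and> finite (range q) \<and>
        (\<forall>i. b i \<in> borel_measurable B) \<and>
        (\<integral>\<^sup>+z. ennreal ((c * V z - b (q (fst z)) (snd z))\<^sup>2) \<partial>(A \<Otimes>\<^sub>M B)) < e"
      using qb(1,2,3) by (intro exI[of _ q] exI[of _ "\<lambda>i w. c * b i w"]) (auto simp: b'_def)
  qed measurable
qed

lemma cell_approx_sum:
  assumes "\<And>i. i \<in> J \<Longrightarrow> cell_approx A B (V i)"
  shows "cell_approx A B (\<lambda>z. \<Sum>i\<in>J. V i z)"
  using assms
proof (induction J rule: infinite_finite_induct)
  case (insert j J)
  then show ?case using cell_approx_add[of A B "V j" "\<lambda>z. \<Sum>i\<in>J. V i z"] by simp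
qed (simp_all add: cell_approx_zero)

lemma cell_approx_rectangle:
  assumes [measurable]: "a \<in> sets A" "b \<in> sets B"
  shows "cell_approx A B (indicator (a \<times> b))"
  unfolding cell_approx_def
proof (intro conjI allI impI)
  fix e :: ennreal assume "e > 0"
  show "\<exists>q r. q \<in> measurable A (count_space (UNIV :: nat set)) \<and> finite (range q) \<and>
        (\<forall>i. r i \<in> borel_measurable B) \<and>
        (\<integral>\<^sup>+z. ennreal ((indicator (a \<times> b) z - r (q (fst z)) (snd z))\<^sup>2) \<partial>(A \<Otimes>\<^sub>M B)) < e"
  proof (intro exI conjI allI)
    show "(\<lambda>t. if t \<in> a then 1 else 0) \<in> measurable A (count_space (UNIV :: nat set))"
      by measurable
    show "finite (range (\<lambda>t. if t \<in> a then 1 else 0 :: nat))"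
      by (rule finite_subset[of _ "{0, 1}"]) auto
    show "(\<lambda>w. if i = 1 then indicator b w else 0) \<in> borel_measurable B" for i :: nat
      by (cases "i = 1") auto
    have "(\<integral>\<^sup>+z. ennreal ((indicator (a \<times> b) z - (if (if fst z \<in> a then 1 else 0) = (1 :: nat) then indicator b (snd z) else 0))\<^sup>2) \<partial>(A \<Otimes>\<^sub>M B))
        = (\<integral>\<^sup>+z. 0 \<partial>(A \<Otimes>\<^sub>M B))"
      by (intro nn_integral_cong) (auto split: split_indicator simp: indicator_def)
    then show "(\<integral>\<^sup>+z. ennreal ((indicator (a \<times> b) z - (if (if fst z \<in> a then 1 else 0) = (1 :: nat) then indicator b (snd z) else 0))\<^sup>2) \<partial>(A \<Otimes>\<^sub>M B)) < e"
      using \<open>e > 0\<close> by simp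
  qed
qed measurable

text \<open>Rectangles form an intersection-stable generator of the product sigma-algebra.
  Complements are differences of indicators, and disjoint unions are dominated by the constant 1,
  which is square integrable since both measures are finite.\<close>

lemma cell_approx_indicator:
  assumes "finite_measure A" "finite_measure B" "E \<in> sets (A \<Otimes>\<^sub>M B)"
  shows "cell_approx A B (indicator E)"
proof -
  have fin: "emeasure (A \<Otimes>\<^sub>M B) (space (A \<Otimes>\<^sub>M B)) < \<infinity>"
    using finite_measure.emeasure_finite[OF finite_measure_pair_measure[OF assms(2,1)]]
    by (simp add: less_top)
  have "E \<in> sigma_sets (space A \<times> space B) {a \<times> b |a b. a \<in> sets A \<and> b \<in> sets B}"
    using assms(3) by (simp add: sets_pair_measure)
  with Int_stable_pair_measure_generator pair_measure_closed show ?thesis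
  proof (induction E rule: sigma_sets_induct_disjoint)
    case (basic E)
    then show ?case by (auto intro: cell_approx_rectangle)
  next
    case empty
    show ?case by (rule cell_approx_cong[OF cell_approx_zero]) simp
  next
    case (compl E)
    have "cell_approx A B (\<lambda>z. indicator (space A \<times> space B) z + (-1) * indicator E z)"
      by (intro cell_approx_add cell_approx_cmult cell_approx_rectangle compl) auto
    then show ?case
      by (rule cell_approx_cong) (auto simp: space_pair_measure split: split_indicator)
  next
    case (union E)
    have E [measurable]: "E i \<in> sets (A \<Otimes>\<^sub>M B)" for i
      using union(2) by (auto simp: sets_pair_measure)
    have S: "(\<Sum>i<n. indicator (E i) z) = (indicator (\<Union>i<n. E i) z :: real)" for n z
      using union(1) by (intro indicator_UN_disjoint[symmetric]) (auto simp: disjoint_family_on_def)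
    show ?case
    proof (rule cell_approx_dominated[where S = "\<lambda>n z. \<Sum>i<n. indicator (E i) z" and D = "\<lambda>_. 1"])
      show "cell_approx A B (\<lambda>z. \<Sum>i<n. indicator (E i) z)" for n
        by (intro cell_approx_sum union)
      show "(\<lambda>n. \<Sum>i<n. indicator (E i) z) \<longlonglongrightarrow> (indicator (\<Union>i. E i) z :: real)" for z
        unfolding S by (rule LIMSEQ_indicator_UN)
      show "\<bar>indicator (\<Union>i. E i) z - (\<Sum>i<n. indicator (E i) z)\<bar> \<le> (1 :: real)" for n z
        unfolding S by (auto split: split_indicator)
    qed (use fin in auto)
  qed
qed

text \<open>This takes the place of continuity in time: a square-integrable process is, up to a
  small error in mean square, constant in time on finitely many cells, which are measurable sets
  instead of intervals.\<close>

proposition cell_approx_L2: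
  assumes "finite_measure A" "finite_measure B" and [measurable]: "V \<in> borel_measurable (A \<Otimes>\<^sub>M B)"
    and fin: "(\<integral>\<^sup>+z. ennreal ((V z)\<^sup>2) \<partial>(A \<Otimes>\<^sub>M B)) < \<infinity>"
  shows "cell_approx A B V"
proof -
  let ?P = "A \<Otimes>\<^sub>M B"
  from borel_measurable_implies_sequence_metric[OF assms(3), of 0] obtain S where
    S: "\<And>n. simple_function ?P (S n)" "\<And>z. z \<in> space ?P \<Longrightarrow> (\<lambda>n. S n z) \<longlonglongrightarrow> V z"
      "\<And>n z. z \<in> space ?P \<Longrightarrow> \<bar>S n z\<bar> \<le> 2 * \<bar>V z\<bar>"
    by auto metis
  have simple: "cell_approx A B s" if s: "simple_function ?P s" for s :: "_ \<Rightarrow> real"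
  proof -
    have "finite (s ` space ?P)" using s by (rule simple_functionD)
    have "cell_approx A B (\<lambda>z. \<Sum>y\<in>s ` space ?P. y * indicator (s -` {y} \<inter> space ?P) z)"
      using s assms(1,2)
      by (intro cell_approx_sum cell_approx_cmult cell_approx_indicator) (auto dest: simple_functionD)
    then show ?thesis
    proof (rule cell_approx_cong)
      fix z assume z: "z \<in> space ?P"
      have "(\<Sum>y\<in>s ` space ?P. y * indicator (s -` {y} \<inter> space ?P) z)
          = (\<Sum>y\<in>s ` space ?P. if y = s z then y else 0)"
        using z by (intro sum.cong) (auto split: split_indicator)
      then show "(\<Sum>y\<in>s ` space ?P. y * indicator (s -` {y} \<inter> space ?P) z) = s z"
        using z \<open>finite (s ` space ?P)\<close> by (simp add: sum.delta)
    qed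
  qed
  show ?thesis
  proof (rule cell_approx_dominated[where S = S and D = "\<lambda>z. 3 * \<bar>V z\<bar>"])
    \<comment> \<open>The simple functions are bounded by \<open>2 * \<bar>V z\<bar>\<close>, whence
      the 3.\<close>
    show "\<bar>V z - S n z\<bar> \<le> 3 * \<bar>V z\<bar>" if "z \<in> space ?P" for n z
      using S(3)[OF that, of n] by linarith
    have "(\<integral>\<^sup>+z. ennreal ((3 * \<bar>V z\<bar>)\<^sup>2) \<partial>?P) = 9 * (\<integral>\<^sup>+z. ennreal ((V z)\<^sup>2) \<partial>?P)"
      by (simp add: power_mult_distrib ennreal_mult nn_integral_cmult)
    then show "(\<integral>\<^sup>+z. ennreal ((3 * \<bar>V z\<bar>)\<^sup>2) \<partial>?P) < \<infinity>"
      using fin by (simp add: ennreal_mult_less_top)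
  qed (use S simple in auto)
qed

section \<open>Integrals of a process against a function\<close>

lemma kernel_integral_measurable:
  fixes D :: "'a \<Rightarrow> 'b \<Rightarrow> real"
  assumes "finite_measure A" and [measurable]: "(\<lambda>(s, w). D s w) \<in> borel_measurable (A \<Otimes>\<^sub>M B)"
    "k \<in> borel_measurable A"
  shows "(\<lambda>w. \<integral>s. D s w * k s \<partial>A) \<in> borel_measurable B"
proof -
  interpret finite_measure A by fact
  have "(\<lambda>(w, s). D s w * k s) \<in> borel_measurable (B \<Otimes>\<^sub>M A)"
  proof -
    have "(\<lambda>(w, s). D s w) \<in> borel_measurable (B \<Otimes>\<^sub>M A)"
      using measurable_compose[OF measurable_pair_swap' assms(2)] by (simp add: case_prod_beta')
    then show ?thesis by (simp add: case_prod_beta')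
  qed
  then show ?thesis by (rule borel_measurable_lebesgue_integral)
qed

lemma AE_section_L2:
  fixes D :: "'a \<Rightarrow> 'b \<Rightarrow> real"
  assumes "finite_measure A" "finite_measure B"
    and [measurable]: "(\<lambda>(s, w). D s w) \<in> borel_measurable (A \<Otimes>\<^sub>M B)"
    and int: "integrable (A \<Otimes>\<^sub>M B) (\<lambda>(s, w). (D s w)\<^sup>2)"
  shows "AE w in B. (\<lambda>s. D s w) \<in> L2 A"
proof -
  interpret A: finite_measure A by fact
  interpret B: finite_measure B by fact
  interpret P: pair_sigma_finite A B ..
  have "AE w in B. integrable A (\<lambda>s. (D s w)\<^sup>2)"
    using P.AE_integrable_snd[OF int] .
  then show ?thesis
  proof (rule AE_mp, intro AE_I2 impI)
    fix w assume "w \<in> space B" "integrable A (\<lambda>s. (D s w)\<^sup>2)"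
    moreover have "(\<lambda>s. D s w) \<in> borel_measurable A"
      using measurable_compose[OF measurable_Pair2'[OF \<open>w \<in> space B\<close>] assms(3)] by simp
    ultimately show "(\<lambda>s. D s w) \<in> L2 A" by (simp add: L2_real_iff)
  qed
qed

text \<open>Cauchy-Schwarz in \<open>s\<close> for almost every \<open>w\<close>, then integration
  over \<open>w\<close>. Later \<open>D\<close> is the process or the error of an approximation to
  it; the second bound turns a small error on the product space into a small error of the
  integral.\<close>

lemma
  fixes D :: "'a \<Rightarrow> 'b \<Rightarrow> real"
  assumes "finite_measure A" "finite_measure B"
    and D [measurable]: "(\<lambda>(s, w). D s w) \<in> borel_measurable (A \<Otimes>\<^sub>M B)"
    and int: "integrable (A \<Otimes>\<^sub>M B) (\<lambda>(s, w). (D s w)\<^sup>2)"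
    and k: "k \<in> L2 A"
  shows kernel_integral_L2: "(\<lambda>w. \<integral>s. D s w * k s \<partial>A) \<in> L2 B"
    and kernel_integral_square_le: "(\<integral>w. (\<integral>s. D s w * k s \<partial>A)\<^sup>2 \<partial>B)
      \<le> (\<integral>s. (k s)\<^sup>2 \<partial>A) * (\<integral>z. (D (fst z) (snd z))\<^sup>2 \<partial>(A \<Otimes>\<^sub>M B))"
proof -
  interpret A: finite_measure A by fact
  interpret B: finite_measure B by fact
  interpret P: pair_sigma_finite A B ..
  note [measurable] = L2_measurable[OF k] kernel_integral_measurable[OF assms(1) D L2_measurable[OF k]]
  have bound: "AE w in B. (\<integral>s. D s w * k s \<partial>A)\<^sup>2 \<le> (\<integral>s. (k s)\<^sup>2 \<partial>A) * (\<integral>s. (D s w)\<^sup>2 \<partial>A)"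
    using AE_section_L2[OF assms(1-4)]
  proof (rule AE_mp, intro AE_I2 impI)
    fix w assume "(\<lambda>s. D s w) \<in> L2 A"
    from Cauchy_Schwarz_integral[OF this k]
    show "(\<integral>s. D s w * k s \<partial>A)\<^sup>2 \<le> (\<integral>s. (k s)\<^sup>2 \<partial>A) * (\<integral>s. (D s w)\<^sup>2 \<partial>A)" by (simp add: mult.commute)
  qed
  have i: "integrable B (\<lambda>w. (\<integral>s. (k s)\<^sup>2 \<partial>A) * (\<integral>s. (D s w)\<^sup>2 \<partial>A))"
    using P.integrable_snd[OF int] by simp
  have i2: "integrable B (\<lambda>w. (\<integral>s. D s w * k s \<partial>A)\<^sup>2)"
    by (rule Bochner_Integration.integrable_bound[OF i]) (use bound in auto)
  then show "(\<lambda>w. \<integral>s. D s w * k s \<partial>A) \<in> L2 B" by (simp add: L2_real_iff)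
  have "(\<integral>w. (\<integral>s. D s w * k s \<partial>A)\<^sup>2 \<partial>B) \<le> (\<integral>w. (\<integral>s. (k s)\<^sup>2 \<partial>A) * (\<integral>s. (D s w)\<^sup>2 \<partial>A) \<partial>B)"
    by (rule integral_mono_AE[OF i2 i bound])
  also have "\<dots> = (\<integral>s. (k s)\<^sup>2 \<partial>A) * (\<integral>z. (D (fst z) (snd z))\<^sup>2 \<partial>(A \<Otimes>\<^sub>M B))"
    using P.integral_snd[OF int] by (simp add: case_prod_beta')
  finally show "(\<integral>w. (\<integral>s. D s w * k s \<partial>A)\<^sup>2 \<partial>B)
      \<le> (\<integral>s. (k s)\<^sup>2 \<partial>A) * (\<integral>z. (D (fst z) (snd z))\<^sup>2 \<partial>(A \<Otimes>\<^sub>M B))" .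
qed

text \<open>The integrand is dominated by \<open>D^2 + k^2 * Z^2\<close>, whose last term is
  integrable because \<open>k\<close> and \<open>Z\<close> depend on different variables. Applied
  with \<open>Z\<close> a single value of the process and with \<open>Z\<close> an integral of
  it.\<close>

lemma kernel_integral_Fubini:
  fixes D :: "'a \<Rightarrow> 'b \<Rightarrow> real"
  assumes "finite_measure A" "finite_measure B"
    and D [measurable]: "(\<lambda>(s, w). D s w) \<in> borel_measurable (A \<Otimes>\<^sub>M B)"
    and int: "integrable (A \<Otimes>\<^sub>M B) (\<lambda>(s, w). (D s w)\<^sup>2)"
    and k: "k \<in> L2 A" and Z: "Z \<in> L2 B"
  shows "(\<integral>w. (\<integral>s. D s w * k s \<partial>A) * Z w \<partial>B) = (\<integral>s. k s * (\<integral>w. D s w * Z w \<partial>B) \<partial>A)"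
proof -
  interpret A: finite_measure A by fact
  interpret B: finite_measure B by fact
  interpret P: pair_sigma_finite A B ..
  note [measurable] = L2_measurable[OF k] L2_measurable[OF Z]
  have kZ: "integrable (A \<Otimes>\<^sub>M B) (\<lambda>z. (k (fst z))\<^sup>2 * (Z (snd z))\<^sup>2)"
    using L2_integrable_real[OF k] L2_integrable_real[OF Z]
    by (intro P.Fubini_integrable) auto
  have "integrable (A \<Otimes>\<^sub>M B) (\<lambda>(s, w). D s w * k s * Z w)"
  proof (rule Bochner_Integration.integrable_bound)
    show "integrable (A \<Otimes>\<^sub>M B) (\<lambda>z. (case z of (s, w) \<Rightarrow> (D s w)\<^sup>2) + (k (fst z))\<^sup>2 * (Z (snd z))\<^sup>2)"
      using int kZ by simp
    show "AE z in A \<Otimes>\<^sub>M B. norm (case z of (s, w) \<Rightarrow> D s w * k s * Z w)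
        \<le> norm ((case z of (s, w) \<Rightarrow> (D s w)\<^sup>2) + (k (fst z))\<^sup>2 * (Z (snd z))\<^sup>2)"
      using abs_mult_le_squares[of "D s w" "k s * Z w" for s w]
      by (intro AE_I2) (auto simp: mult.assoc power_mult_distrib)
  qed measurable
  note Fub = P.Fubini_integral[OF this]
  have "(\<integral>w. (\<integral>s. D s w * k s \<partial>A) * Z w \<partial>B) = (\<integral>w. (\<integral>s. D s w * k s * Z w \<partial>A) \<partial>B)"
    by simp
  also have "\<dots> = (\<integral>s. (\<integral>w. k s * (D s w * Z w) \<partial>B) \<partial>A)"
    using Fub by (simp add: mult_ac)
  finally show ?thesis by simp
qed

text \<open>Riesz-Fischer. A fast subsequence converges almost everywhere, and Fatou's lemma along
  it bounds the distance of the whole sequence from the limit.\<close>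

lemma (in prob_space) L2_complete:
  fixes Z :: "nat \<Rightarrow> 'a \<Rightarrow> real"
  assumes Z: "\<And>n. Z n \<in> L2 M"
    and Cauchy: "\<And>e. e > 0 \<Longrightarrow> \<exists>N. \<forall>m\<ge>N. \<forall>n\<ge>N. (\<integral>w. (Z m w - Z n w)\<^sup>2 \<partial>M) < e"
  shows "\<exists>z\<in>L2 M. L2_tendsto M Z z"
proof -
  note [measurable] = L2_measurable[OF Z]
  have d: "(\<lambda>w. Z m w - Z n w) \<in> L2 M" for m n by (intro L2_diff Z)
  \<comment> \<open>The bound \<open>(1 / 4) ^ k\<close> on the squares becomes
    \<open>(1 / 2) ^ k\<close> for the L1 norms of the increments, which is summable.\<close>
  have "\<exists>N. \<forall>k. \<forall>m\<ge>N k. \<forall>n\<ge>N k. (\<integral>w. (Z m w - Z n w)\<^sup>2 \<partial>M) < (1 / 4) ^ k"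
    by (intro choice allI Cauchy) simp
  then obtain N where N: "\<And>k m n. m \<ge> N k \<Longrightarrow> n \<ge> N k \<Longrightarrow> (\<integral>w. (Z m w - Z n w)\<^sup>2 \<partial>M) < (1 / 4) ^ k"
    by blast
  \<comment> \<open>Partial sums of \<open>N\<close> make the indices monotone and keep
    \<open>r k \<ge> N k\<close>.\<close>
  define r where "r k = (\<Sum>j\<le>k. N j)" for k
  have rN: "r k \<ge> N k" for k unfolding r_def by (rule member_le_sum) auto
  have rmono: "r k \<le> r (Suc k)" for k by (simp add: r_def)
  define g where "g k w = Z (r (Suc k)) w - Z (r k) w" for k w
  have g: "g k \<in> L2 M" for k unfolding g_def[abs_def] by (rule d)
  note [measurable] = L2_measurable[OF g]
  have gk: "(\<integral>w. \<bar>g k w\<bar> \<partial>M) \<le> (1 / 2) ^ k" for k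
  proof -
    have "(\<integral>w. \<bar>g k w\<bar> \<partial>M)\<^sup>2 \<le> (1 / 4) ^ k"
      using integral_abs_square_le[OF g[of k]]
        N[of k "r (Suc k)" "r k", OF order_trans[OF rN rmono] rN] by (simp add: g_def)
    also have "\<dots> = ((1 / 2) ^ k)\<^sup>2" by (simp add: power_mult[symmetric] power2_eq_square power_mult_distrib[symmetric])
    finally show ?thesis by (rule power2_le_imp_le) simp
  qed
  have "(\<integral>\<^sup>+w. (\<Sum>k. ennreal \<bar>g k w\<bar>) \<partial>M) = (\<Sum>k. \<integral>\<^sup>+w. ennreal \<bar>g k w\<bar> \<partial>M)"
    by (rule nn_integral_suminf) measurable
  also have "\<dots> \<le> (\<Sum>k. ennreal ((1 / 2) ^ k))"
  proof (intro suminf_le summableI)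
    fix k
    have "(\<integral>\<^sup>+w. ennreal \<bar>g k w\<bar> \<partial>M) = ennreal (\<integral>w. \<bar>g k w\<bar> \<partial>M)"
      using L2_integrable_id[OF g[of k]] by (intro nn_integral_eq_integral) auto
    also have "\<dots> \<le> ennreal ((1 / 2) ^ k)" by (rule ennreal_leI[OF gk])
    finally show "(\<integral>\<^sup>+w. ennreal \<bar>g k w\<bar> \<partial>M) \<le> ennreal ((1 / 2) ^ k)" .
  qed
  also have "\<dots> = ennreal (\<Sum>k. (1 / 2) ^ k)"
    by (rule suminf_ennreal2) (auto intro: summable_geometric)
  finally have "(\<integral>\<^sup>+w. (\<Sum>k. ennreal \<bar>g k w\<bar>) \<partial>M) \<noteq> \<infinity>" by (auto simp: top_unique)
  then have "AE w in M. (\<Sum>k. ennreal \<bar>g k w\<bar>) \<noteq> \<infinity>"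
    by (intro nn_integral_noteq_infinite) auto
  then have conv: "AE w in M. convergent (\<lambda>k. Z (r k) w)"
  proof (rule AE_mp, intro AE_I2 impI)
    fix w assume "(\<Sum>k. ennreal \<bar>g k w\<bar>) \<noteq> \<infinity>"
    then have "summable (\<lambda>k. \<bar>g k w\<bar>)"
      by (intro summable_suminf_not_top) auto
    then have "summable (\<lambda>k. g k w)" by (rule summable_rabs_cancel)
    then have "convergent (\<lambda>n. \<Sum>k<n. g k w)" by (simp add: summable_iff_convergent)
    moreover have "(\<Sum>k<n. g k w) = Z (r n) w - Z (r 0) w" for n
      unfolding g_def by (rule sum_lessThan_telescope)
    ultimately show "convergent (\<lambda>k. Z (r k) w)"
      using convergent_add[of "\<lambda>n. \<Sum>k<n. g k w" "\<lambda>_. Z (r 0) w"] by (simp add: convergent_const)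
  qed
  define z where "z w = lim (\<lambda>k. Z (r k) w)" for w
  have [measurable]: "z \<in> borel_measurable M"
    unfolding z_def[abs_def] by (rule borel_measurable_lim_metric) measurable
  have near: "(\<integral>\<^sup>+w. ennreal ((Z n w - z w)\<^sup>2) \<partial>M) \<le> ennreal ((1 / 4) ^ k)" if "n \<ge> N k" for n k
  proof -
    have "(\<integral>\<^sup>+w. ennreal ((Z n w - z w)\<^sup>2) \<partial>M) = (\<integral>\<^sup>+w. liminf (\<lambda>j. ennreal ((Z n w - Z (r j) w)\<^sup>2)) \<partial>M)"
    proof (rule nn_integral_cong_AE, use conv in \<open>rule AE_mp\<close>, intro AE_I2 impI)
      fix w assume "convergent (\<lambda>k. Z (r k) w)"
      then have "(\<lambda>j. ennreal ((Z n w - Z (r j) w)\<^sup>2)) \<longlonglongrightarrow> ennreal ((Z n w - z w)\<^sup>2)"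
        unfolding z_def by (intro tendsto_intros) (simp add: convergent_LIMSEQ_iff)
      then show "ennreal ((Z n w - z w)\<^sup>2) = liminf (\<lambda>j. ennreal ((Z n w - Z (r j) w)\<^sup>2))"
        by (intro lim_imp_Liminf[symmetric]) auto
    qed
    also have "\<dots> \<le> liminf (\<lambda>j. \<integral>\<^sup>+w. ennreal ((Z n w - Z (r j) w)\<^sup>2) \<partial>M)"
      by (rule nn_integral_liminf) measurable
    also have "\<dots> \<le> ennreal ((1 / 4) ^ k)"
    proof (rule Liminf_le)
      show "\<forall>\<^sub>F j in sequentially. (\<integral>\<^sup>+w. ennreal ((Z n w - Z (r j) w)\<^sup>2) \<partial>M) \<le> ennreal ((1 / 4) ^ k)"
        using eventually_ge_at_top[of k]
      proof eventually_elim
        case (elim j)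
        have "r j \<ge> N k" unfolding r_def using elim by (intro member_le_sum) auto
        have "(\<integral>\<^sup>+w. ennreal ((Z n w - Z (r j) w)\<^sup>2) \<partial>M) = ennreal (\<integral>w. (Z n w - Z (r j) w)\<^sup>2 \<partial>M)"
          using L2_integrable_real[OF d] by (intro nn_integral_eq_integral) auto
        also have "\<dots> \<le> ennreal ((1 / 4) ^ k)"
          using N[OF that \<open>r j \<ge> N k\<close>] by (intro ennreal_leI) simp
        finally show ?case .
      qed
    qed simp
    finally show ?thesis .
  qed
  have "integrable M (\<lambda>w. (Z (N 0) w - z w)\<^sup>2)"
    using near[of 0 "N 0"] by (intro integrableI_nonneg) (auto simp: order_le_less_trans)
  then have "(\<lambda>w. Z (N 0) w - z w) \<in> L2 M" by (simp add: L2_real_iff)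
  from L2_diff[OF Z[of "N 0"] this] have zL2: "z \<in> L2 M" by simp
  have "L2_tendsto M Z z"
    unfolding L2_tendsto_def
  proof (rule LIMSEQ_I)
    fix e :: real assume "e > 0"
    obtain k where k: "(1 / 4 :: real) ^ k < e"
      using real_arch_pow_inv[OF \<open>e > 0\<close>, of "1 / 4"] by auto
    show "\<exists>no. \<forall>n\<ge>no. norm ((\<integral>w. (norm (Z n w - z w))\<^sup>2 \<partial>M) - 0) < e"
    proof (intro exI allI impI)
      fix n assume n: "n \<ge> N k"
      have "ennreal (\<integral>w. (Z n w - z w)\<^sup>2 \<partial>M) = (\<integral>\<^sup>+w. ennreal ((Z n w - z w)\<^sup>2) \<partial>M)"
        using L2_integrable_real[OF L2_diff[OF Z zL2]] by (intro nn_integral_eq_integral[symmetric]) auto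
      also have "\<dots> \<le> ennreal ((1 / 4) ^ k)" by (rule near[OF n])
      finally have "(\<integral>w. (Z n w - z w)\<^sup>2 \<partial>M) \<le> (1 / 4) ^ k" by simp
      then show "norm ((\<integral>w. (norm (Z n w - z w))\<^sup>2 \<partial>M) - 0) < e" using k by simp
    qed
  qed
  then show ?thesis using zL2 by blast
qed

section \<open>The Gaussian isometry on H\<close>

text \<open>\<open>Y\<close> is to be the centred process \<open>Xu\<close>, not the observed one.
  Inside the locale, \<open>X f\<close> abbreviates its integral against a square-integrable
  \<open>f\<close>, and \<open>I\<close> the extension of this integral to \<open>H\<close>.\<close>

locale gaussian_completion = prob_space M
  for M :: "'w measure" +
  fixes mu :: "real measure" and Y :: "real \<Rightarrow> 'w \<Rightarrow> real"
    and emb :: "(real \<Rightarrow> real) \<Rightarrow> 'h::{real_inner, complete_space, second_countable_topology}"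
  assumes finite_mu: "finite_measure mu"
    and Y_measurable [measurable]: "(\<lambda>(t, w). Y t w) \<in> borel_measurable (mu \<Otimes>\<^sub>M M)"
    and gaussian: "centered_gaussian_process M (space mu) Y"
    and integrable_var: "integrable mu (\<lambda>t. cov M Y t t)"
    and completion: "is_H_completion M mu Y emb"
begin

sublocale mu: finite_measure mu by (rule finite_mu)
sublocale P: pair_sigma_finite mu M ..

abbreviation "X \<equiv> gauss_int_fun mu Y"
abbreviation "I \<equiv> gauss_int M mu Y emb"

section \<open>The isometry on square-integrable integrands\<close>

lemma emb_linear:
  "f \<in> L2 mu \<Longrightarrow> g \<in> L2 mu \<Longrightarrow> emb (\<lambda>t. a * f t + b * g t) = a *\<^sub>R emb f + b *\<^sub>R emb g"
  using completion by (auto simp: is_H_completion_def)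

lemma inner_emb: "f \<in> L2 mu \<Longrightarrow> g \<in> L2 mu \<Longrightarrow> inner (emb f) (emb g) = (\<integral>t. f t * cov_op_fun M mu Y g t \<partial>mu)"
  using completion by (auto simp: is_H_completion_def)

lemma emb_dense: "\<exists>g. (\<forall>n. g n \<in> L2 mu) \<and> (\<lambda>n. emb (g n)) \<longlonglongrightarrow> \<eta>"
proof -
  have "\<eta> \<in> closure (emb ` L2 mu)" using completion by (simp add: is_H_completion_def)
  then obtain x where x: "\<And>n. x n \<in> emb ` L2 mu" "x \<longlonglongrightarrow> \<eta>"
    by (auto simp: closure_sequential)
  then have "\<forall>n. \<exists>g. g \<in> L2 mu \<and> x n = emb g" by auto
  then obtain g where "\<forall>n. g n \<in> L2 mu \<and> x n = emb (g n)" by metis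
  moreover from this have "x = (\<lambda>n. emb (g n))" by auto
  ultimately show ?thesis using x(2) by blast
qed

lemma gaussian_char_comb:
  "finite J \<Longrightarrow> J \<subseteq> space mu \<Longrightarrow> gaussian_char M (\<lambda>w. \<Sum>t\<in>J. c t * Y t w)"
  by (rule centered_gaussian_imp_gaussian_char[OF gaussian[unfolded centered_gaussian_process_def, rule_format]]) simp

lemma centered_gaussian_Y: "t \<in> space mu \<Longrightarrow> centered_gaussian M (Y t)"
proof -
  assume t: "t \<in> space mu"
  have "centered_gaussian M (\<lambda>w. \<Sum>t\<in>{t}. 1 * Y t w)"
    using gaussian[unfolded centered_gaussian_process_def, rule_format, of "{t}" "\<lambda>_. 1"] t by simp
  then show ?thesis by simp
qed

lemma Y_L2: "t \<in> space mu \<Longrightarrow> Y t \<in> L2 M"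
  using centered_gaussian_imp_gaussian_char[OF centered_gaussian_Y] by (simp add: gaussian_char_def)

lemma cov_diag: "cov M Y t t = (\<integral>w. (Y t w)\<^sup>2 \<partial>M)"
  by (simp add: cov_def power2_eq_square)

lemma integrable_Y2: "integrable (mu \<Otimes>\<^sub>M M) (\<lambda>(t, w). (Y t w)\<^sup>2)"
proof (rule P.Fubini_integrable)
  show "integrable mu (\<lambda>t. \<integral>w. norm (case (t, w) of (t, w) \<Rightarrow> (Y t w)\<^sup>2) \<partial>M)"
    using integrable_var by (simp add: cov_diag)
  show "AE t in mu. integrable M (\<lambda>w. case (t, w) of (t, w) \<Rightarrow> (Y t w)\<^sup>2)"
    using L2_integrable_real[OF Y_L2] by (intro AE_I2) simp
qed measurable

lemma X_L2: "f \<in> L2 mu \<Longrightarrow> X f \<in> L2 M"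
  unfolding gauss_int_fun_def[abs_def]
  by (rule kernel_integral_L2[OF finite_mu finite_measure_axioms Y_measurable integrable_Y2])

text \<open>Only almost sure: the integral is known to be additive for those \<open>w\<close> whose
  path is square integrable.\<close>

lemma X_linear:
  assumes "f \<in> L2 mu" "g \<in> L2 mu"
  shows "AE w in M. X (\<lambda>t. a * f t + b * g t) w = a * X f w + b * X g w"
  using AE_section_L2[OF finite_mu finite_measure_axioms Y_measurable integrable_Y2]
proof (rule AE_mp, intro AE_I2 impI)
  fix w assume w: "(\<lambda>s. Y s w) \<in> L2 mu"
  have "X (\<lambda>t. a * f t + b * g t) w = (\<integral>s. a * (Y s w * f s) + b * (Y s w * g s) \<partial>mu)"
    unfolding gauss_int_fun_def by (intro Bochner_Integration.integral_cong refl) (simp add: algebra_simps)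
  then show "X (\<lambda>t. a * f t + b * g t) w = a * X f w + b * X g w"
    using L2_mult_integrable[OF w assms(1)] L2_mult_integrable[OF w assms(2)]
    by (simp add: gauss_int_fun_def)
qed

text \<open>Fubini twice: first with the outer factor \<open>X f\<close>, then with a single
  \<open>Y s\<close>, which turns the inner expectation into \<open>cov_op_fun\<close>.\<close>

lemma X_norm:
  assumes f: "f \<in> L2 mu"
  shows "(\<integral>w. (X f w)\<^sup>2 \<partial>M) = (norm (emb f))\<^sup>2"
proof -
  note Fub = kernel_integral_Fubini[OF finite_mu finite_measure_axioms Y_measurable integrable_Y2 f,
      folded gauss_int_fun_def]
  have "(\<integral>w. (X f w)\<^sup>2 \<partial>M) = (\<integral>s. f s * (\<integral>w. Y s w * X f w \<partial>M) \<partial>mu)"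
    using Fub[OF X_L2[OF f]] by (simp add: power2_eq_square)
  also have "\<dots> = (\<integral>s. f s * cov_op_fun M mu Y f s \<partial>mu)"
  proof (rule Bochner_Integration.integral_cong[OF refl])
    fix s assume s: "s \<in> space mu"
    have "(\<integral>w. Y s w * X f w \<partial>M) = cov_op_fun M mu Y f s"
      using Fub[OF Y_L2[OF s]] by (simp add: cov_op_fun_def cov_def mult.commute)
    then show "f s * (\<integral>w. Y s w * X f w \<partial>M) = f s * cov_op_fun M mu Y f s" by simp
  qed
  also have "\<dots> = (norm (emb f))\<^sup>2"
    using inner_emb[OF f f] by (simp add: power2_norm_eq_inner)
  finally show ?thesis .
qed

lemma X_dist:
  assumes "f \<in> L2 mu" "g \<in> L2 mu"
  shows "(\<integral>w. (X f w - X g w)\<^sup>2 \<partial>M) = (norm (emb f - emb g))\<^sup>2"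
proof -
  define h where "h = (\<lambda>t. 1 * f t + (-1) * g t)"
  have fg: "h \<in> L2 mu"
    using L2_diff[OF assms] by (simp add: h_def)
  note [measurable] = L2_measurable[OF X_L2[OF fg]] L2_measurable[OF X_L2[OF assms(1)]]
    L2_measurable[OF X_L2[OF assms(2)]]
  have "(\<integral>w. (X f w - X g w)\<^sup>2 \<partial>M) = (\<integral>w. (X h w)\<^sup>2 \<partial>M)"
    using X_linear[OF assms, of 1 "-1", folded h_def] by (intro integral_cong_AE) auto
  also have "\<dots> = (norm (emb f - emb g))\<^sup>2"
    unfolding X_norm[OF fg] unfolding h_def emb_linear[OF assms] by simp
  finally show ?thesis .
qed

text \<open>Within a cell \<open>q\<^sup>-\<^sup>1 i\<close>, the sample point \<open>\<tau> i\<close> nearly minimises the distance of \<open>Y t\<close> to the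
  approximating variable, so \<open>Y\<close> is close to its own samples.\<close>

lemma cell_sample:
  assumes "e > 0"
  obtains q \<tau> where "q \<in> measurable mu (count_space (UNIV :: nat set))" "finite (range q)"
    "\<And>s. s \<in> space mu \<Longrightarrow> \<tau> (q s) \<in> space mu"
    "(\<lambda>(s, w). Y s w - Y (\<tau> (q s)) w) \<in> borel_measurable (mu \<Otimes>\<^sub>M M)"
    "(\<integral>\<^sup>+z. ennreal ((Y (fst z) (snd z) - Y (\<tau> (q (fst z))) (snd z))\<^sup>2) \<partial>(mu \<Otimes>\<^sub>M M)) < ennreal e"
proof -
  \<comment> \<open>The slack granted to each sample point. The \<open>+ 1\<close> avoids dividing
    by zero when \<open>mu\<close> is null, and the total slack stays below
    \<open>e / 8\<close>.\<close>
  define \<delta> where "\<delta> = e / (8 * (measure mu (space mu) + 1))"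
  have m0: "measure mu (space mu) + 1 > 0" using measure_nonneg[of mu "space mu"] by linarith
  then have "\<delta> > 0" using \<open>e > 0\<close> by (simp add: \<delta>_def)
  have \<delta>m: "\<delta> * measure mu (space mu) < e / 8"
  proof -
    have "\<delta> * measure mu (space mu) < \<delta> * (measure mu (space mu) + 1)"
      using \<open>\<delta> > 0\<close> by simp
    also have "\<dots> = e / 8" using m0 by (simp add: \<delta>_def field_simps)
    finally show ?thesis .
  qed
  have "(\<integral>\<^sup>+z. ennreal ((case_prod Y z)\<^sup>2) \<partial>(mu \<Otimes>\<^sub>M M)) < \<infinity>"
    using integrable_Y2 by (simp add: integrable_iff_bounded case_prod_beta')
  then have approx: "cell_approx mu M (case_prod Y)"
    by (intro cell_approx_L2 finite_mu finite_measure_axioms) (use Y_measurable in auto)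
  have "ennreal (e / 8) > 0" using \<open>e > 0\<close> by simp
  obtain q b where qb: "q \<in> measurable mu (count_space (UNIV :: nat set))" "finite (range q)"
    "\<And>i. b i \<in> borel_measurable M"
    "(\<integral>\<^sup>+z. ennreal ((case_prod Y z - b (q (fst z)) (snd z))\<^sup>2) \<partial>(mu \<Otimes>\<^sub>M M)) < ennreal (e / 8)"
    by (rule cell_approxE[OF approx \<open>ennreal (e / 8) > 0\<close>]) (rule that)
  define b' where "b' = (\<lambda>z. b (q (fst z)) (snd z))"
  have b'm [measurable]: "b' \<in> borel_measurable (mu \<Otimes>\<^sub>M M)"
    unfolding b'_def by (rule cell_fun_measurable[OF qb(1,3)])
  define \<phi> where "\<phi> i t = (\<integral>\<^sup>+w. ennreal ((Y t w - b i w)\<^sup>2) \<partial>M)" for i t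
  define C where "C i = {t \<in> space mu. q t = i}" for i
  \<comment> \<open>The infimum over a cell need not be attained, hence the slack
    \<open>\<delta>\<close>; if it is infinite, every point of the cell will do.\<close>
  have "\<exists>t. C i \<noteq> {} \<longrightarrow> t \<in> C i \<and> \<phi> i t \<le> (INF t\<in>C i. \<phi> i t) + ennreal \<delta>" for i
  proof (cases "C i = {} \<or> (INF t\<in>C i. \<phi> i t) = \<top>")
    case True
    then show ?thesis by auto
  next
    case False
    then obtain r where r: "(INF t\<in>C i. \<phi> i t) = ennreal r" "r \<ge> 0"
      by (cases "INF t\<in>C i. \<phi> i t") auto
    then have "(INF t\<in>C i. \<phi> i t) < (INF t\<in>C i. \<phi> i t) + ennreal \<delta>"
      using \<open>\<delta> > 0\<close> by (simp add: ennreal_less_iff flip: ennreal_plus)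
    then show ?thesis by (auto simp: INF_less_iff intro: less_imp_le)
  qed
  then obtain \<tau> where \<tau>: "\<And>i. C i \<noteq> {} \<Longrightarrow> \<tau> i \<in> C i"
    "\<And>i. C i \<noteq> {} \<Longrightarrow> \<phi> i (\<tau> i) \<le> (INF t\<in>C i. \<phi> i t) + ennreal \<delta>" by metis
  have \<tau>s: "\<tau> (q s) \<in> space mu" "\<phi> (q s) (\<tau> (q s)) \<le> \<phi> (q s) s + ennreal \<delta>" if "s \<in> space mu" for s
  proof -
    have "s \<in> C (q s)" using that by (simp add: C_def)
    then show "\<tau> (q s) \<in> space mu" using \<tau>(1)[of "q s"] by (auto simp: C_def)
    have "\<phi> (q s) (\<tau> (q s)) \<le> (INF t\<in>C (q s). \<phi> (q s) t) + ennreal \<delta>"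
      using \<open>s \<in> C (q s)\<close> by (intro \<tau>(2)) auto
    also have "\<dots> \<le> \<phi> (q s) s + ennreal \<delta>"
      using \<open>s \<in> C (q s)\<close> by (intro add_right_mono INF_lower)
    finally show "\<phi> (q s) (\<tau> (q s)) \<le> \<phi> (q s) s + ennreal \<delta>" .
  qed
  define Yt where "Yt = (\<lambda>z. Y (\<tau> (q (fst z))) (snd z))"
  have Yt [measurable]: "Yt \<in> borel_measurable (mu \<Otimes>\<^sub>M M)"
  proof -
    \<comment> \<open>On empty cells \<open>\<tau>\<close> is arbitrary and may leave the time
      interval, where \<open>Y\<close> need not be measurable; these cells are sent to 0.\<close>
    have "(\<lambda>z. (if C (q (fst z)) = {} then (\<lambda>_. 0) else Y (\<tau> (q (fst z)))) (snd z)) \<in> borel_measurable (mu \<Otimes>\<^sub>M M)"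
    proof (rule cell_fun_measurable[OF qb(1), of "\<lambda>i. if C i = {} then (\<lambda>_. 0) else Y (\<tau> i)"])
      fix i
      show "(if C i = {} then (\<lambda>_. 0) else Y (\<tau> i)) \<in> borel_measurable M"
        using L2_measurable[OF Y_L2[of "\<tau> i"]] \<tau>(1)[of i] by (auto simp: C_def)
    qed
    moreover have "(if C (q (fst z)) = {} then (\<lambda>_. 0) else Y (\<tau> (q (fst z)))) (snd z) = Yt z"
      if "z \<in> space (mu \<Otimes>\<^sub>M M)" for z
      using that by (auto simp: C_def Yt_def space_pair_measure)
    ultimately show ?thesis by (simp cong: measurable_cong)
  qed
  \<comment> \<open>Within a cell the sample is, up to \<open>\<delta>\<close>, at least as close to
    the approximating variable as \<open>Y s\<close> is. Its total error is therefore at most that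
    of \<open>Y\<close> plus \<open>\<delta>\<close> times the mass of \<open>mu\<close>.\<close>
  have "(\<integral>\<^sup>+z. ennreal ((Yt z - b' z)\<^sup>2) \<partial>(mu \<Otimes>\<^sub>M M)) = (\<integral>\<^sup>+s. (\<integral>\<^sup>+w. ennreal ((Yt (s, w) - b' (s, w))\<^sup>2) \<partial>M) \<partial>mu)"
    by (rule nn_integral_fst[symmetric]) measurable
  also have "\<dots> = (\<integral>\<^sup>+s. \<phi> (q s) (\<tau> (q s)) \<partial>mu)"
    by (simp add: \<phi>_def Yt_def b'_def)
  also have "\<dots> \<le> (\<integral>\<^sup>+s. \<phi> (q s) s + ennreal \<delta> \<partial>mu)"
    by (intro nn_integral_mono \<tau>s)
  also have "\<dots> = (\<integral>\<^sup>+s. \<phi> (q s) s \<partial>mu) + ennreal (\<delta> * measure mu (space mu))"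
  proof -
    have "(\<lambda>s. \<integral>\<^sup>+w. ennreal ((case_prod Y (s, w) - b' (s, w))\<^sup>2) \<partial>M) \<in> borel_measurable mu"
      by measurable
    then have "(\<lambda>s. \<phi> (q s) s) \<in> borel_measurable mu" by (simp add: \<phi>_def b'_def)
    then show ?thesis
      using \<open>\<delta> > 0\<close> by (simp add: nn_integral_add mu.emeasure_eq_measure ennreal_mult)
  qed
  also have "(\<integral>\<^sup>+s. \<phi> (q s) s \<partial>mu) = (\<integral>\<^sup>+s. (\<integral>\<^sup>+w. ennreal ((case_prod Y (s, w) - b' (s, w))\<^sup>2) \<partial>M) \<partial>mu)"
    by (simp add: \<phi>_def b'_def)
  also have "\<dots> = (\<integral>\<^sup>+z. ennreal ((case_prod Y z - b' z)\<^sup>2) \<partial>(mu \<Otimes>\<^sub>M M))"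
    by (rule nn_integral_fst) measurable
  also have "\<dots> + ennreal (\<delta> * measure mu (space mu)) < ennreal (e / 8) + ennreal (e / 8)"
    using qb(4) \<delta>m \<open>\<delta> > 0\<close> by (intro add_strict_mono) (auto simp: b'_def ennreal_less_iff)
  also have "\<dots> = ennreal e / 4"
  proof -
    have "ennreal (e / 8) + ennreal (e / 8) = ennreal (e / 4)" using \<open>e > 0\<close> by (simp flip: ennreal_plus)
    also have "\<dots> = ennreal e / 4" using \<open>e > 0\<close> by (simp add: divide_ennreal[symmetric])
    finally show ?thesis .
  qed
  finally have 1: "(\<integral>\<^sup>+z. ennreal ((b' z - Yt z)\<^sup>2) \<partial>(mu \<Otimes>\<^sub>M M)) < ennreal e / 4"
    by (simp add: power2_commute)
  have "(\<integral>\<^sup>+z. ennreal ((case_prod Y z - b' z)\<^sup>2) \<partial>(mu \<Otimes>\<^sub>M M)) < ennreal (e / 8)"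
    using qb(4) by (simp add: b'_def)
  also have "\<dots> \<le> ennreal (e / 4)" using \<open>e > 0\<close> by (intro ennreal_leI) simp
  also have "\<dots> = ennreal e / 4" using \<open>e > 0\<close> by (simp add: divide_ennreal[symmetric])
  finally have 2: "(\<integral>\<^sup>+z. ennreal ((case_prod Y z - b' z)\<^sup>2) \<partial>(mu \<Otimes>\<^sub>M M)) < ennreal e / 4" .
  have 3: "(\<integral>\<^sup>+z. ennreal ((case_prod Y z - b' z + (b' z - Yt z))\<^sup>2) \<partial>(mu \<Otimes>\<^sub>M M)) < ennreal e"
    by (rule order_le_less_trans[OF nn_integral_square_add_le ennreal_quarter_split[OF 2 1]]) measurable
  have 4: "(\<lambda>z. case_prod Y z - Yt z) \<in> borel_measurable (mu \<Otimes>\<^sub>M M)" by measurable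
  show thesis
    by (rule that[of q \<tau>, OF qb(1,2) \<tau>s(1)]) (use 3 4 in \<open>auto simp: Yt_def case_prod_beta'\<close>)
qed

lemma cell_sample_integrable:
  assumes "e > 0"
  obtains q \<tau> where "q \<in> measurable mu (count_space (UNIV :: nat set))" "finite (range q)"
    "\<And>s. s \<in> space mu \<Longrightarrow> \<tau> (q s) \<in> space mu"
    "(\<lambda>(s, w). Y s w - Y (\<tau> (q s)) w) \<in> borel_measurable (mu \<Otimes>\<^sub>M M)"
    "integrable (mu \<Otimes>\<^sub>M M) (\<lambda>(s, w). (Y s w - Y (\<tau> (q s)) w)\<^sup>2)"
    "(\<integral>z. (Y (fst z) (snd z) - Y (\<tau> (q (fst z))) (snd z))\<^sup>2 \<partial>(mu \<Otimes>\<^sub>M M)) < e"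
proof -
  obtain q \<tau> where q: "q \<in> measurable mu (count_space (UNIV :: nat set))" "finite (range q)"
    "\<And>s. s \<in> space mu \<Longrightarrow> \<tau> (q s) \<in> space mu"
    and m [measurable]: "(\<lambda>(s, w). Y s w - Y (\<tau> (q s)) w) \<in> borel_measurable (mu \<Otimes>\<^sub>M M)"
    and lt: "(\<integral>\<^sup>+z. ennreal ((Y (fst z) (snd z) - Y (\<tau> (q (fst z))) (snd z))\<^sup>2) \<partial>(mu \<Otimes>\<^sub>M M)) < ennreal e"
    by (rule cell_sample[OF assms]) (rule that)
  define D where "D = (\<lambda>z. Y (fst z) (snd z) - Y (\<tau> (q (fst z))) (snd z))"
  have [measurable]: "D \<in> borel_measurable (mu \<Otimes>\<^sub>M M)"
    using m by (simp add: D_def case_prod_beta')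
  have lt': "(\<integral>\<^sup>+z. ennreal ((D z)\<^sup>2) \<partial>(mu \<Otimes>\<^sub>M M)) < ennreal e"
    using lt by (simp add: D_def)
  have i: "integrable (mu \<Otimes>\<^sub>M M) (\<lambda>z. (D z)\<^sup>2)"
  proof (rule integrableI_nonneg)
    show "(\<integral>\<^sup>+z. ennreal ((D z)\<^sup>2) \<partial>(mu \<Otimes>\<^sub>M M)) < \<infinity>"
      using order.strict_trans[OF lt' ennreal_less_top] by simp
  qed auto
  have "ennreal (\<integral>z. (D z)\<^sup>2 \<partial>(mu \<Otimes>\<^sub>M M)) < ennreal e"
    using lt' nn_integral_eq_integral[OF i] by simp
  then have "(\<integral>z. (D z)\<^sup>2 \<partial>(mu \<Otimes>\<^sub>M M)) < e" by (simp add: ennreal_less_iff)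
  then show thesis
    by (intro that[of q \<tau>, OF q m]) (use i in \<open>simp_all add: D_def case_prod_beta'\<close>)
qed

text \<open>Gaussianity is given for finite combinations only. Replacing \<open>Y s\<close> by the
  sample of its cell turns the integral into such a combination, and
  \<open>kernel_integral_square_le\<close> bounds the error; the Gaussian property survives the
  limit.\<close>

lemma gaussian_char_X:
  assumes g: "g \<in> L2 mu"
  shows "gaussian_char M (X g)"
proof -
  have gi: "integrable mu g" by (rule mu.L2_integrable_id[OF g])
  have "\<exists>Z. gaussian_char M Z \<and> (\<integral>w. (norm (Z w - X g w))\<^sup>2 \<partial>M) \<le> (\<integral>s. (g s)\<^sup>2 \<partial>mu) * (1 / real (Suc n))" for n
  proof -
    obtain q \<tau> where q [measurable]: "q \<in> measurable mu (count_space (UNIV :: nat set))"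
      and fin: "finite (range q)" and \<tau>: "\<And>s. s \<in> space mu \<Longrightarrow> \<tau> (q s) \<in> space mu"
      and D: "(\<lambda>(s, w). Y s w - Y (\<tau> (q s)) w) \<in> borel_measurable (mu \<Otimes>\<^sub>M M)"
        "integrable (mu \<Otimes>\<^sub>M M) (\<lambda>(s, w). (Y s w - Y (\<tau> (q s)) w)\<^sup>2)"
        "(\<integral>z. (Y (fst z) (snd z) - Y (\<tau> (q (fst z))) (snd z))\<^sup>2 \<partial>(mu \<Otimes>\<^sub>M M)) < 1 / real (Suc n)"
      by (rule cell_sample_integrable[of "1 / real (Suc n)"]) (simp, rule that)
    define J where "J = q ` space mu"
    have J: "finite J" unfolding J_def using fin by (rule finite_subset[rotated]) auto
    define a where "a i = (\<integral>s. indicator {s \<in> space mu. q s = i} s * g s \<partial>mu)" for i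
    have cell [measurable]: "{s \<in> space mu. q s = i} \<in> sets mu" for i by measurable
    have gint: "integrable mu (\<lambda>s. indicator {s \<in> space mu. q s = i} s * g s)" for i
      using integrable_mult_indicator[OF cell gi] by simp
    define Z where "Z w = (\<Sum>i\<in>J. a i * Y (\<tau> i) w)" for w
    have step: "Y (\<tau> (q s)) w * g s = (\<Sum>i\<in>J. indicator {s \<in> space mu. q s = i} s * g s * Y (\<tau> i) w)"
      if "s \<in> space mu" for s w
    proof -
      have "(\<Sum>i\<in>J. indicator {s \<in> space mu. q s = i} s * g s * Y (\<tau> i) w)
          = (\<Sum>i\<in>J. if i = q s then g s * Y (\<tau> i) w else 0)"
        using that by (intro sum.cong) (auto split: split_indicator)
      also have "\<dots> = g s * Y (\<tau> (q s)) w" using J that by (simp add: J_def sum.delta)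
      finally show ?thesis by simp
    qed
    have Zint: "integrable mu (\<lambda>s. Y (\<tau> (q s)) w * g s)" for w
      by (rule iffD2[OF Bochner_Integration.integrable_cong[OF refl step]])
        (auto intro!: Bochner_Integration.integrable_sum integrable_mult_left gint)
    have Z: "Z w = (\<integral>s. Y (\<tau> (q s)) w * g s \<partial>mu)" for w
    proof -
      have "(\<integral>s. Y (\<tau> (q s)) w * g s \<partial>mu)
          = (\<integral>s. (\<Sum>i\<in>J. indicator {s \<in> space mu. q s = i} s * g s * Y (\<tau> i) w) \<partial>mu)"
        by (rule Bochner_Integration.integral_cong[OF refl step])
      also have "\<dots> = Z w"
        unfolding Z_def a_def using gint by (subst Bochner_Integration.integral_sum) auto
      finally show ?thesis by simp
    qed
    have "gaussian_char M Z"
    proof -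
      \<comment> \<open>Nothing says that \<open>\<tau>\<close> is injective, while a Gaussian
        combination is indexed by a set of times; so the coefficients of cells with the same sample
        point are added.\<close>
      have "Z w = (\<Sum>t\<in>\<tau> ` J. (\<Sum>i\<in>{i \<in> J. \<tau> i = t}. a i) * Y t w)" for w
        unfolding Z_def by (subst sum.image_gen[OF J, where g = \<tau>])
          (auto simp: sum_distrib_right intro!: sum.cong)
      then have "Z = (\<lambda>w. \<Sum>t\<in>\<tau> ` J. (\<Sum>i\<in>{i \<in> J. \<tau> i = t}. a i) * Y t w)" by auto
      moreover have "\<tau> ` J \<subseteq> space mu" using \<tau> by (auto simp: J_def)
      ultimately show ?thesis using gaussian_char_comb[of "\<tau> ` J"] J by simp
    qed
    then have "Z \<in> L2 M" by (simp add: gaussian_char_def)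
    define K where "K w = (\<integral>s. (Y s w - Y (\<tau> (q s)) w) * g s \<partial>mu)" for w
    note [measurable] = L2_measurable[OF X_L2[OF g]] L2_measurable[OF \<open>Z \<in> L2 M\<close>]
    have [measurable]: "K \<in> borel_measurable M"
      unfolding K_def[abs_def]
      by (rule L2_measurable[OF kernel_integral_L2[OF finite_mu finite_measure_axioms D(1,2) g]])
    have "AE w in M. X g w - Z w = K w"
      using AE_section_L2[OF finite_mu finite_measure_axioms Y_measurable integrable_Y2]
    proof (rule AE_mp, intro AE_I2 impI)
      fix w assume "(\<lambda>s. Y s w) \<in> L2 mu"
      then show "X g w - Z w = K w"
        using L2_mult_integrable[OF _ g] Zint
        by (simp add: K_def Z gauss_int_fun_def left_diff_distrib)
    qed
    then have "AE w in M. (norm (Z w - X g w))\<^sup>2 = (K w)\<^sup>2"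
      by eventually_elim (metis power2_abs power2_commute real_norm_def)
    then have "(\<integral>w. (norm (Z w - X g w))\<^sup>2 \<partial>M) = (\<integral>w. (K w)\<^sup>2 \<partial>M)"
      by (intro integral_cong_AE) auto
    also have "\<dots> \<le> (\<integral>s. (g s)\<^sup>2 \<partial>mu) * (\<integral>z. (Y (fst z) (snd z) - Y (\<tau> (q (fst z))) (snd z))\<^sup>2 \<partial>(mu \<Otimes>\<^sub>M M))"
      unfolding K_def by (rule kernel_integral_square_le[OF finite_mu finite_measure_axioms D(1,2) g])
    also have "\<dots> \<le> (\<integral>s. (g s)\<^sup>2 \<partial>mu) * (1 / real (Suc n))"
      using D(3) by (intro mult_left_mono) auto
    finally show ?thesis using \<open>gaussian_char M Z\<close> by blast
  qed
  then obtain Z where Z: "\<And>n. gaussian_char M (Z n)"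
    "\<And>n. (\<integral>w. (norm (Z n w - X g w))\<^sup>2 \<partial>M) \<le> (\<integral>s. (g s)\<^sup>2 \<partial>mu) * (1 / real (Suc n))" by metis
  have "(\<lambda>n. (\<integral>s. (g s)\<^sup>2 \<partial>mu) * (1 / real (Suc n))) \<longlonglongrightarrow> 0"
    using tendsto_mult_left[OF LIMSEQ_inverse_real_of_nat, of "\<integral>s. (g s)\<^sup>2 \<partial>mu"]
    by (simp add: inverse_eq_divide)
  from L2_tendsto_bound[OF Z(2) this] have "L2_tendsto M Z (X g)" .
  then show ?thesis using Z(1) X_L2[OF g] by (rule gaussian_char_limit)
qed

text \<open>The normalised indicators of the cells recover \<open>Y t\<close> from its local averages.\<close>

lemma cell_average:
  assumes "e > 0"
  obtains q k where "q \<in> measurable mu (count_space (UNIV :: nat set))" "\<And>i. k i \<in> L2 mu"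
    "(\<integral>\<^sup>+z. ennreal ((Y (fst z) (snd z) - X (k (q (fst z))) (snd z))\<^sup>2) \<partial>(mu \<Otimes>\<^sub>M M)) \<le> ennreal e"
proof -
  obtain q \<tau> where q [measurable]: "q \<in> measurable mu (count_space (UNIV :: nat set))"
    and fin: "finite (range q)" and \<tau>: "\<And>s. s \<in> space mu \<Longrightarrow> \<tau> (q s) \<in> space mu"
    and D: "(\<lambda>(s, w). Y s w - Y (\<tau> (q s)) w) \<in> borel_measurable (mu \<Otimes>\<^sub>M M)"
      "integrable (mu \<Otimes>\<^sub>M M) (\<lambda>(s, w). (Y s w - Y (\<tau> (q s)) w)\<^sup>2)"
      "(\<integral>z. (Y (fst z) (snd z) - Y (\<tau> (q (fst z))) (snd z))\<^sup>2 \<partial>(mu \<Otimes>\<^sub>M M)) < e / 4"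
    by (rule cell_sample_integrable[of "e / 4"]) (use \<open>e > 0\<close> in simp, rule that)
  define J where "J = q ` space mu"
  have J: "finite J" unfolding J_def using fin by (rule finite_subset[rotated]) auto
  define C where "C i = {s \<in> space mu. q s = i}" for i
  have C [measurable]: "C i \<in> sets mu" for i unfolding C_def by measurable
  define m where "m i = measure mu (C i)" for i
  \<comment> \<open>On a null cell, division by zero makes \<open>k i\<close> zero; such a cell
    contributes nothing.\<close>
  define k where "k i s = indicator (C i) s / m i" for i s
  have k: "k i \<in> L2 mu" for i
    unfolding k_def[abs_def]
    by (rule mu.L2_bounded[where C = "1 / m i"]) (auto simp: m_def split: split_indicator)
  define \<Delta> where "\<Delta> z = Y (fst z) (snd z) - Y (\<tau> (q (fst z))) (snd z)" for z
  have [measurable]: "\<Delta> \<in> borel_measurable (mu \<Otimes>\<^sub>M M)"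
    using D(1) by (simp add: \<Delta>_def[abs_def] case_prod_beta')
  have \<Delta>int: "integrable (mu \<Otimes>\<^sub>M M) (\<lambda>z. (\<Delta> z)\<^sup>2)"
    using D(2) by (simp add: \<Delta>_def case_prod_beta')
  define \<psi> where "\<psi> i = (\<integral>\<^sup>+w. ennreal ((Y (\<tau> i) w - X (k i) w)\<^sup>2) \<partial>M)" for i
  \<comment> \<open>By Cauchy-Schwarz, averaging over a cell costs a factor \<open>1 / m i\<close>,
    which the mass of the cell cancels.\<close>
  have cell: "\<psi> i * emeasure mu (C i) \<le> (\<integral>\<^sup>+z. indicator (C i) (fst z) * ennreal ((\<Delta> z)\<^sup>2) \<partial>(mu \<Otimes>\<^sub>M M))"
    if "i \<in> J" for i
  proof (cases "m i = 0")
    case True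
    then show ?thesis by (simp add: m_def mu.emeasure_eq_measure)
  next
    case False
    then have "m i > 0" by (simp add: m_def zero_less_measure_iff)
    have \<tau>i: "\<tau> i \<in> space mu" using \<open>i \<in> J\<close> \<tau> by (auto simp: J_def)
    \<comment> \<open>Cutting \<open>\<Delta>\<close> off outside the cell keeps only the share of
      this cell, so that summing over the cells gives the integral of the square of
      \<open>\<Delta>\<close> just once.\<close>
    define D' where "D' s w = indicator (C i) s * \<Delta> (s, w)" for s w
    have D'm: "(\<lambda>(s, w). D' s w) \<in> borel_measurable (mu \<Otimes>\<^sub>M M)"
      unfolding D'_def case_prod_beta' by simp
    have D'i: "integrable (mu \<Otimes>\<^sub>M M) (\<lambda>(s, w). (D' s w)\<^sup>2)"
    proof (rule Bochner_Integration.integrable_bound[OF \<Delta>int])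
      show "(\<lambda>(s, w). (D' s w)\<^sup>2) \<in> borel_measurable (mu \<Otimes>\<^sub>M M)" using D'm by (simp add: case_prod_beta')
      show "AE z in mu \<Otimes>\<^sub>M M. norm (case z of (s, w) \<Rightarrow> (D' s w)\<^sup>2) \<le> norm ((\<Delta> z)\<^sup>2)"
        by (intro AE_I2) (auto simp: D'_def case_prod_beta' split: split_indicator)
    qed
    define K where "K w = (\<integral>s. D' s w * k i s \<partial>mu)" for w
    have KL2: "K \<in> L2 M"
      unfolding K_def[abs_def] by (rule kernel_integral_L2[OF finite_mu finite_measure_axioms D'm D'i k])
    note [measurable] = L2_measurable[OF KL2] L2_measurable[OF X_L2[OF k]] L2_measurable[OF Y_L2[OF \<tau>i]]
    have kint: "integrable mu (k i)" by (rule mu.L2_integrable_id[OF k])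
    have k1: "(\<integral>s. k i s \<partial>mu) = 1"
      using \<open>m i > 0\<close> by (simp add: k_def m_def)
    have "AE w in M. X (k i) w - Y (\<tau> i) w = K w"
      using AE_section_L2[OF finite_mu finite_measure_axioms Y_measurable integrable_Y2]
    proof (rule AE_mp, intro AE_I2 impI)
      fix w assume w: "(\<lambda>s. Y s w) \<in> L2 mu"
      have "K w = (\<integral>s. Y s w * k i s - Y (\<tau> i) w * k i s \<partial>mu)"
        unfolding K_def by (intro Bochner_Integration.integral_cong refl)
          (auto simp: D'_def \<Delta>_def k_def C_def left_diff_distrib diff_divide_distrib split: split_indicator)
      also have "\<dots> = X (k i) w - Y (\<tau> i) w * (\<integral>s. k i s \<partial>mu)"
        using L2_mult_integrable[OF w k] kint by (simp add: gauss_int_fun_def)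
      finally show "X (k i) w - Y (\<tau> i) w = K w" by (simp add: k1)
    qed
    then have "AE w in M. ennreal ((Y (\<tau> i) w - X (k i) w)\<^sup>2) = ennreal ((K w)\<^sup>2)"
      by eventually_elim (metis power2_commute)
    then have "\<psi> i = (\<integral>\<^sup>+w. ennreal ((K w)\<^sup>2) \<partial>M)"
      unfolding \<psi>_def by (rule nn_integral_cong_AE)
    also have "\<dots> = ennreal (\<integral>w. (K w)\<^sup>2 \<partial>M)"
      using L2_integrable_real[OF KL2] by (intro nn_integral_eq_integral) auto
    also have "\<dots> \<le> ennreal ((1 / m i) * (\<integral>z. (D' (fst z) (snd z))\<^sup>2 \<partial>(mu \<Otimes>\<^sub>M M)))"
    proof (rule ennreal_leI)
      have "(k i s)\<^sup>2 = k i s / m i" for s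
        by (auto simp: k_def power2_eq_square split: split_indicator)
      then have "(\<integral>s. (k i s)\<^sup>2 \<partial>mu) = 1 / m i" using k1 by simp
      then show "(\<integral>w. (K w)\<^sup>2 \<partial>M) \<le> (1 / m i) * (\<integral>z. (D' (fst z) (snd z))\<^sup>2 \<partial>(mu \<Otimes>\<^sub>M M))"
        using kernel_integral_square_le[OF finite_mu finite_measure_axioms D'm D'i k[of i]] by (simp add: K_def)
    qed
    finally have "\<psi> i * emeasure mu (C i) \<le> ennreal ((1 / m i) * (\<integral>z. (D' (fst z) (snd z))\<^sup>2 \<partial>(mu \<Otimes>\<^sub>M M))) * ennreal (m i)"
      by (simp add: mu.emeasure_eq_measure m_def mult_right_mono)
    also have "\<dots> = ennreal (\<integral>z. (D' (fst z) (snd z))\<^sup>2 \<partial>(mu \<Otimes>\<^sub>M M))"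
      using \<open>m i > 0\<close> by (simp add: ennreal_mult[symmetric])
    also have "\<dots> = (\<integral>\<^sup>+z. ennreal ((D' (fst z) (snd z))\<^sup>2) \<partial>(mu \<Otimes>\<^sub>M M))"
      using D'i by (intro nn_integral_eq_integral[symmetric]) (auto simp: case_prod_beta')
    also have "\<dots> = (\<integral>\<^sup>+z. indicator (C i) (fst z) * ennreal ((\<Delta> z)\<^sup>2) \<partial>(mu \<Otimes>\<^sub>M M))"
      by (intro nn_integral_cong) (auto simp: D'_def split: split_indicator)
    finally show ?thesis .
  qed
  define A B where "A z = Y (\<tau> (q (fst z))) (snd z)" and "B z = X (k (q (fst z))) (snd z)" for z
  have A [measurable]: "A \<in> borel_measurable (mu \<Otimes>\<^sub>M M)"
  proof -
    have "A = (\<lambda>z. case_prod Y z - \<Delta> z)" by (auto simp: A_def B_def \<Delta>_def)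
    then show ?thesis by simp
  qed
  have B [measurable]: "B \<in> borel_measurable (mu \<Otimes>\<^sub>M M)"
    unfolding B_def[abs_def]
    by (rule cell_fun_measurable[OF q, of "\<lambda>i. X (k i)"]) (rule L2_measurable[OF X_L2[OF k]])
  have sum_ind: "(\<Sum>i\<in>J. indicator (C i) s * c i) = (c (q s) :: ennreal)" if "s \<in> space mu" for s c
  proof -
    have "(\<Sum>i\<in>J. indicator (C i) s * c i) = (\<Sum>i\<in>J. if i = q s then c i else 0)"
      using that by (intro sum.cong) (auto simp: C_def split: split_indicator)
    then show ?thesis using that J by (simp add: J_def sum.delta)
  qed
  have "(\<integral>\<^sup>+z. ennreal ((A z - B z)\<^sup>2) \<partial>(mu \<Otimes>\<^sub>M M)) = (\<integral>\<^sup>+s. (\<integral>\<^sup>+w. ennreal ((A (s, w) - B (s, w))\<^sup>2) \<partial>M) \<partial>mu)"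
    by (rule nn_integral_fst[symmetric]) measurable
  also have "\<dots> = (\<integral>\<^sup>+s. \<psi> (q s) \<partial>mu)"
    by (simp add: \<psi>_def A_def B_def)
  also have "\<dots> = (\<integral>\<^sup>+s. (\<Sum>i\<in>J. indicator (C i) s * \<psi> i) \<partial>mu)"
    by (intro nn_integral_cong) (simp add: sum_ind)
  also have "\<dots> = (\<Sum>i\<in>J. \<psi> i * emeasure mu (C i))"
    by (subst nn_integral_sum) (auto simp: nn_integral_cmult_indicator mult.commute[of "indicator _ _"])
  also have "\<dots> \<le> (\<Sum>i\<in>J. \<integral>\<^sup>+z. indicator (C i) (fst z) * ennreal ((\<Delta> z)\<^sup>2) \<partial>(mu \<Otimes>\<^sub>M M))"
    by (rule sum_mono[OF cell])
  also have "\<dots> = (\<integral>\<^sup>+z. (\<Sum>i\<in>J. indicator (C i) (fst z) * ennreal ((\<Delta> z)\<^sup>2)) \<partial>(mu \<Otimes>\<^sub>M M))"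
    by (subst nn_integral_sum) auto
  also have "\<dots> = (\<integral>\<^sup>+z. ennreal ((\<Delta> z)\<^sup>2) \<partial>(mu \<Otimes>\<^sub>M M))"
    by (intro nn_integral_cong) (auto simp: space_pair_measure sum_ind)
  finally have AB: "(\<integral>\<^sup>+z. ennreal ((A z - B z)\<^sup>2) \<partial>(mu \<Otimes>\<^sub>M M)) \<le> (\<integral>\<^sup>+z. ennreal ((\<Delta> z)\<^sup>2) \<partial>(mu \<Otimes>\<^sub>M M))" .
  have \<Delta>e: "(\<integral>\<^sup>+z. ennreal ((\<Delta> z)\<^sup>2) \<partial>(mu \<Otimes>\<^sub>M M)) \<le> ennreal (e / 4)"
    using nn_integral_eq_integral[OF \<Delta>int] D(3) by (simp add: \<Delta>_def ennreal_leI)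
  have "(\<integral>\<^sup>+z. ennreal ((\<Delta> z + (A z - B z))\<^sup>2) \<partial>(mu \<Otimes>\<^sub>M M))
      \<le> 2 * (\<integral>\<^sup>+z. ennreal ((\<Delta> z)\<^sup>2) \<partial>(mu \<Otimes>\<^sub>M M)) + 2 * (\<integral>\<^sup>+z. ennreal ((A z - B z)\<^sup>2) \<partial>(mu \<Otimes>\<^sub>M M))"
    by (rule nn_integral_square_add_le) measurable
  also have "\<dots> \<le> 2 * ennreal (e / 4) + 2 * ennreal (e / 4)"
    by (intro add_mono mult_left_mono \<Delta>e order_trans[OF AB \<Delta>e]) auto
  also have "\<dots> = ennreal e"
  proof -
    have "2 * ennreal (e / 4) = ennreal (e / 2)"
      using \<open>e > 0\<close> ennreal_mult[of 2 "e / 4"] by simp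
    then show ?thesis using \<open>e > 0\<close> by (simp flip: ennreal_plus)
  qed
  finally show thesis
    by (intro that[of q k, OF q k]) (simp add: \<Delta>_def A_def B_def)
qed

text \<open>The integrated errors are at most \<open>(1 / 2) ^ n\<close> and so summable. Hence the
  errors at \<open>t\<close> have a finite sum for almost every \<open>t\<close>, and for such
  \<open>t\<close> they tend to 0 without passing to a subsequence. The partition changes with
  \<open>n\<close>, and \<open>g n\<close> is the kernel of the cell containing
  \<open>t\<close>.\<close>

lemma AE_Y_in_chaos:
  "AE t in mu. \<exists>g. (\<forall>n. g n \<in> L2 mu) \<and> L2_tendsto M (\<lambda>n. X (g n)) (Y t)"
proof -
  define good where "good n q k \<longleftrightarrow> q \<in> measurable mu (count_space (UNIV :: nat set)) \<and> (\<forall>i. k i \<in> L2 mu) \<and>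
    (\<integral>\<^sup>+z. ennreal ((Y (fst z) (snd z) - X (k (q (fst z))) (snd z))\<^sup>2) \<partial>(mu \<Otimes>\<^sub>M M)) \<le> ennreal ((1 / 2) ^ n)"
    for n q k
  have "\<exists>q k. good n q k" for n
  proof -
    have "(1 / 2 :: real) ^ n > 0" by simp
    then obtain q k where "q \<in> measurable mu (count_space (UNIV :: nat set))" "\<And>i. k i \<in> L2 mu"
      "(\<integral>\<^sup>+z. ennreal ((Y (fst z) (snd z) - X (k (q (fst z))) (snd z))\<^sup>2) \<partial>(mu \<Otimes>\<^sub>M M)) \<le> ennreal ((1 / 2) ^ n)"
      by (rule cell_average) (rule that)
    then have "good n q k" by (simp add: good_def)
    then show ?thesis by blast
  qed
  then obtain q k where "\<And>n. good n (q n) (k n)" by metis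
  then have q: "\<And>n. q n \<in> measurable mu (count_space (UNIV :: nat set))" and k: "\<And>n i. k n i \<in> L2 mu"
    and le: "\<And>n. (\<integral>\<^sup>+z. ennreal ((Y (fst z) (snd z) - X (k n (q n (fst z))) (snd z))\<^sup>2) \<partial>(mu \<Otimes>\<^sub>M M)) \<le> ennreal ((1 / 2) ^ n)"
    unfolding good_def by auto
  define B where "B n z = X (k n (q n (fst z))) (snd z)" for n z
  have [measurable]: "B n \<in> borel_measurable (mu \<Otimes>\<^sub>M M)" for n
    unfolding B_def[abs_def]
    by (rule cell_fun_measurable[OF q, of "\<lambda>i. X (k n i)"]) (rule L2_measurable[OF X_L2[OF k]])
  define \<theta> where "\<theta> n t = (\<integral>\<^sup>+w. ennreal ((case_prod Y (t, w) - B n (t, w))\<^sup>2) \<partial>M)" for n t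
  have [measurable]: "\<theta> n \<in> borel_measurable mu" for n
    unfolding \<theta>_def[abs_def] by measurable
  have "(\<integral>\<^sup>+t. (\<Sum>n. \<theta> n t) \<partial>mu) = (\<Sum>n. \<integral>\<^sup>+t. \<theta> n t \<partial>mu)"
    by (rule nn_integral_suminf) measurable
  also have "\<dots> \<le> (\<Sum>n. ennreal ((1 / 2) ^ n))"
  proof (intro suminf_le summableI)
    fix n
    have "(\<integral>\<^sup>+t. \<theta> n t \<partial>mu) = (\<integral>\<^sup>+z. ennreal ((case_prod Y z - B n z)\<^sup>2) \<partial>(mu \<Otimes>\<^sub>M M))"
      unfolding \<theta>_def by (rule nn_integral_fst) measurable
    then show "(\<integral>\<^sup>+t. \<theta> n t \<partial>mu) \<le> ennreal ((1 / 2) ^ n)"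
      using le[of n] by (simp add: B_def case_prod_beta')
  qed
  also have "\<dots> = ennreal (\<Sum>k. (1 / 2) ^ k)"
    by (rule suminf_ennreal2) (auto intro: summable_geometric)
  finally have "(\<integral>\<^sup>+t. (\<Sum>n. \<theta> n t) \<partial>mu) \<noteq> \<infinity>" by (auto simp: top_unique)
  then have "AE t in mu. (\<Sum>n. \<theta> n t) \<noteq> \<infinity>"
    by (intro nn_integral_noteq_infinite) auto
  then show ?thesis
  proof (rule AE_mp, intro AE_I2 impI)
    fix t assume t: "t \<in> space mu" and fin: "(\<Sum>n. \<theta> n t) \<noteq> \<infinity>"
    define g where "g n = k n (q n t)" for n
    have g: "g n \<in> L2 mu" for n by (simp add: g_def k)
    have \<theta>: "\<theta> n t = ennreal (\<integral>w. (norm (X (g n) w - Y t w))\<^sup>2 \<partial>M)" for n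
      unfolding \<theta>_def B_def g_def using L2_integrable[OF L2_diff[OF X_L2[OF k] Y_L2[OF t]]]
      by (subst nn_integral_eq_integral) (auto simp: power2_commute)
    have "summable (\<lambda>n. \<integral>w. (norm (X (g n) w - Y t w))\<^sup>2 \<partial>M)"
      using fin unfolding \<theta> by (intro summable_suminf_not_top) auto
    then have "L2_tendsto M (\<lambda>n. X (g n)) (Y t)"
      unfolding L2_tendsto_def by (rule summable_LIMSEQ_zero)
    then show "\<exists>g. (\<forall>n. g n \<in> L2 mu) \<and> L2_tendsto M (\<lambda>n. X (g n)) (Y t)"
      using g by blast
  qed
qed

section \<open>Extension of the isometry to all of H\<close>

text \<open>One approximating sequence and completeness give \<open>Z\<close>. By the isometry,
  every other sequence with the same limit in \<open>H\<close> leads to the same variable; this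
  makes the choice in \<open>gauss_int\<close> meaningful.\<close>

lemma I_exists:
  "\<exists>Z. Z \<in> L2 M \<and> (\<forall>g. (\<forall>n. g n \<in> L2 mu) \<and> (\<lambda>n. emb (g n)) \<longlonglongrightarrow> \<eta> \<longrightarrow>
     L2_tendsto M (\<lambda>n. X (g n)) Z)"
proof -
  obtain g where g: "\<And>n. g n \<in> L2 mu" "(\<lambda>n. emb (g n)) \<longlonglongrightarrow> \<eta>" using emb_dense by metis
  have "\<exists>Z\<in>L2 M. L2_tendsto M (\<lambda>n. X (g n)) Z"
  proof (rule L2_complete)
    fix e :: real assume "e > 0"
    then have "sqrt e > 0" by simp
    from metric_CauchyD[OF LIMSEQ_imp_Cauchy[OF g(2)] this]
    obtain N where N: "\<And>m n. m \<ge> N \<Longrightarrow> n \<ge> N \<Longrightarrow> norm (emb (g m) - emb (g n)) < sqrt e"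
      by (auto simp: dist_norm)
    show "\<exists>N. \<forall>m\<ge>N. \<forall>n\<ge>N. (\<integral>w. (X (g m) w - X (g n) w)\<^sup>2 \<partial>M) < e"
    proof (intro exI allI impI)
      fix m n assume "m \<ge> N" "n \<ge> N"
      from power_strict_mono[OF N[OF this], of 2] \<open>e > 0\<close>
      show "(\<integral>w. (X (g m) w - X (g n) w)\<^sup>2 \<partial>M) < e" by (simp add: X_dist g)
    qed
  qed (intro X_L2 g)
  then obtain Z where Z: "Z \<in> L2 M" "L2_tendsto M (\<lambda>n. X (g n)) Z" by blast
  have "L2_tendsto M (\<lambda>n. X (f n)) Z" if f: "\<And>n. f n \<in> L2 mu" "(\<lambda>n. emb (f n)) \<longlonglongrightarrow> \<eta>" for f
  proof (rule L2_tendsto_bound)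
    fix n
    show "(\<integral>w. (norm (X (f n) w - Z w))\<^sup>2 \<partial>M)
        \<le> 2 * (norm (emb (f n) - emb (g n)))\<^sup>2 + 2 * (\<integral>w. (norm (X (g n) w - Z w))\<^sup>2 \<partial>M)"
      using L2_dist_add_le[OF L2_diff[OF X_L2[OF f(1)] X_L2[OF g(1)]] L2_diff[OF X_L2[OF g(1)] Z(1)], of n n n]
      by (simp add: X_dist f g)
  next
    have "(\<lambda>n. norm (emb (f n) - emb (g n))) \<longlonglongrightarrow> 0"
      using tendsto_norm[OF tendsto_diff[OF f(2) g(2)]] by simp
    from tendsto_add[OF tendsto_mult_left[OF tendsto_power[OF this, of 2], of 2]
        tendsto_mult_left[OF Z(2)[unfolded L2_tendsto_def], of 2]]
    show "(\<lambda>n. 2 * (norm (emb (f n) - emb (g n)))\<^sup>2 + 2 * (\<integral>w. (norm (X (g n) w - Z w))\<^sup>2 \<partial>M)) \<longlonglongrightarrow> 0"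
      by (simp only: zero_power2 mult_zero_right add_0_right)
  qed
  then show ?thesis using Z(1) by blast
qed

lemma I_L2: "I \<eta> \<in> L2 M"
  and I_limit: "(\<And>n. g n \<in> L2 mu) \<Longrightarrow> (\<lambda>n. emb (g n)) \<longlonglongrightarrow> \<eta> \<Longrightarrow> L2_tendsto M (\<lambda>n. X (g n)) (I \<eta>)"
  using someI_ex[OF I_exists[of \<eta>], folded gauss_int_def] by blast+

lemma I_measurable [measurable]: "I \<eta> \<in> borel_measurable M"
  by (rule L2_measurable[OF I_L2])

text \<open>\<open>I\<close> picks one representative per vector, so linearity is claimed only
  almost surely, with a null set that depends on the vectors.\<close>

lemma I_linear: "AE w in M. I (a *\<^sub>R \<eta> + b *\<^sub>R \<theta>) w = a * I \<eta> w + b * I \<theta> w"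
proof -
  obtain f where f: "\<And>n. f n \<in> L2 mu" "(\<lambda>n. emb (f n)) \<longlonglongrightarrow> \<eta>" using emb_dense by metis
  obtain g where g: "\<And>n. g n \<in> L2 mu" "(\<lambda>n. emb (g n)) \<longlonglongrightarrow> \<theta>" using emb_dense by metis
  define h where "h n = (\<lambda>t. a * f n t + b * g n t)" for n
  have h: "h n \<in> L2 mu" for n unfolding h_def by (intro L2_add L2_mult f g)
  have "(\<lambda>n. emb (h n)) \<longlonglongrightarrow> a *\<^sub>R \<eta> + b *\<^sub>R \<theta>"
    unfolding h_def emb_linear[OF f(1) g(1)] by (intro tendsto_intros f g)
  then have 1: "L2_tendsto M (\<lambda>n. X (h n)) (I (a *\<^sub>R \<eta> + b *\<^sub>R \<theta>))"
    by (intro I_limit h)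
  have 2: "L2_tendsto M (\<lambda>n w. a *\<^sub>R X (f n) w + b *\<^sub>R X (g n) w) (\<lambda>w. a *\<^sub>R I \<eta> w + b *\<^sub>R I \<theta> w)"
    by (intro L2_tendsto_add L2_tendsto_scaleR I_limit L2_scaleR X_L2 I_L2 f g)
  note [measurable] = L2_measurable[OF X_L2[OF f(1)]] L2_measurable[OF X_L2[OF g(1)]] L2_measurable[OF X_L2[OF h]]
  have "L2_tendsto M (\<lambda>n. X (h n)) (\<lambda>w. a *\<^sub>R I \<eta> w + b *\<^sub>R I \<theta> w)"
  proof (rule L2_tendsto_cong[OF _ _ _ _ _ _ 2])
    show "AE w in M. a *\<^sub>R X (f n) w + b *\<^sub>R X (g n) w = X (h n) w" for n
      using X_linear[OF f(1)[of n] g(1)[of n], of a b] by (auto simp: h_def)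
  qed measurable
  from L2_tendsto_unique[OF 1 this X_L2[OF h] I_L2] show ?thesis
    using L2_add[OF L2_scaleR[OF I_L2] L2_scaleR[OF I_L2]] by simp
qed

lemma I_zero: "AE w in M. I 0 w = 0"
  using I_linear[of 0 0 0 0] by simp

lemma I_uminus: "AE w in M. I (- \<eta>) w = - I \<eta> w"
  using I_linear[of "-1" \<eta> 0 0] by simp

lemma I_sum: "finite J \<Longrightarrow> AE w in M. I (\<Sum>i\<in>J. c i *\<^sub>R h i) w = (\<Sum>i\<in>J. c i * I (h i) w)"
proof (induction J rule: finite_induct)
  case empty
  then show ?case using I_zero by simp
next
  case (insert j J)
  then show ?case using I_linear[of "c j" "h j" 1 "\<Sum>i\<in>J. c i *\<^sub>R h i"] by auto
qed

lemma I_norm: "(\<integral>w. (I \<eta> w)\<^sup>2 \<partial>M) = (norm \<eta>)\<^sup>2"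
proof -
  obtain g where g: "\<And>n. g n \<in> L2 mu" "(\<lambda>n. emb (g n)) \<longlonglongrightarrow> \<eta>" using emb_dense by metis
  have "(\<lambda>n. \<integral>w. (X (g n) w)\<^sup>2 \<partial>M) \<longlonglongrightarrow> (\<integral>w. (I \<eta> w)\<^sup>2 \<partial>M)"
    by (intro L2_tendsto_integral_square I_limit g X_L2 I_L2)
  moreover have "(\<lambda>n. \<integral>w. (X (g n) w)\<^sup>2 \<partial>M) \<longlonglongrightarrow> (norm \<eta>)\<^sup>2"
    unfolding X_norm[OF g(1)] by (intro tendsto_intros g)
  ultimately show ?thesis by (rule LIMSEQ_unique)
qed

lemma I_char: "(\<integral>w. cis (I \<eta> w) \<partial>M) = complex_of_real (exp (- (norm \<eta>)\<^sup>2 / 2))"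
proof -
  obtain g where g: "\<And>n. g n \<in> L2 mu" "(\<lambda>n. emb (g n)) \<longlonglongrightarrow> \<eta>" using emb_dense by metis
  have "gaussian_char M (I \<eta>)"
    by (rule gaussian_char_limit[OF I_limit[OF g] gaussian_char_X[OF g(1)] I_L2])
  then have "(\<integral>w. cis (1 * I \<eta> w) \<partial>M) = complex_of_real (exp (- (1\<^sup>2 * (\<integral>w. (I \<eta> w)\<^sup>2 \<partial>M)) / 2))"
    unfolding gaussian_char_def by blast
  then show ?thesis by (simp add: I_norm)
qed

text \<open>By the isometry, convergence of \<open>X (g n)\<close> to \<open>Y t\<close> in mean
  square makes \<open>emb (g n)\<close> a Cauchy sequence; its limit in the complete space
  \<open>H\<close> is the vector sought.\<close>

lemma AE_Y_eq_I: "AE t in mu. \<exists>\<eta>. AE w in M. I \<eta> w = Y t w"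
  using AE_Y_in_chaos
proof (rule AE_mp, intro AE_I2 impI)
  fix t assume t: "t \<in> space mu" and "\<exists>g. (\<forall>n. g n \<in> L2 mu) \<and> L2_tendsto M (\<lambda>n. X (g n)) (Y t)"
  then obtain g where g: "\<And>n. g n \<in> L2 mu" and lim: "L2_tendsto M (\<lambda>n. X (g n)) (Y t)" by blast
  have "Cauchy (\<lambda>n. emb (g n))"
  proof (rule metric_CauchyI)
    fix e :: real assume "e > 0"
    \<comment> \<open>Twice the two errors, each below \<open>e^2 / 4\<close>, stay below
      \<open>e^2\<close>.\<close>
    then have "e\<^sup>2 / 4 > 0" by simp
    from LIMSEQ_D[OF lim[unfolded L2_tendsto_def] this] obtain N where
      N: "\<And>n. n \<ge> N \<Longrightarrow> (\<integral>w. (norm (X (g n) w - Y t w))\<^sup>2 \<partial>M) < e\<^sup>2 / 4" by auto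
    show "\<exists>N. \<forall>m\<ge>N. \<forall>n\<ge>N. dist (emb (g m)) (emb (g n)) < e"
    proof (intro exI allI impI)
      fix m n assume mn: "m \<ge> N" "n \<ge> N"
      have "(norm (emb (g m) - emb (g n)))\<^sup>2 = (\<integral>w. (norm (X (g m) w - Y t w + (Y t w - X (g n) w)))\<^sup>2 \<partial>M)"
        by (simp add: X_dist[OF g g, symmetric])
      also have "\<dots> \<le> 2 * (\<integral>w. (norm (X (g m) w - Y t w))\<^sup>2 \<partial>M) + 2 * (\<integral>w. (norm (Y t w - X (g n) w))\<^sup>2 \<partial>M)"
        by (intro L2_dist_add_le L2_diff X_L2 g Y_L2 t)
      also have "\<dots> < e\<^sup>2"
        using N[OF mn(1)] N[OF mn(2)] by (simp add: norm_minus_commute power2_commute)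
      finally show "dist (emb (g m)) (emb (g n)) < e"
        using \<open>e > 0\<close> by (simp add: dist_norm power2_less_imp_less)
    qed
  qed
  then obtain \<eta> where "(\<lambda>n. emb (g n)) \<longlonglongrightarrow> \<eta>"
    using Cauchy_convergent by (auto simp: convergent_def)
  from L2_tendsto_unique[OF I_limit[OF g this] lim X_L2[OF g] I_L2 Y_L2[OF t]]
  show "\<exists>\<eta>. AE w in M. I \<eta> w = Y t w" by blast
qed

end

section \<open>Closability of the Malliavin derivative\<close>

lemma schwartz_cong: "schwartz n f \<Longrightarrow> (\<And>i. i < n \<Longrightarrow> x i = y i) \<Longrightarrow> f x = f y"
  unfolding schwartz_def by blast

lemma schwartz_continuous: "schwartz n f \<Longrightarrow> continuous_on UNIV f"
proof -
  assume "schwartz n f"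
  then have "continuous_on UNIV (foldr partial [] f)"
    unfolding schwartz_def by (metis empty_subsetI list.set(1))
  then show ?thesis by simp
qed

lemma schwartz_partial:
  assumes f: "schwartz n f" and i: "i < n"
  shows "schwartz n (partial i f)"
  unfolding schwartz_def
proof (intro conjI allI impI)
  fix x y :: "nat \<Rightarrow> real" assume xy: "\<forall>j<n. x j = y j"
  then have "f (x(i := s)) = f (y(i := s))" for s
    by (intro schwartz_cong[OF f]) simp
  then show "partial i f x = partial i f y" using xy i by (simp add: partial_def)
next
  fix js assume js: "set js \<subseteq> {..<n}"
  \<comment> \<open>An iterated derivative of \<open>partial i f\<close> is one of \<open>f\<close>
    with \<open>i\<close> appended, because \<open>foldr\<close> applies the last index
    first.\<close>
  have app: "foldr partial js (partial i f) = foldr partial (js @ [i]) f" by simp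
  have set: "set (js @ [i]) \<subseteq> {..<n}" using js i by simp
  note F = f[unfolded schwartz_def, THEN conjunct2, rule_format, OF set, folded app]
  show "continuous_on UNIV (foldr partial js (partial i f))" using F by blast
  show "(\<lambda>s. foldr partial js (partial i f) (x(j := s))) differentiable (at (x j))" if "j < n" for j x
    using F that by blast
  show "\<exists>C. \<forall>x. (\<Sum>i<n. (x i)\<^sup>2) ^ k * \<bar>foldr partial js (partial i f) x\<bar> \<le> C" for k
    using F by blast
qed

lemma schwartz_bounded:
  assumes "schwartz n f"
  obtains C where "\<And>x. \<bar>f x\<bar> \<le> C"
proof -
  have "set [] \<subseteq> {..<n}" by simp
  note F = assms[unfolded schwartz_def, THEN conjunct2, rule_format, OF this]
  have "\<exists>C. \<forall>x. (\<Sum>i<n. (x i)\<^sup>2) ^ 0 * \<bar>foldr partial [] f x\<bar> \<le> C" using F by blast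
  then show thesis using that by auto
qed

lemma schwartz_has_partial:
  assumes f: "schwartz n f" and i: "i < n"
  shows "((\<lambda>s. f (x(i := s))) has_real_derivative partial i f (x(i := s))) (at s)"
proof -
  have "set [] \<subseteq> {..<n}" by simp
  note F = f[unfolded schwartz_def, THEN conjunct2, rule_format, OF this]
  have "(\<lambda>t. foldr partial [] f ((x(i := s))(i := t))) differentiable (at ((x(i := s)) i))"
    using F i by blast
  then have "(\<lambda>t. f (x(i := t))) differentiable (at s)" by simp
  then show ?thesis
    by (simp add: partial_def DERIV_deriv_iff_real_differentiable)
qed

text \<open>One coordinate is switched on at a time; the step adds a partial derivative that is jointly
  continuous, so the two-variable chain rule applies along the diagonal.\<close>

lemma schwartz_chain_aux:
  assumes f: "schwartz n f" and "k \<le> n"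
  shows "((\<lambda>s. f (\<lambda>i. if i < k then x i + s * a i else x i)) has_real_derivative
    (\<Sum>i<k. a i * partial i f (\<lambda>i. if i < k then x i + s * a i else x i))) (at s)"
  using \<open>k \<le> n\<close>
proof (induction k arbitrary: x s)
  case 0
  then show ?case by simp
next
  case (Suc k)
  then have "k < n" by simp
  \<comment> \<open>The definition of \<open>schwartz\<close> provides derivatives in each
    coordinate separately. Parameter \<open>s\<close> moves the coordinates below \<open>k\<close>
    and \<open>r\<close> the coordinate \<open>k\<close>; the line of the statement is the diagonal
    \<open>s = r\<close>.\<close>
  define pt where "pt s r = (\<lambda>i. if i < k then x i + s * a i else if i = k then x k + r * a k else x i)" for s r
  have pt_eq: "pt s r = (\<lambda>i. if i < k then (x(k := x k + r * a k)) i + s * a i else (x(k := x k + r * a k)) i)" for s r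
    by (auto simp: pt_def)
  have pt_diag: "pt s s = (\<lambda>i. if i < Suc k then x i + s * a i else x i)" for s
    by (auto simp: pt_def fun_eq_iff less_Suc_eq)
  have pt_upd: "(pt s r)(k := x k + r' * a k) = pt s r'" for s r r'
    by (auto simp: pt_def)
  have d1: "((\<lambda>s. f (pt s r)) has_real_derivative (\<Sum>i<k. a i * partial i f (pt s r))) (at s)" for s r
    unfolding pt_eq using Suc by (intro Suc.IH) simp
  have d2: "((\<lambda>r. f (pt s r)) has_real_derivative a k * partial k f (pt s r)) (at r)" for s r
  proof -
    have "((\<lambda>r'. f ((pt s r)(k := x k + r' * a k))) has_real_derivative
        partial k f ((pt s r)(k := x k + r * a k)) * a k) (at r)"
      by (rule DERIV_chain2[OF schwartz_has_partial[OF f \<open>k < n\<close>]]) (auto intro!: derivative_eq_intros)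
    then show ?thesis unfolding pt_upd by (simp add: mult.commute)
  qed
  have cont_pt: "continuous_on UNIV (\<lambda>z. pt (fst z) (snd z))"
  proof (rule continuous_on_coordinatewise_then_product)
    fix i show "continuous_on UNIV (\<lambda>z. pt (fst z) (snd z) i)"
      unfolding pt_def by (cases "i < k"; cases "i = k") (auto intro!: continuous_intros)
  qed
  have "continuous_on UNIV (\<lambda>z. partial k f (pt (fst z) (snd z)))"
    by (rule continuous_on_compose2[OF schwartz_continuous[OF schwartz_partial[OF f \<open>k < n\<close>]] cont_pt]) simp
  then have cont: "continuous_on UNIV (\<lambda>z. blinfun_mult_right (a k * partial k f (pt (fst z) (snd z))))"
    by (intro bounded_linear.continuous_on[OF bounded_linear_blinfun_mult_right] continuous_intros)
  have "((\<lambda>(s, r). f (pt s r)) has_derivative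
      (\<lambda>(ts, tr). (\<Sum>i<k. a i * partial i f (pt s s)) * ts + blinfun_mult_right (a k * partial k f (pt s s)) tr))
      (at (s, s) within UNIV \<times> UNIV)"
  proof (rule has_derivative_partialsI[where fy = "\<lambda>s r. blinfun_mult_right (a k * partial k f (pt s r))"])
    show "((\<lambda>s'. f (pt s' s)) has_derivative (*) (\<Sum>i<k. a i * partial i f (pt s s))) (at s within UNIV)"
      using d1[of s s] by (simp add: has_field_derivative_def)
    show "((\<lambda>r. f (pt s r)) has_derivative blinfun_apply (blinfun_mult_right (a k * partial k f (pt s r)))) (at r within UNIV)" for s r
      using d2[of s r] by (simp add: has_field_derivative_def)
    show "continuous (at (s, s) within UNIV \<times> UNIV) (\<lambda>(s, r). blinfun_mult_right (a k * partial k f (pt s r)))"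
      using cont by (simp add: continuous_on_eq_continuous_at case_prod_beta')
  qed auto
  then have "((\<lambda>(s, r). f (pt s r)) has_derivative
      (\<lambda>(ts, tr). (\<Sum>i<k. a i * partial i f (pt s s)) * ts + (a k * partial k f (pt s s)) * tr)) (at (s, s))"
    by simp
  from has_derivative_compose[OF has_derivative_Pair[OF has_derivative_ident has_derivative_ident], OF this]
  have "((\<lambda>s. f (pt s s)) has_derivative (\<lambda>t. (\<Sum>i<k. a i * partial i f (pt s s)) * t + (a k * partial k f (pt s s)) * t)) (at s)"
    by simp
  then have "((\<lambda>s. f (pt s s)) has_real_derivative (\<Sum>i<Suc k. a i * partial i f (pt s s))) (at s)"
    unfolding has_field_derivative_def by (simp add: distrib_right[abs_def] fun_eq_iff distrib_right)
  then show ?case unfolding pt_diag .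
qed

lemma schwartz_chain:
  assumes f: "schwartz n f"
  shows "((\<lambda>s. f (\<lambda>i. x i + s * a i)) has_real_derivative
    (\<Sum>i<n. a i * partial i f (\<lambda>i. x i + s * a i))) (at s)"
proof -
  have "g (\<lambda>i. if i < n then x i + s * a i else x i) = g (\<lambda>i. x i + s * a i)" if "schwartz n g" for g s
    by (rule schwartz_cong[OF that]) simp
  from this[OF f] this[OF schwartz_partial[OF f]] show ?thesis
    using schwartz_chain_aux[OF f order_refl, of x a s] by simp
qed

context gaussian_completion
begin

text \<open>The vectors \<open>h i\<close> and \<open>k i\<close> are joined to one family
  \<open>v\<close> of length \<open>n + m\<close>. Subtracting \<open>a i\<close> times
  \<open>I \<eta>\<close> leaves residuals that are, almost surely, integrals of vectors orthogonal
  to \<open>\<eta>\<close>; for jointly Gaussian variables orthogonality is independence. The second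
  functional is the test function against which the derivative of the first is later
  identified.\<close>

lemma cylindrical_integration_by_parts:
  assumes \<eta>: "norm \<eta> = 1" and f: "schwartz n f" and g: "schwartz m g"
  shows "(\<integral>w. I \<eta> w * (f (\<lambda>i. I (h i) w) * g (\<lambda>i. I (k i) w)) \<partial>M)
    = (\<integral>w. (\<Sum>i<n. inner (h i) \<eta> * partial i f (\<lambda>i. I (h i) w)) * g (\<lambda>i. I (k i) w)
        + f (\<lambda>i. I (h i) w) * (\<Sum>i<m. inner (k i) \<eta> * partial i g (\<lambda>i. I (k i) w)) \<partial>M)"
proof -
  define v where "v i = (if i < n then h i else k (i - n))" for i
  define a where "a i = inner (v i) \<eta>" for i
  define \<phi> where "\<phi> x = f x * g (\<lambda>j. x (n + j))" for x :: "nat \<Rightarrow> real"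
  define d\<phi> where "d\<phi> x = (\<Sum>i<n. a i * partial i f x) * g (\<lambda>j. x (n + j))
      + f x * (\<Sum>i<m. a (n + i) * partial i g (\<lambda>j. x (n + j)))" for x :: "nat \<Rightarrow> real"
  note fp = schwartz_partial[OF f] and gp = schwartz_partial[OF g]
  have shift: "continuous_on UNIV (\<lambda>x :: nat \<Rightarrow> real. \<lambda>j. x (n + j))"
    by (intro continuous_on_coordinatewise_then_product continuous_on_product_coordinates)
  have c: "continuous_on UNIV (\<lambda>x. q (\<lambda>j. x (n + j)))" if "schwartz m q" for q
    by (rule continuous_on_compose2[OF schwartz_continuous[OF that] shift]) simp
  obtain Cf where Cf: "\<And>x. \<bar>f x\<bar> \<le> Cf" by (rule schwartz_bounded[OF f]) (rule that)
  obtain Cg where Cg: "\<And>x. \<bar>g x\<bar> \<le> Cg" by (rule schwartz_bounded[OF g]) (rule that)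
  have "\<exists>C. \<forall>x. \<bar>partial i f x\<bar> \<le> C" if "i < n" for i
    using schwartz_bounded[OF fp[OF that]] by metis
  then obtain Df where Df: "\<And>i x. i < n \<Longrightarrow> \<bar>partial i f x\<bar> \<le> Df i" by metis
  have "\<exists>C. \<forall>x. \<bar>partial i g x\<bar> \<le> C" if "i < m" for i
    using schwartz_bounded[OF gp[OF that]] by metis
  then obtain Dg where Dg: "\<And>i x. i < m \<Longrightarrow> \<bar>partial i g x\<bar> \<le> Dg i" by metis
  define S1 where "S1 = (\<Sum>i<n. \<bar>a i\<bar> * Df i)"
  define S2 where "S2 = (\<Sum>i<m. \<bar>a (n + i)\<bar> * Dg i)"
  have Cf0: "Cf \<ge> 0" and Cg0: "Cg \<ge> 0" using Cf Cg abs_ge_zero order_trans by blast+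
  have s1: "\<bar>\<Sum>i<n. a i * partial i f x\<bar> \<le> S1" for x
    unfolding S1_def by (rule order_trans[OF sum_abs])
      (auto simp: abs_mult intro!: sum_mono mult_left_mono Df)
  have s2: "\<bar>\<Sum>i<m. a (n + i) * partial i g x\<bar> \<le> S2" for x
    unfolding S2_def by (rule order_trans[OF sum_abs])
      (auto simp: abs_mult intro!: sum_mono mult_left_mono Dg)
  have S10: "S1 \<ge> 0" and S20: "S2 \<ge> 0" using s1 s2 abs_ge_zero order_trans by blast+
  \<comment> \<open>One constant has to bound both \<open>\<phi>\<close> and
    \<open>d\<phi>\<close>.\<close>
  define C where "C = Cf * Cg + S1 * Cg + Cf * S2"
  have cf: "f (\<lambda>i. I (v i) w) = f (\<lambda>i. I (h i) w)" for w
    by (rule schwartz_cong[OF f]) (simp add: v_def)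
  have cfp: "partial j f (\<lambda>i. I (v i) w) = partial j f (\<lambda>i. I (h i) w)" if "j < n" for j w
    by (rule schwartz_cong[OF fp[OF that]]) (simp add: v_def)
  have vk: "(\<lambda>j. I (v (n + j)) w) = (\<lambda>j. I (k j) w)" for w by (simp add: v_def)
  have "(\<integral>w. I \<eta> w * \<phi> (\<lambda>i. I (v i) w) \<partial>M) = (\<integral>w. d\<phi> (\<lambda>i. I (v i) w) \<partial>M)"
  proof (rule gaussian_integration_by_parts[where L = "n + m" and a = a and C = C])
    fix u :: real and c :: "nat \<Rightarrow> real"
    define \<theta> where "\<theta> = (\<Sum>i<n + m. c i *\<^sub>R (v i - a i *\<^sub>R \<eta>))"
    have 1: "AE w in M. I \<theta> w = (\<Sum>i<n + m. c i * (I (v i) w - a i * I \<eta> w))"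
    proof -
      have "AE w in M. \<forall>i. I (1 *\<^sub>R v i + (- a i) *\<^sub>R \<eta>) w = 1 * I (v i) w + (- a i) * I \<eta> w"
        unfolding AE_all_countable using I_linear by blast
      moreover have "AE w in M. I \<theta> w = (\<Sum>i<n + m. c i * I (1 *\<^sub>R v i + (- a i) *\<^sub>R \<eta>) w)"
        unfolding \<theta>_def using I_sum[of "{..<n + m}" c "\<lambda>i. v i - a i *\<^sub>R \<eta>"] by simp
      ultimately show ?thesis by eventually_elim simp
    qed
    have 2: "AE w in M. I (u *\<^sub>R \<eta> + 1 *\<^sub>R \<theta>) w = u * I \<eta> w + 1 * I \<theta> w" by (rule I_linear)
    \<comment> \<open>Orthogonality to the unit vector \<open>\<eta>\<close> splits the squared norm
      by Pythagoras, and thereby the characteristic function into a product.\<close>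
    have "inner \<theta> \<eta> = 0"
      using \<eta> by (simp add: \<theta>_def inner_sum_left inner_diff_left a_def norm_eq_1)
    then have norm: "(norm (u *\<^sub>R \<eta> + 1 *\<^sub>R \<theta>))\<^sup>2 = u\<^sup>2 + (norm \<theta>)\<^sup>2"
      unfolding power2_norm_eq_inner using \<eta>
      by (simp add: inner_add_left inner_add_right inner_commute norm_eq_1 power2_eq_square)
    have "(\<integral>w. cis (u * I \<eta> w + (\<Sum>i<n + m. c i * (I (v i) w - a i * I \<eta> w))) \<partial>M)
        = (\<integral>w. cis (I (u *\<^sub>R \<eta> + 1 *\<^sub>R \<theta>) w) \<partial>M)"
    proof (rule integral_cong_AE)
      show "AE w in M. cis (u * I \<eta> w + (\<Sum>i<n + m. c i * (I (v i) w - a i * I \<eta> w))) = cis (I (u *\<^sub>R \<eta> + 1 *\<^sub>R \<theta>) w)"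
        using 1 2 by eventually_elim simp
    qed measurable
    also have "\<dots> = complex_of_real (exp (- u\<^sup>2 / 2)) * complex_of_real (exp (- (norm \<theta>)\<^sup>2 / 2))"
      unfolding I_char norm by (simp add: exp_add[symmetric] add_divide_distrib flip: of_real_mult)
    also have "complex_of_real (exp (- (norm \<theta>)\<^sup>2 / 2)) = (\<integral>w. cis (I \<theta> w) \<partial>M)"
      by (rule I_char[symmetric])
    also have "\<dots> = (\<integral>w. cis (\<Sum>i<n + m. c i * (I (v i) w - a i * I \<eta> w)) \<partial>M)"
    proof (rule integral_cong_AE)
      show "AE w in M. cis (I \<theta> w) = cis (\<Sum>i<n + m. c i * (I (v i) w - a i * I \<eta> w))"
        using 1 by eventually_elim simp
    qed measurable
    finally show "(\<integral>w. cis (u * I \<eta> w + (\<Sum>i<n + m. c i * (I (v i) w - a i * I \<eta> w))) \<partial>M)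
      = complex_of_real (exp (- u\<^sup>2 / 2)) * (\<integral>w. cis (\<Sum>i<n + m. c i * (I (v i) w - a i * I \<eta> w)) \<partial>M)" .
  next
    fix x y :: "nat \<Rightarrow> real" assume xy: "\<And>i. i < n + m \<Longrightarrow> x i = y i"
    have 1: "q x = q y" if "schwartz n q" for q by (rule schwartz_cong[OF that]) (simp add: xy)
    have 2: "q (\<lambda>j. x (n + j)) = q (\<lambda>j. y (n + j))" if "schwartz m q" for q
      by (rule schwartz_cong[OF that]) (simp add: xy)
    show "\<phi> x = \<phi> y" by (simp add: \<phi>_def 1[OF f] 2[OF g])
    show "d\<phi> x = d\<phi> y" by (simp add: d\<phi>_def 1[OF f] 2[OF g] 1[OF fp] 2[OF gp])
  next
    show "continuous_on UNIV \<phi>"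
      unfolding \<phi>_def[abs_def] by (intro continuous_intros schwartz_continuous[OF f] c[OF g])
    show "continuous_on UNIV d\<phi>"
      unfolding d\<phi>_def[abs_def]
      by (intro continuous_intros schwartz_continuous[OF f] c[OF g] schwartz_continuous[OF fp] c[OF gp]) auto
  next
    fix x
    have "\<bar>\<phi> x\<bar> \<le> Cf * Cg"
      unfolding \<phi>_def abs_mult by (intro mult_mono Cf Cg Cf0) simp
    then show "\<bar>\<phi> x\<bar> \<le> C" unfolding C_def using S10 S20 Cf0 Cg0 by (simp add: add_increasing2)
    have "\<bar>d\<phi> x\<bar> \<le> S1 * Cg + Cf * S2"
      unfolding d\<phi>_def by (rule order_trans[OF abs_triangle_ineq])
        (auto simp: abs_mult intro!: add_mono mult_mono s1 s2 Cf Cg Cf0 S10)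
    then show "\<bar>d\<phi> x\<bar> \<le> C" unfolding C_def using mult_nonneg_nonneg[OF Cf0 Cg0] by linarith
  next
    fix x s
    show "((\<lambda>s. \<phi> (\<lambda>i. x i + s * a i)) has_real_derivative d\<phi> (\<lambda>i. x i + s * a i)) (at s)"
      unfolding \<phi>_def d\<phi>_def
      by (rule derivative_eq_intros schwartz_chain[OF f]
          schwartz_chain[OF g, of "\<lambda>j. x (n + j)" "\<lambda>j. a (n + j)"] refl)+ (simp add: algebra_simps)
  qed measurable
  then show ?thesis
    by (simp add: \<phi>_def d\<phi>_def cf cfp vk) (simp add: a_def v_def)
qed

lemma schwartz_I_measurable: "schwartz n f \<Longrightarrow> (\<lambda>w. f (\<lambda>i. I (h i) w)) \<in> borel_measurable M"
proof -
  assume f: "schwartz n f"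
  have [measurable]: "f \<in> borel_measurable borel"
    by (intro borel_measurable_continuous_onI schwartz_continuous[OF f])
  have [measurable]: "(\<lambda>w i. I (h i) w) \<in> borel_measurable M"
    by (rule measurable_coordinatewise_then_product) simp
  show ?thesis by measurable
qed

lemma schwartz_I_L2: "schwartz n f \<Longrightarrow> (\<lambda>w. f (\<lambda>i. I (h i) w)) \<in> L2 M"
  by (rule schwartz_bounded, assumption) (rule L2_bounded, auto intro: schwartz_I_measurable)

lemma cylindrical_L2:
  assumes "cylindrical M mu Y emb F G"
  shows "F \<in> L2 M" "G \<in> L2 M"
proof -
  obtain n f h where nfh: "n \<ge> 1" "schwartz n f" "F = (\<lambda>w. f (\<lambda>i. I (h i) w))"
    "G = (\<lambda>w. \<Sum>i<n. partial i f (\<lambda>j. I (h j) w) *\<^sub>R h i)"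
    using assms unfolding cylindrical_def by blast
  show "F \<in> L2 M" unfolding nfh(3) by (rule schwartz_I_L2[OF nfh(2)])
  show "G \<in> L2 M"
    unfolding nfh(4)
  proof (rule L2_sum)
    fix i assume "i \<in> {..<n}"
    then have i: "i < n" by simp
    note p = schwartz_I_L2[OF schwartz_partial[OF nfh(2) i]]
    have "(\<lambda>w. partial i f (\<lambda>j. I (h j) w) *\<^sub>R h i) \<in> borel_measurable M"
      using L2_measurable[OF p[of h]] by measurable
    then show "(\<lambda>w. partial i f (\<lambda>j. I (h j) w) *\<^sub>R h i) \<in> L2 M"
      using L2_integrable_real[OF p[of h]] by (simp add: L2_def power_mult_distrib)
  qed
qed

text \<open>Closability: integration by parts identifies \<open>G\<close> through \<open>F\<close> when tested against
  cylindrical functionals, and these are rich enough because the partial derivatives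
  occurring in the approximations of \<open>G\<close> are again such functionals.\<close>

lemma nabla_graph_weak:
  assumes graph: "nabla_graph M mu Y emb F G" and \<eta>: "norm \<eta> = 1" and g: "schwartz m g"
  shows "(\<integral>w. inner (G w) \<eta> * g (\<lambda>i. I (k i) w) \<partial>M)
    = (\<integral>w. F w * (I \<eta> w * g (\<lambda>i. I (k i) w) - (\<Sum>i<m. inner (k i) \<eta> * partial i g (\<lambda>i. I (k i) w))) \<partial>M)"
proof -
  define \<Phi> where "\<Phi> w = g (\<lambda>i. I (k i) w)" for w
  define d\<Phi> where "d\<Phi> w = (\<Sum>i<m. inner (k i) \<eta> * partial i g (\<lambda>i. I (k i) w))" for w
  have \<Phi>: "\<Phi> \<in> L2 M" unfolding \<Phi>_def[abs_def] by (rule schwartz_I_L2[OF g])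
  have d\<Phi>: "d\<Phi> \<in> L2 M"
    unfolding d\<Phi>_def[abs_def] by (intro L2_sum L2_mult schwartz_I_L2[OF schwartz_partial[OF g]]) simp
  obtain C where C: "\<And>x. \<bar>g x\<bar> \<le> C" by (rule schwartz_bounded[OF g]) (rule that)
  \<comment> \<open>Boundedness of \<open>g\<close> keeps the weight against which \<open>F\<close>
    is tested in \<open>L2\<close>, so that the limit along \<open>Fs\<close> can be taken.\<close>
  have "(\<lambda>w. \<Phi> w * I \<eta> w) \<in> L2 M"
    by (rule L2_mult_bounded[OF I_L2 L2_measurable[OF \<Phi>], where C = C]) (simp add: \<Phi>_def C)
  then have W: "(\<lambda>w. I \<eta> w * \<Phi> w - d\<Phi> w) \<in> L2 M"
    using L2_diff[OF _ d\<Phi>] by (simp add: mult.commute)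
  obtain Fs Gs where cyl: "\<And>j. cylindrical M mu Y emb (Fs j) (Gs j)"
    and lim: "L2_tendsto M Fs F" "L2_tendsto M Gs G" and FG: "F \<in> L2 M" "G \<in> L2 M"
    using graph unfolding nabla_graph_def by blast
  note cylL2 = cylindrical_L2[OF cyl]
  have eq: "(\<integral>w. inner (Gs j w) \<eta> * \<Phi> w \<partial>M) = (\<integral>w. Fs j w * (I \<eta> w * \<Phi> w - d\<Phi> w) \<partial>M)" for j
  proof -
    obtain n f h where nfh: "n \<ge> 1" "schwartz n f" "Fs j = (\<lambda>w. f (\<lambda>i. I (h i) w))"
      "Gs j = (\<lambda>w. \<Sum>i<n. partial i f (\<lambda>j. I (h j) w) *\<^sub>R h i)"
      using cyl[of j] unfolding cylindrical_def by blast
    have G: "inner (Gs j w) \<eta> = (\<Sum>i<n. inner (h i) \<eta> * partial i f (\<lambda>i. I (h i) w))" for w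
      unfolding nfh(4) by (simp add: inner_sum_left mult.commute)
    have ibp: "(\<integral>w. I \<eta> w * (Fs j w * \<Phi> w) \<partial>M) = (\<integral>w. inner (Gs j w) \<eta> * \<Phi> w + Fs j w * d\<Phi> w \<partial>M)"
      using cylindrical_integration_by_parts[OF \<eta> nfh(2) g, of h k]
      by (simp add: G \<Phi>_def d\<Phi>_def nfh(3))
    have i1: "integrable M (\<lambda>w. inner (Gs j w) \<eta> * \<Phi> w)"
      by (intro L2_mult_integrable L2_inner cylL2 \<Phi>)
    have i2: "integrable M (\<lambda>w. Fs j w * d\<Phi> w)"
      by (intro L2_mult_integrable cylL2 d\<Phi>)
    have i3: "integrable M (\<lambda>w. Fs j w * (I \<eta> w * \<Phi> w - d\<Phi> w))"
      by (intro L2_mult_integrable cylL2 W)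
    have "(\<lambda>w. I \<eta> w * (Fs j w * \<Phi> w)) = (\<lambda>w. Fs j w * (I \<eta> w * \<Phi> w - d\<Phi> w) + Fs j w * d\<Phi> w)"
      by (auto simp: algebra_simps)
    then show ?thesis using ibp i1 i2 i3 by simp
  qed
  have "(\<lambda>j. \<integral>w. inner (Gs j w) \<eta> * \<Phi> w \<partial>M) \<longlonglongrightarrow> (\<integral>w. inner (G w) \<eta> * \<Phi> w \<partial>M)"
    by (intro L2_tendsto_integral_mult L2_tendsto_inner lim cylL2 FG L2_inner \<Phi>)
  moreover have "(\<lambda>j. \<integral>w. inner (Gs j w) \<eta> * \<Phi> w \<partial>M) \<longlonglongrightarrow> (\<integral>w. F w * (I \<eta> w * \<Phi> w - d\<Phi> w) \<partial>M)"
    unfolding eq by (intro L2_tendsto_integral_mult lim cylL2 FG W)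
  ultimately show ?thesis
    unfolding \<Phi>_def d\<Phi>_def by (rule LIMSEQ_unique)
qed

text \<open>Density of the cylindrical functionals is not invoked. The difference \<open>Z\<close>
  of the two gradients in a direction \<open>\<eta>\<close> is orthogonal to every
  \<open>partial i f\<close>, hence to the component along \<open>\<eta>\<close> of each cylindrical
  gradient, hence in the limit to those of \<open>G\<close> and \<open>G'\<close>, and so to
  itself.\<close>

lemma nabla_graph_unique:
  assumes G: "nabla_graph M mu Y emb F G" and G': "nabla_graph M mu Y emb F G'"
  shows "AE w in M. G w = G' w"
proof -
  have L2: "G \<in> L2 M" "G' \<in> L2 M" using G G' by (auto simp: nabla_graph_def)
  have unit: "AE w in M. inner (G w - G' w) \<eta> = 0" if \<eta>: "norm \<eta> = 1" for \<eta>
  proof -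
    define Z where "Z w = inner (G w - G' w) \<eta>" for w
    have Z: "Z \<in> L2 M" unfolding Z_def[abs_def] by (intro L2_inner L2_diff L2)
    have orth: "(\<integral>w. Z w * inner (H w) \<eta> \<partial>M) = 0" if cyl: "cylindrical M mu Y emb F0 H" for F0 H
    proof -
      obtain n f h where nfh: "schwartz n f" "H = (\<lambda>w. \<Sum>i<n. partial i f (\<lambda>j. I (h j) w) *\<^sub>R h i)"
        using cyl unfolding cylindrical_def by blast
      have zero: "(\<integral>w. Z w * partial i f (\<lambda>j. I (h j) w) \<partial>M) = 0" if "i < n" for i
      proof -
        note p = schwartz_partial[OF nfh(1) that]
        have "integrable M (\<lambda>w. inner (G w) \<eta> * partial i f (\<lambda>j. I (h j) w))"
          "integrable M (\<lambda>w. inner (G' w) \<eta> * partial i f (\<lambda>j. I (h j) w))"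
          by (intro L2_mult_integrable L2_inner L2 schwartz_I_L2[OF p])+
        then show ?thesis
          using nabla_graph_weak[OF G \<eta> p, of h] nabla_graph_weak[OF G' \<eta> p, of h]
          by (simp add: Z_def inner_diff_left left_diff_distrib)
      qed
      have "(\<integral>w. Z w * inner (H w) \<eta> \<partial>M)
          = (\<integral>w. (\<Sum>i<n. inner (h i) \<eta> * (Z w * partial i f (\<lambda>j. I (h j) w))) \<partial>M)"
        unfolding nfh(2) by (simp add: inner_sum_left sum_distrib_left mult_ac)
      also have "\<dots> = (\<Sum>i<n. \<integral>w. inner (h i) \<eta> * (Z w * partial i f (\<lambda>j. I (h j) w)) \<partial>M)"
        by (rule Bochner_Integration.integral_sum)
          (auto intro!: integrable_mult_right L2_mult_integrable Z schwartz_I_L2[OF schwartz_partial[OF nfh(1)]])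
      also have "\<dots> = 0" using zero by simp
      finally show ?thesis .
    qed
    have orth': "(\<integral>w. Z w * inner (H w) \<eta> \<partial>M) = 0" if H: "nabla_graph M mu Y emb F0 H" for F0 H
    proof -
      obtain Fs Hs where cyl: "\<And>j. cylindrical M mu Y emb (Fs j) (Hs j)"
        and lim: "L2_tendsto M Hs H" and HL2: "H \<in> L2 M"
        using H unfolding nabla_graph_def by blast
      have "(\<lambda>j. \<integral>w. inner (Hs j w) \<eta> * Z w \<partial>M) \<longlonglongrightarrow> (\<integral>w. inner (H w) \<eta> * Z w \<partial>M)"
        by (intro L2_tendsto_integral_mult L2_tendsto_inner lim cylindrical_L2(2)[OF cyl] HL2 L2_inner Z)
      moreover have "(\<integral>w. inner (Hs j w) \<eta> * Z w \<partial>M) = 0" for j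
        using orth[OF cyl[of j]] by (simp add: mult.commute)
      ultimately have "(\<integral>w. inner (H w) \<eta> * Z w \<partial>M) = 0" by (simp add: LIMSEQ_const_iff)
      then show ?thesis by (simp add: mult.commute)
    qed
    have "(\<integral>w. (Z w)\<^sup>2 \<partial>M) = (\<integral>w. Z w * inner (G w) \<eta> - Z w * inner (G' w) \<eta> \<partial>M)"
      by (simp add: Z_def power2_eq_square inner_diff_left right_diff_distrib)
    also have "\<dots> = 0"
      using orth'[OF G] orth'[OF G'] L2_mult_integrable[OF Z L2_inner[OF L2(1), of \<eta>]]
        L2_mult_integrable[OF Z L2_inner[OF L2(2), of \<eta>]] by simp
    finally have "AE w in M. (Z w)\<^sup>2 = 0"
      using L2_integrable_real[OF Z] by (subst (asm) integral_nonneg_eq_0_iff_AE) auto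
    then show ?thesis by (simp add: Z_def)
  qed
  have vec: "AE w in M. inner (G w - G' w) v = 0" for v
  proof (cases "v = 0")
    case False
    have "AE w in M. inner (G w - G' w) (v /\<^sub>R norm v) = 0" using False by (intro unit) simp
    then show ?thesis using False by simp
  qed simp
  \<comment> \<open>The null set in \<open>vec\<close> depends on \<open>v\<close>; a countable
    dense set of directions, available as \<open>H\<close> is second countable, gives a common
    one.\<close>
  obtain D :: "'h set" where D: "countable D" "\<And>U. open U \<Longrightarrow> U \<noteq> {} \<Longrightarrow> \<exists>d\<in>D. d \<in> U"
    by (rule countable_dense_setE) blast
  have "AE w in M. \<forall>v\<in>D. inner (G w - G' w) v = 0"
    using D(1) vec by (simp add: AE_ball_countable)
  then show ?thesis
  proof (rule AE_mp, intro AE_I2 impI)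
    fix w assume 0: "\<forall>v\<in>D. inner (G w - G' w) v = 0"
    show "G w = G' w"
    proof (rule ccontr)
      assume "G w \<noteq> G' w"
      define x where "x = G w - G' w"
      have "x \<noteq> 0" using \<open>G w \<noteq> G' w\<close> by (simp add: x_def)
      then obtain v where v: "v \<in> D" "v \<in> ball x (norm x)"
        using D(2)[of "ball x (norm x)"] by auto
      \<comment> \<open>\<open>v\<close> is orthogonal to \<open>x\<close>, so Pythagoras
        contradicts its being nearer to \<open>x\<close> than the origin is.\<close>
      have "(norm (x - v))\<^sup>2 = (norm x)\<^sup>2 + (norm v)\<^sup>2"
        using 0 v(1) by (simp add: power2_norm_eq_inner inner_diff_left inner_diff_right inner_commute x_def[symmetric])
      moreover have "(norm (x - v))\<^sup>2 < (norm x)\<^sup>2"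
        using v(2) by (intro power_strict_mono) (auto simp: dist_norm)
      ultimately show False by simp
    qed
  qed
qed

end

section \<open>Smooth approximation of the soft threshold\<close>

text \<open>A class of smooth functions of polynomial growth that is closed under derivatives and
  contains the regularised absolute values; times a Gaussian factor its members are rapidly
  decreasing.\<close>

inductive_set tame :: "real \<Rightarrow> (real \<Rightarrow> real) set" for e where
  const: "(\<lambda>x. c) \<in> tame e"
| ident: "(\<lambda>x. x) \<in> tame e"
| root: "(\<lambda>x. sqrt ((x - c)\<^sup>2 + e)) \<in> tame e"
| inverse_root: "(\<lambda>x. inverse (sqrt ((x - c)\<^sup>2 + e))) \<in> tame e"
| add: "f \<in> tame e \<Longrightarrow> g \<in> tame e \<Longrightarrow> (\<lambda>x. f x + g x) \<in> tame e"
| mult: "f \<in> tame e \<Longrightarrow> g \<in> tame e \<Longrightarrow> (\<lambda>x. f x * g x) \<in> tame e"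

lemma tame_linear: "(\<lambda>x. x - c) \<in> tame e"
  using tame.add[OF tame.ident tame.const[of "-c"]] by simp

lemma sqrt_shift_derivative:
  assumes "e > 0"
  shows "((\<lambda>x. sqrt ((x - c)\<^sup>2 + e)) has_real_derivative (x - c) * inverse (sqrt ((x - c)\<^sup>2 + e))) (at x)"
proof -
  have "(x - c)\<^sup>2 + e > 0" using assms by (simp add: add_nonneg_pos)
  then show ?thesis
    by (auto intro!: derivative_eq_intros simp: field_simps)
qed

lemma tame_derivative:
  assumes "e > 0" "f \<in> tame e"
  shows "\<exists>f'\<in>tame e. \<forall>x. (f has_real_derivative f' x) (at x)"
  using assms(2)
proof induction
  case (const c)
  show ?case by (rule bexI[OF _ tame.const[of 0]]) simp
next
  case ident
  show ?case by (rule bexI[OF _ tame.const[of 1]]) simp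
next
  case (root c)
  show ?case
    by (rule bexI[OF _ tame.mult[OF tame_linear[of c] tame.inverse_root[of c]]])
      (simp add: sqrt_shift_derivative assms(1))
next
  case (inverse_root c)
  let ?r = "\<lambda>x. inverse (sqrt ((x - c)\<^sup>2 + e))"
  have pos: "(x - c)\<^sup>2 + e > 0" for x using assms(1) by (simp add: add_nonneg_pos)
  have "(?r has_real_derivative (- 1 * (x - c)) * (?r x * (?r x * ?r x))) (at x)" for x
    using pos[of x]
    by (intro DERIV_cong[OF DERIV_inverse'[OF sqrt_shift_derivative[OF assms(1)]]]) (auto simp: algebra_simps)
  then show ?case
    by (intro bexI[OF _ tame.mult[OF tame.mult[OF tame.const[of "-1"] tame_linear[of c]]
            tame.mult[OF tame.inverse_root[of c] tame.mult[OF tame.inverse_root[of c] tame.inverse_root[of c]]]]]) simp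
next
  case (add f g)
  then obtain f' g' where "f' \<in> tame e" "g' \<in> tame e"
    "\<And>x. (f has_real_derivative f' x) (at x)" "\<And>x. (g has_real_derivative g' x) (at x)" by blast
  then show ?case
    by (intro bexI[OF _ tame.add[of f' _ g']]) (auto intro: DERIV_add)
next
  case (mult f g)
  then obtain f' g' where "f' \<in> tame e" "g' \<in> tame e"
    "\<And>x. (f has_real_derivative f' x) (at x)" "\<And>x. (g has_real_derivative g' x) (at x)" by blast
  with mult show ?case
    by (intro bexI[OF _ tame.add[OF tame.mult[of f' _ g] tame.mult[of g' _ f]]]) (auto intro: DERIV_mult)
qed

text \<open>Growth is measured in powers of \<open>1 + x^2\<close> because this base is at least 1:
  exponents can be raised at will, which settles sums.\<close>

lemma tame_growth:
  assumes "e > 0" "f \<in> tame e"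
  shows "\<exists>C m. C \<ge> 0 \<and> (\<forall>x. \<bar>f x\<bar> \<le> C * (1 + x\<^sup>2) ^ m)"
proof -
  have abs1: "\<bar>x\<bar> \<le> 1 + x\<^sup>2" for x :: real
    using abs_mult_le_squares[of x 1] by simp
  have one: "1 \<le> (1 + x\<^sup>2) ^ m" for x :: real and m by (rule one_le_power) simp
  show ?thesis
    using assms(2)
  proof induction
    case (const c)
    show ?case by (rule exI[of _ "\<bar>c\<bar>"], rule exI[of _ 0]) simp
  next
    case ident
    show ?case using abs1 by (intro exI[of _ 1]) auto
  next
    case (root c)
    have "\<bar>sqrt ((x - c)\<^sup>2 + e)\<bar> \<le> (1 + \<bar>c\<bar> + sqrt e) * (1 + x\<^sup>2) ^ 1" for x
    proof -
      have "\<bar>sqrt ((x - c)\<^sup>2 + e)\<bar> \<le> \<bar>x - c\<bar> + sqrt e"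
        using assms(1) sqrt_add_le_add_sqrt[of "(x - c)\<^sup>2" e] by simp
      also have "\<dots> \<le> (1 + x\<^sup>2) + (\<bar>c\<bar> + sqrt e) * 1" using abs1[of x] by simp
      also have "\<dots> \<le> (1 + x\<^sup>2) + (\<bar>c\<bar> + sqrt e) * (1 + x\<^sup>2)"
        using assms(1) by (intro add_left_mono mult_left_mono) auto
      finally show ?thesis by (simp add: algebra_simps)
    qed
    moreover have "1 + \<bar>c\<bar> + sqrt e \<ge> 0" using assms(1) by simp
    ultimately show ?case by blast
  next
    case (inverse_root c)
    have "\<bar>inverse (sqrt ((x - c)\<^sup>2 + e))\<bar> \<le> inverse (sqrt e) * (1 + x\<^sup>2) ^ 0" for x
      using assms(1) by (simp add: le_imp_inverse_le)
    moreover have "inverse (sqrt e) \<ge> 0" using assms(1) by simp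
    ultimately show ?case by blast
  next
    case (add f g)
    then obtain C m D n where CD: "C \<ge> 0" "D \<ge> 0" "\<And>x. \<bar>f x\<bar> \<le> C * (1 + x\<^sup>2) ^ m" "\<And>x. \<bar>g x\<bar> \<le> D * (1 + x\<^sup>2) ^ n"
      by blast
    have "\<bar>f x + g x\<bar> \<le> (C + D) * (1 + x\<^sup>2) ^ (m + n)" for x
    proof -
      have "\<bar>f x + g x\<bar> \<le> C * (1 + x\<^sup>2) ^ m + D * (1 + x\<^sup>2) ^ n"
        using CD(3,4)[of x] by linarith
      also have "\<dots> \<le> C * (1 + x\<^sup>2) ^ (m + n) + D * (1 + x\<^sup>2) ^ (m + n)"
        using CD(1,2) by (intro add_mono mult_left_mono power_increasing) auto
      finally show ?thesis by (simp add: distrib_right)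
    qed
    moreover have "C + D \<ge> 0" using CD by simp
    ultimately show ?case by blast
  next
    case (mult f g)
    then obtain C m D n where CD: "C \<ge> 0" "D \<ge> 0" "\<And>x. \<bar>f x\<bar> \<le> C * (1 + x\<^sup>2) ^ m" "\<And>x. \<bar>g x\<bar> \<le> D * (1 + x\<^sup>2) ^ n"
      by blast
    have "\<bar>f x * g x\<bar> \<le> (C * D) * (1 + x\<^sup>2) ^ (m + n)" for x
    proof -
      have "\<bar>f x * g x\<bar> \<le> (C * (1 + x\<^sup>2) ^ m) * (D * (1 + x\<^sup>2) ^ n)"
        unfolding abs_mult using CD by (intro mult_mono) auto
      then show ?thesis by (simp add: power_add mult_ac)
    qed
    moreover have "C * D \<ge> 0" using CD by simp
    ultimately show ?case by blast
  qed
qed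

text \<open>The inequality \<open>y \<le> exp y\<close> at \<open>y = d * z / N\<close>, raised to
  the power \<open>N\<close>.\<close>

lemma power_le_exp:
  assumes "d > 0" "z \<ge> (0 :: real)"
  shows "z ^ N \<le> (real N / d) ^ N * exp (d * z)"
proof (cases "N = 0")
  case False
  then have "N > 0" by simp
  have "d * z / real N \<le> exp (d * z / real N)"
    using exp_ge_add_one_self[of "d * z / real N"] by linarith
  then have "z \<le> (real N / d) * exp (d * z / real N)"
    using assms \<open>N > 0\<close> by (simp add: field_simps)
  then have "z ^ N \<le> ((real N / d) * exp (d * z / real N)) ^ N"
    using assms by (intro power_mono)
  also have "\<dots> = (real N / d) ^ N * exp (d * z)"
  proof -
    have "exp (d * z / real N) ^ N = exp (d * z)"
      using \<open>N > 0\<close> exp_of_nat_mult[of N "d * z / real N"] by simp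
    then show ?thesis by (simp only: power_mult_distrib)
  qed
  finally show ?thesis .
qed (use assms in simp)

lemma schwartz_tame:
  assumes "e > 0" "d > 0" "p \<in> tame e"
  shows "schwartz 1 (\<lambda>x. p (x 0) * exp (- d * (x 0)\<^sup>2))"
proof -
  \<comment> \<open>This class is closed under differentiation, so all iterated partial derivatives
    stay in it and one decay estimate serves for all of them.\<close>
  define \<G> where "\<G> = {\<lambda>x. q x * exp (- d * x\<^sup>2) |q. q \<in> tame e}"
  have step: "\<exists>\<psi>'\<in>\<G>. \<forall>x. (\<psi> has_real_derivative \<psi>' x) (at x)" if \<psi>: "\<psi> \<in> \<G>" for \<psi>
  proof -
    obtain q where q: "q \<in> tame e" "\<psi> = (\<lambda>x. q x * exp (- d * x\<^sup>2))" using \<psi> unfolding \<G>_def by blast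
    obtain q' where q': "q' \<in> tame e" "\<And>x. (q has_real_derivative q' x) (at x)"
      using tame_derivative[OF assms(1) q(1)] by blast
    define r where "r x = q' x + - 2 * d * (x * q x)" for x
    have "r \<in> tame e"
      unfolding r_def[abs_def]
      by (intro tame.add q' tame.mult tame.ident q tame.const)
    moreover have "(\<psi> has_real_derivative r x * exp (- d * x\<^sup>2)) (at x)" for x
      unfolding q(2) r_def by (auto intro!: derivative_eq_intros q' simp: algebra_simps)
    ultimately show ?thesis by (intro bexI[of _ "\<lambda>x. r x * exp (- d * x\<^sup>2)"]) (auto simp: \<G>_def)
  qed
  have iter: "\<exists>\<psi>\<in>\<G>. foldr partial js (\<lambda>x. p (x 0) * exp (- d * (x 0)\<^sup>2)) = (\<lambda>x. \<psi> (x 0))"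
    if "set js \<subseteq> {..<1}" for js
    using that
  proof (induction js)
    case Nil
    show ?case
      using assms(3) by (intro bexI[of _ "\<lambda>x. p x * exp (- d * x\<^sup>2)"]) (auto simp: \<G>_def)
  next
    case (Cons j js)
    then obtain \<psi> where \<psi>: "\<psi> \<in> \<G>" "foldr partial js (\<lambda>x. p (x 0) * exp (- d * (x 0)\<^sup>2)) = (\<lambda>x. \<psi> (x 0))" by auto
    obtain \<psi>' where \<psi>': "\<psi>' \<in> \<G>" "\<And>x. (\<psi> has_real_derivative \<psi>' x) (at x)" using step[OF \<psi>(1)] by blast
    have "j = 0" using Cons by simp
    then have "foldr partial (j # js) (\<lambda>x. p (x 0) * exp (- d * (x 0)\<^sup>2)) = (\<lambda>x. \<psi>' (x 0))"
      using \<psi>(2) DERIV_imp_deriv[OF \<psi>'(2)] by (simp add: partial_def fun_eq_iff)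
    then show ?case using \<psi>'(1) by blast
  qed
  have decay: "\<exists>C. \<forall>x. (x\<^sup>2) ^ k * \<bar>\<psi> x\<bar> \<le> C" if \<psi>: "\<psi> \<in> \<G>" for \<psi> k
  proof -
    obtain q where q: "q \<in> tame e" "\<psi> = (\<lambda>x. q x * exp (- d * x\<^sup>2))" using \<psi> unfolding \<G>_def by blast
    obtain C m where C: "C \<ge> 0" "\<And>x. \<bar>q x\<bar> \<le> C * (1 + x\<^sup>2) ^ m"
      using tame_growth[OF assms(1) q(1)] by blast
    have "(x\<^sup>2) ^ k * \<bar>\<psi> x\<bar> \<le> C * ((real (k + m) / d) ^ (k + m) * exp d)" for x
    proof -
      have "(x\<^sup>2) ^ k * \<bar>\<psi> x\<bar> \<le> (1 + x\<^sup>2) ^ k * (C * (1 + x\<^sup>2) ^ m * exp (- d * x\<^sup>2))"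
        unfolding q(2) abs_mult using C by (intro mult_mono power_mono) auto
      also have "\<dots> = C * ((1 + x\<^sup>2) ^ (k + m) * exp (- d * x\<^sup>2))" by (simp add: power_add)
      \<comment> \<open>\<open>power_le_exp\<close> at \<open>z = 1 + x^2\<close>: the exponential
        cancels the Gaussian factor up to the constant \<open>exp d\<close>.\<close>
      also have "\<dots> \<le> C * ((real (k + m) / d) ^ (k + m) * exp (d * (1 + x\<^sup>2)) * exp (- d * x\<^sup>2))"
        using C(1) assms(2) by (intro mult_left_mono mult_right_mono power_le_exp) auto
      also have "exp (d * (1 + x\<^sup>2)) = exp d * exp (d * x\<^sup>2)" by (simp add: distrib_left exp_add)
      finally show ?thesis by (simp add: exp_minus mult.assoc)
    qed
    then show ?thesis by blast
  qed
  show ?thesis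
    unfolding schwartz_def
  proof (intro conjI allI impI)
    fix js assume "set js \<subseteq> {..<1 :: nat}"
    from iter[OF this] obtain \<psi> where \<psi>: "\<psi> \<in> \<G>"
      "foldr partial js (\<lambda>x. p (x 0) * exp (- d * (x 0)\<^sup>2)) = (\<lambda>x. \<psi> (x 0))" by blast
    obtain \<psi>' where \<psi>': "\<And>x. (\<psi> has_real_derivative \<psi>' x) (at x)" using step[OF \<psi>(1)] by blast
    have "continuous_on UNIV \<psi>"
      using \<psi>' by (auto intro!: continuous_at_imp_continuous_on DERIV_isCont)
    then show "continuous_on UNIV (foldr partial js (\<lambda>x. p (x 0) * exp (- d * (x 0)\<^sup>2)))"
      unfolding \<psi>(2) by (rule continuous_on_compose2) (auto intro: continuous_on_product_coordinates)
    show "(\<lambda>s. foldr partial js (\<lambda>x. p (x 0) * exp (- d * (x 0)\<^sup>2)) (x(i := s))) differentiable (at (x i))"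
      if "i < 1" for i x
      using that \<psi>' unfolding \<psi>(2) by (auto simp: real_differentiable_def)
    show "\<exists>C. \<forall>x. (\<Sum>i<1. (x i)\<^sup>2) ^ k * \<bar>foldr partial js (\<lambda>x. p (x 0) * exp (- d * (x 0)\<^sup>2)) x\<bar> \<le> C" for k
    proof -
      obtain C where "\<And>y. (y\<^sup>2) ^ k * \<bar>\<psi> y\<bar> \<le> C" using decay[OF \<psi>(1), of k] by blast
      then show ?thesis unfolding \<psi>(2) by (intro exI[of _ C]) simp
    qed
  qed simp
qed

text \<open>A smooth rapidly decreasing approximation of \<open>(\<bar>x - hi\<bar> - \<bar>x - lo\<bar>) / 2\<close>, which is the
  soft-threshold function.\<close>

definition smooth_threshold :: "real \<Rightarrow> real \<Rightarrow> real \<Rightarrow> real \<Rightarrow> real" where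
  "smooth_threshold e lo hi x = (sqrt ((x - hi)\<^sup>2 + e) - sqrt ((x - lo)\<^sup>2 + e)) / 2 * exp (- e * x\<^sup>2)"

definition smooth_threshold' :: "real \<Rightarrow> real \<Rightarrow> real \<Rightarrow> real \<Rightarrow> real" where
  "smooth_threshold' e lo hi x =
     ((x - hi) * inverse (sqrt ((x - hi)\<^sup>2 + e)) - (x - lo) * inverse (sqrt ((x - lo)\<^sup>2 + e))) / 2 * exp (- e * x\<^sup>2)
     - 2 * e * x * smooth_threshold e lo hi x"

lemma smooth_threshold_derivative:
  assumes "e > 0"
  shows "(smooth_threshold e lo hi has_real_derivative smooth_threshold' e lo hi x) (at x)"
proof -
  have "((\<lambda>x. exp (- e * x\<^sup>2)) has_real_derivative exp (- e * x\<^sup>2) * (- 2 * e * x)) (at x)"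
    by (auto intro!: derivative_eq_intros)
  note DERIV_mult[OF DERIV_cdivide[OF DERIV_diff[OF sqrt_shift_derivative[OF assms] sqrt_shift_derivative[OF assms]]] this]
  from DERIV_cong[OF this[of hi lo 2]] show ?thesis
    by (simp add: smooth_threshold_def[abs_def] smooth_threshold'_def mult_ac)
qed

lemma schwartz_smooth_threshold:
  assumes "e > 0"
  shows "schwartz 1 (\<lambda>x. smooth_threshold e lo hi (x 0))"
proof -
  have "(\<lambda>x. 1 / 2 * (sqrt ((x - hi)\<^sup>2 + e) + - 1 * sqrt ((x - lo)\<^sup>2 + e))) \<in> tame e"
    by (intro tame.intros)
  from schwartz_tame[OF assms assms this] show ?thesis
    by (simp add: smooth_threshold_def)
qed

lemma smooth_threshold_bound:
  assumes "e > 0"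
  shows "\<bar>smooth_threshold e lo hi x\<bar> \<le> \<bar>hi - lo\<bar> / 2"
proof -
  \<comment> \<open>The regularised absolute value is the length of the plane vector with entries
    \<open>x - c\<close> and \<open>sqrt e\<close>, so the reverse triangle inequality makes it
    1-Lipschitz in \<open>c\<close>.\<close>
  have s: "sqrt ((x - c)\<^sup>2 + e) = cmod (Complex (x - c) (sqrt e))" for c
    using assms by (simp add: cmod_def)
  have "\<bar>sqrt ((x - hi)\<^sup>2 + e) - sqrt ((x - lo)\<^sup>2 + e)\<bar> \<le> cmod (Complex (x - hi) (sqrt e) - Complex (x - lo) (sqrt e))"
    unfolding s by (rule norm_triangle_ineq3)
  also have "\<dots> = \<bar>hi - lo\<bar>" by (simp add: cmod_def)
  finally have 1: "\<bar>sqrt ((x - hi)\<^sup>2 + e) - sqrt ((x - lo)\<^sup>2 + e)\<bar> \<le> \<bar>hi - lo\<bar>" .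
  have 2: "exp (- e * x\<^sup>2) \<le> 1" using assms by simp
  have "\<bar>sqrt ((x - hi)\<^sup>2 + e) - sqrt ((x - lo)\<^sup>2 + e)\<bar> * exp (- e * x\<^sup>2) \<le> \<bar>hi - lo\<bar> * 1"
    by (rule mult_mono[OF 1 2]) auto
  then show ?thesis by (simp add: smooth_threshold_def abs_mult)
qed

text \<open>The term linear in \<open>x\<close> comes from differentiating
  \<open>exp (- e * x^2)\<close>. The bound is uniform in \<open>e \<le> 1\<close>, and linear
  growth suits dominated convergence since \<open>I h\<close> is square integrable.\<close>

lemma smooth_threshold'_bound:
  assumes "e > 0" "e \<le> 1"
  shows "\<bar>smooth_threshold' e lo hi x\<bar> \<le> 1 + \<bar>hi - lo\<bar> * \<bar>x\<bar>"
proof -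
  have r: "\<bar>(x - c) * inverse (sqrt ((x - c)\<^sup>2 + e))\<bar> \<le> 1" for c
  proof -
    have "\<bar>x - c\<bar> \<le> sqrt ((x - c)\<^sup>2 + e)" using assms by (intro real_le_rsqrt) simp
    moreover have "sqrt ((x - c)\<^sup>2 + e) > 0" using assms by (simp add: add_nonneg_pos)
    ultimately show ?thesis by (simp add: abs_mult field_simps)
  qed
  let ?a = "((x - hi) * inverse (sqrt ((x - hi)\<^sup>2 + e)) - (x - lo) * inverse (sqrt ((x - lo)\<^sup>2 + e))) / 2"
  have "\<bar>?a\<bar> \<le> 1" using r[of hi] r[of lo] by (simp add: abs_le_iff)
  then have "\<bar>?a\<bar> * exp (- e * x\<^sup>2) \<le> 1 * 1" using assms by (intro mult_mono) auto
  then have 1: "\<bar>?a * exp (- e * x\<^sup>2)\<bar> \<le> 1" by (simp add: abs_mult)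
  have "\<bar>2 * e * x * smooth_threshold e lo hi x\<bar> = (2 * e) * (\<bar>x\<bar> * \<bar>smooth_threshold e lo hi x\<bar>)"
    using assms by (simp add: abs_mult)
  also have "\<dots> \<le> 2 * (\<bar>x\<bar> * (\<bar>hi - lo\<bar> / 2))"
    using assms by (intro mult_mono smooth_threshold_bound) auto
  finally have 2: "\<bar>2 * e * x * smooth_threshold e lo hi x\<bar> \<le> \<bar>hi - lo\<bar> * \<bar>x\<bar>" by (simp add: mult.commute)
  show ?thesis
    unfolding smooth_threshold'_def using abs_triangle_ineq4[of "?a * exp (- e * x\<^sup>2)" "2 * e * x * smooth_threshold e lo hi x"] 1 2
    by linarith
qed

lemma smooth_threshold_limit:
  assumes "e \<longlonglongrightarrow> 0"
  shows "(\<lambda>n. smooth_threshold (e n) lo hi x) \<longlonglongrightarrow> (\<bar>x - hi\<bar> - \<bar>x - lo\<bar>) / 2"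
proof -
  have "(\<lambda>n. smooth_threshold (e n) lo hi x) \<longlonglongrightarrow>
      (sqrt ((x - hi)\<^sup>2 + 0) - sqrt ((x - lo)\<^sup>2 + 0)) / 2 * exp (- 0 * x\<^sup>2)"
    unfolding smooth_threshold_def by (intro tendsto_intros assms) auto
  then show ?thesis by simp
qed

text \<open>At a kink the sequence tends to -1/2 if \<open>lo < hi\<close> and to 0 if
  \<open>lo = hi\<close>, instead of -1; hence the kinks are excluded.\<close>

lemma smooth_threshold'_limit:
  assumes "e \<longlonglongrightarrow> 0" "x \<noteq> lo" "x \<noteq> hi" "lo \<le> hi"
  shows "(\<lambda>n. smooth_threshold' (e n) lo hi x) \<longlonglongrightarrow> - indicator {lo..hi} x"
proof -
  have "(\<lambda>n. smooth_threshold' (e n) lo hi x) \<longlonglongrightarrow>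
      ((x - hi) * inverse (sqrt ((x - hi)\<^sup>2 + 0)) - (x - lo) * inverse (sqrt ((x - lo)\<^sup>2 + 0))) / 2 * exp (- 0 * x\<^sup>2)
      - 2 * 0 * x * ((\<bar>x - hi\<bar> - \<bar>x - lo\<bar>) / 2)"
    unfolding smooth_threshold'_def
    by (intro tendsto_intros assms(1) smooth_threshold_limit) (use assms in auto)
  moreover have "(x - c) * inverse (sqrt ((x - c)\<^sup>2 + 0)) = sgn (x - c)" if "x \<noteq> c" for c
    using that by (cases "x > c") (auto simp: sgn_if field_simps)
  ultimately have "(\<lambda>n. smooth_threshold' (e n) lo hi x) \<longlonglongrightarrow> (sgn (x - hi) - sgn (x - lo)) / 2"
    using assms(2,3) by simp
  moreover have "(sgn (x - hi) - sgn (x - lo)) / 2 = - indicator {lo..hi} x"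
    using assms(2-4) by (auto simp: sgn_if split: split_indicator)
  ultimately show ?thesis by simp
qed

lemma soft_xi_eq:
  assumes "l t \<ge> 0"
  shows "soft_xi \<alpha> l t x = (\<bar>x - (\<alpha> t + l t)\<bar> - \<bar>x - (\<alpha> t - l t)\<bar>) / 2"
  using assms by (auto simp: soft_xi_def sgn_if min_def abs_if)

lemma soft_xi_square:
  assumes "l t \<ge> 0"
  shows "\<bar>soft_xi \<alpha> l t x\<bar>\<^sup>2 = min (\<bar>x - \<alpha> t\<bar>\<^sup>2) ((l t)\<^sup>2)"
proof -
  have "\<bar>soft_xi \<alpha> l t x\<bar> = min (l t) \<bar>x - \<alpha> t\<bar>"
    using assms by (auto simp: soft_xi_def abs_mult abs_sgn_eq)
  then show ?thesis
    using assms power_mono[of "l t" "\<bar>x - \<alpha> t\<bar>" 2] power_mono[of "\<bar>x - \<alpha> t\<bar>" "l t" 2]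
    by (auto simp: min_def)
qed

section \<open>The derivative of the soft threshold\<close>

context gaussian_completion
begin

lemma nabla_graph_cong:
  assumes "nabla_graph M mu Y emb F G" "AE w in M. F w = F' w" "AE w in M. G w = G' w"
    "F' \<in> borel_measurable M" "G' \<in> borel_measurable M"
  shows "nabla_graph M mu Y emb F' G'"
proof -
  obtain Fs Gs where cyl: "\<And>k. cylindrical M mu Y emb (Fs k) (Gs k)"
    and lim: "L2_tendsto M Fs F" "L2_tendsto M Gs G" and FG: "F \<in> L2 M" "G \<in> L2 M"
    using assms(1) unfolding nabla_graph_def by blast
  note m = cylindrical_L2[OF cyl, THEN L2_measurable] FG[THEN L2_measurable]
  have "L2_tendsto M Fs F'"
    by (rule L2_tendsto_cong[OF _ assms(2) m(1,1,3) assms(4) lim(1)]) simp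
  moreover have "L2_tendsto M Gs G'"
    by (rule L2_tendsto_cong[OF _ assms(3) m(2,2,4) assms(5) lim(2)]) simp
  ultimately show ?thesis
    unfolding nabla_graph_def
    using cyl L2_AE_cong[OF FG(1) assms(4,2)] L2_AE_cong[OF FG(2) assms(5,3)] by blast
qed

text \<open>Smoothed thresholds of the single variable \<open>I h\<close> are cylindrical with
  \<open>n = 1\<close>; they and their gradients converge by dominated convergence. The gradients
  may have the wrong limit at the kinks: \<open>atoms\<close> makes these a null event or else
  annihilates the gradients through \<open>h = 0\<close>.\<close>

lemma nabla_graph_threshold:
  assumes "lo \<le> hi" and atoms: "h = 0 \<or> (AE w in M. I h w \<noteq> lo \<and> I h w \<noteq> hi)"
  shows "nabla_graph M mu Y emb (\<lambda>w. (\<bar>I h w - hi\<bar> - \<bar>I h w - lo\<bar>) / 2)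
    (\<lambda>w. (- indicator {lo..hi} (I h w)) *\<^sub>R h)"
proof -
  define e where "e n = inverse (real (Suc n))" for n
  have e: "e n > 0" "e n \<le> 1" for n by (simp_all add: e_def inverse_le_1_iff)
  have e0: "e \<longlonglongrightarrow> 0" unfolding e_def[abs_def] by (rule LIMSEQ_inverse_real_of_nat)
  define \<psi> where "\<psi> n = smooth_threshold (e n) lo hi" for n
  define \<psi>' where "\<psi>' n = smooth_threshold' (e n) lo hi" for n
  have deriv: "(\<psi> n has_real_derivative \<psi>' n x) (at x)" for n x
    unfolding \<psi>_def \<psi>'_def by (rule smooth_threshold_derivative[OF e(1)])
  have sch: "schwartz 1 (\<lambda>x. \<psi> n (x 0))" for n
    unfolding \<psi>_def by (rule schwartz_smooth_threshold[OF e(1)])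
  define Fs where "Fs n = (\<lambda>w. \<psi> n (I h w))" for n
  define Gs where "Gs n = (\<lambda>w. \<psi>' n (I h w) *\<^sub>R h)" for n
  have cyl: "cylindrical M mu Y emb (Fs n) (Gs n)" for n
    unfolding cylindrical_def
  proof (intro exI conjI)
    show "schwartz 1 (\<lambda>x. \<psi> n (x 0))" by (rule sch)
    show "Fs n = (\<lambda>w. \<psi> n (I h w))" by (simp add: Fs_def)
    show "Gs n = (\<lambda>w. \<Sum>i<1. partial i (\<lambda>x. \<psi> n (x 0)) (\<lambda>j. I h w) *\<^sub>R h)"
      using DERIV_imp_deriv[OF deriv] by (simp add: Gs_def partial_def)
  qed simp
  note [measurable] = cylindrical_L2[OF cyl, THEN L2_measurable]
  define F where "F w = (\<bar>I h w - hi\<bar> - \<bar>I h w - lo\<bar>) / 2" for w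
  define G where "G w = (- indicator {lo..hi} (I h w)) *\<^sub>R h" for w
  have [measurable]: "F \<in> borel_measurable M" unfolding F_def[abs_def] by measurable
  have [measurable]: "G \<in> borel_measurable M" unfolding G_def[abs_def] by measurable
  have Fb: "\<bar>F w\<bar> \<le> \<bar>hi - lo\<bar> / 2" for w
    using abs_triangle_ineq3[of "I h w - hi" "I h w - lo"] by (simp add: F_def abs_minus_commute)
  have FL2: "F \<in> L2 M" by (rule L2_bounded[where C = "\<bar>hi - lo\<bar> / 2"]) (use Fb in auto)
  have GL2: "G \<in> L2 M"
    by (rule L2_bounded[where C = "norm h"]) (auto simp: G_def split: split_indicator)
  have "(\<lambda>n. \<integral>w. (norm (Fs n w - F w))\<^sup>2 \<partial>M) \<longlonglongrightarrow> (\<integral>w. 0 \<partial>M)"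
  proof (rule integral_dominated_convergence[where w = "\<lambda>_. \<bar>hi - lo\<bar>\<^sup>2"])
    show "AE w in M. (\<lambda>n. (norm (Fs n w - F w))\<^sup>2) \<longlonglongrightarrow> 0"
    proof (rule AE_I2)
      fix w
      have "(\<lambda>n. (norm (Fs n w - F w))\<^sup>2) \<longlonglongrightarrow> (norm (F w - F w))\<^sup>2"
        unfolding Fs_def \<psi>_def F_def by (intro tendsto_intros smooth_threshold_limit[OF e0])
      then show "(\<lambda>n. (norm (Fs n w - F w))\<^sup>2) \<longlonglongrightarrow> 0" by simp
    qed
    show "AE w in M. norm ((norm (Fs n w - F w))\<^sup>2) \<le> \<bar>hi - lo\<bar>\<^sup>2" for n
    proof (rule AE_I2)
      fix w
      have "\<bar>Fs n w - F w\<bar> \<le> \<bar>hi - lo\<bar>"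
        using Fb[of w] smooth_threshold_bound[OF e(1), of n lo hi "I h w"] by (simp add: Fs_def \<psi>_def)
      from power_mono[OF this, of 2] show "norm ((norm (Fs n w - F w))\<^sup>2) \<le> \<bar>hi - lo\<bar>\<^sup>2" by simp
    qed
  qed simp_all
  then have F: "L2_tendsto M Fs F" by (simp add: L2_tendsto_def)
  have "(\<lambda>n. \<integral>w. (norm (Gs n w - G w))\<^sup>2 \<partial>M) \<longlonglongrightarrow> (\<integral>w. 0 \<partial>M)"
  proof (rule integral_dominated_convergence[where w = "\<lambda>w. (8 + 2 * (hi - lo)\<^sup>2 * (I h w)\<^sup>2) * (norm h)\<^sup>2"])
    show "integrable M (\<lambda>w. (8 + 2 * (hi - lo)\<^sup>2 * (I h w)\<^sup>2) * (norm h)\<^sup>2)"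
      using L2_integrable_real[OF I_L2[of h]] by simp
    have lim: "(\<lambda>n. (norm (Gs n w - G w))\<^sup>2) \<longlonglongrightarrow> 0" if "h = 0 \<or> (I h w \<noteq> lo \<and> I h w \<noteq> hi)" for w
    proof (cases "h = 0")
      case True
      then show ?thesis by (simp add: Gs_def G_def)
    next
      case False
      then have "(\<lambda>n. (norm (Gs n w - G w))\<^sup>2) \<longlonglongrightarrow> (norm (G w - G w))\<^sup>2"
        using that unfolding Gs_def \<psi>'_def G_def
        by (intro tendsto_intros smooth_threshold'_limit[OF e0]) (use assms(1) in auto)
      then show ?thesis by simp
    qed
    have "AE w in M. h = 0 \<or> (I h w \<noteq> lo \<and> I h w \<noteq> hi)"
      using atoms by auto
    then show "AE w in M. (\<lambda>n. (norm (Gs n w - G w))\<^sup>2) \<longlonglongrightarrow> 0"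
      by eventually_elim (rule lim)
    show "AE w in M. norm ((norm (Gs n w - G w))\<^sup>2) \<le> (8 + 2 * (hi - lo)\<^sup>2 * (I h w)\<^sup>2) * (norm h)\<^sup>2" for n
    proof (rule AE_I2)
      fix w
      define y where "y = I h w"
      \<comment> \<open>The 2 is 1 from the bound on the derivative plus 1 from the indicator;
        squaring by \<open>norm_add_square_le\<close> gives the 8 of the dominating
        function.\<close>
      have "\<bar>\<psi>' n y + indicator {lo..hi} y\<bar> \<le> \<bar>2 + \<bar>hi - lo\<bar> * \<bar>y\<bar>\<bar>"
        using smooth_threshold'_bound[OF e, of n lo hi y] by (auto simp: \<psi>'_def split: split_indicator)
      then have "(\<psi>' n y + indicator {lo..hi} y)\<^sup>2 \<le> (2 + \<bar>hi - lo\<bar> * \<bar>y\<bar>)\<^sup>2"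
        by (simp only: abs_le_square_iff)
      also have "\<dots> \<le> 2 * 2\<^sup>2 + 2 * (\<bar>hi - lo\<bar> * \<bar>y\<bar>)\<^sup>2"
        using norm_add_square_le[of 2 "\<bar>hi - lo\<bar> * \<bar>y\<bar>"] by simp
      finally have "(\<psi>' n y + indicator {lo..hi} y)\<^sup>2 \<le> 8 + 2 * (hi - lo)\<^sup>2 * y\<^sup>2"
        by (simp add: power_mult_distrib)
      moreover have "Gs n w - G w = (\<psi>' n y + indicator {lo..hi} y) *\<^sub>R h"
        by (simp add: Gs_def G_def y_def scaleR_add_left)
      ultimately show "norm ((norm (Gs n w - G w))\<^sup>2) \<le> (8 + 2 * (hi - lo)\<^sup>2 * (I h w)\<^sup>2) * (norm h)\<^sup>2"
        by (simp add: power_mult_distrib mult_right_mono y_def)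
    qed
  qed simp_all
  then have "L2_tendsto M Gs G" by (simp add: L2_tendsto_def)
  with F FL2 GL2 cyl have "nabla_graph M mu Y emb F G" unfolding nabla_graph_def by blast
  then show ?thesis by (simp add: F_def[abs_def] G_def[abs_def])
qed

text \<open>A nonzero second moment rules out the degenerate case of
  \<open>centered_gaussian\<close>, and a law with a density charges no point.\<close>

lemma gaussian_no_atom:
  assumes "centered_gaussian M Z" "(\<integral>w. (Z w)\<^sup>2 \<partial>M) \<noteq> 0"
  shows "AE w in M. Z w \<noteq> c"
proof -
  have "\<not> (AE w in M. Z w = 0)"
  proof
    assume "AE w in M. Z w = 0"
    then have "(\<integral>w. (Z w)\<^sup>2 \<partial>M) = (\<integral>w. 0 \<partial>M)"
      using assms(1) by (intro integral_cong_AE) (auto simp: centered_gaussian_def)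
    then show False using assms(2) by simp
  qed
  then obtain \<sigma> where "distributed M lborel Z (normal_density 0 \<sigma>)"
    using assms(1) by (auto simp: centered_gaussian_def)
  from distributed_AE2[OF this, of "\<lambda>x. x \<noteq> c"] show ?thesis
    using AE_lborel_singleton[of c] by auto
qed

text \<open>The gradient takes only the values \<open>0\<close> and \<open>- h\<close>, where \<open>I h\<close> is \<open>Y t\<close>, so \<open>cov_op\<close> is
  evaluated at two elements of \<open>H\<close> only.\<close>

lemma malliavin_D_threshold:
  assumes t: "t \<in> space mu" and h: "AE w in M. I h w = Y t w" and "lo \<le> hi"
    and F [measurable]: "F \<in> borel_measurable M" and FY: "AE w in M. F w = (\<bar>Y t w - hi\<bar> - \<bar>Y t w - lo\<bar>) / 2"
  shows "F \<in> Dom_nabla M mu Y emb"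
    and "AE w in M. malliavin_D M mu Y emb t F w = - indicator {lo..hi} (Y t w) * cov M Y t t"
proof -
  have [measurable]: "Y t \<in> borel_measurable M" by (rule L2_measurable[OF Y_L2[OF t]])
  have var: "(\<integral>w. (Y t w)\<^sup>2 \<partial>M) = (norm h)\<^sup>2"
    unfolding I_norm[symmetric] using h by (intro integral_cong_AE) auto
  \<comment> \<open>\<open>h = 0\<close> exactly when \<open>Y t\<close> has variance 0. Such a
    \<open>Y t\<close> may sit at a kink; otherwise its law has a density.\<close>
  have atoms: "h = 0 \<or> (AE w in M. I h w \<noteq> lo \<and> I h w \<noteq> hi)"
  proof (cases "h = 0")
    case False
    then have *: "(\<integral>w. (Y t w)\<^sup>2 \<partial>M) \<noteq> 0" by (simp add: var)
    show ?thesis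
      using h gaussian_no_atom[OF centered_gaussian_Y[OF t] *, of lo]
        gaussian_no_atom[OF centered_gaussian_Y[OF t] *, of hi] by auto
  qed simp
  have graph: "nabla_graph M mu Y emb F (\<lambda>w. (- indicator {lo..hi} (Y t w)) *\<^sub>R h)"
  proof (rule nabla_graph_cong[OF nabla_graph_threshold[OF \<open>lo \<le> hi\<close> atoms]])
    show "AE w in M. (\<bar>I h w - hi\<bar> - \<bar>I h w - lo\<bar>) / 2 = F w"
      using FY h by eventually_elim simp
    show "AE w in M. (- indicator {lo..hi} (I h w)) *\<^sub>R h = (- indicator {lo..hi} (Y t w)) *\<^sub>R h"
      using h by eventually_elim simp
  qed measurable
  then show "F \<in> Dom_nabla M mu Y emb" by (auto simp: Dom_nabla_def)
  \<comment> \<open>\<open>nabla\<close> is some element of the graph; by uniqueness it agrees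
    almost surely with the gradient just exhibited.\<close>
  have "nabla_graph M mu Y emb F (nabla M mu Y emb F)"
    unfolding nabla_def by (rule someI[of "nabla_graph M mu Y emb F", OF graph])
  from nabla_graph_unique[OF this graph]
  have grad: "AE w in M. nabla M mu Y emb F w = (- indicator {lo..hi} (Y t w)) *\<^sub>R h" .
  have zero: "cov_op M mu Y emb 0 t = 0"
  proof -
    have "cov_op M mu Y emb 0 t = (\<integral>w. 0 \<partial>M)"
      unfolding cov_op_def using I_zero by (intro integral_cong_AE) auto
    then show ?thesis by simp
  qed
  have minus: "cov_op M mu Y emb (- h) t = - cov M Y t t"
  proof -
    have "cov_op M mu Y emb (- h) t = (\<integral>w. - (Y t w * Y t w) \<partial>M)"
      unfolding cov_op_def using I_uminus[of h] h by (intro integral_cong_AE) auto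
    then show ?thesis by (simp add: cov_def)
  qed
  show "AE w in M. malliavin_D M mu Y emb t F w = - indicator {lo..hi} (Y t w) * cov M Y t t"
    using grad by eventually_elim (auto simp: malliavin_D_def zero minus split: split_indicator)
qed

text \<open>For almost every \<open>t\<close> both versions agree almost surely with the same
  derivative. Fubini exchanges the two quantifiers, for which the set of agreement has to be jointly
  measurable.\<close>

lemma D_version_unique:
  assumes "D_version M mu Y emb \<xi> V" "D_version M mu Y emb \<xi> W"
  shows "AE w in M. AE t in mu. V t w = W t w"
proof -
  have [measurable]: "(\<lambda>(t, w). V t w) \<in> borel_measurable (mu \<Otimes>\<^sub>M M)"
    "(\<lambda>(t, w). W t w) \<in> borel_measurable (mu \<Otimes>\<^sub>M M)"
    using assms by (auto simp: D_version_def)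
  have "AE t in mu. (AE w in M. V t w = malliavin_D M mu Y emb t (\<xi> t) w)"
    "AE t in mu. (AE w in M. W t w = malliavin_D M mu Y emb t (\<xi> t) w)"
    using assms by (auto simp: D_version_def)
  then have "AE t in mu. AE w in M. V t w = W t w"
  proof eventually_elim
    case (elim t)
    then show ?case by eventually_elim simp
  qed
  then show ?thesis
  proof (subst (asm) P.AE_commute)
    have "{z \<in> space (mu \<Otimes>\<^sub>M M). case_prod V z = case_prod W z} \<in> sets (mu \<Otimes>\<^sub>M M)"
      by measurable
    then show "{z \<in> space (mu \<Otimes>\<^sub>M M). V (fst z) (snd z) = W (fst z) (snd z)} \<in> sets (mu \<Otimes>\<^sub>M M)"
      by (simp add: case_prod_beta')
  qed
qed

end

theorem proposition4p1:
  fixes T :: real and M :: "'w measure" and mu :: "real measure"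
    and X Xu :: "real \<Rightarrow> 'w \<Rightarrow> real" and u \<alpha> l :: "real \<Rightarrow> real"
    and emb :: "(real \<Rightarrow> real) \<Rightarrow> 'h::{real_inner, complete_space, second_countable_topology}"
  assumes "T > 0"
    and "prob_space M"
    and "finite_measure mu" and "sets mu = sets (restrict_space borel {0..T})"
    and "(\<lambda>(t, w). X t w) \<in> borel_measurable (mu \<Otimes>\<^sub>M M)"
    and "\<And>t w. t \<in> {0..T} \<Longrightarrow> w \<in> space M \<Longrightarrow> X t w = u t + Xu t w"
    and "centered_gaussian_process M {0..T} Xu"
    and "\<exists>s\<in>{0..T}. \<exists>t\<in>{0..T}. cov M Xu s t \<noteq> 0"
    and "integrable mu (\<lambda>t. cov M Xu t t)"
    and "is_H_completion M mu Xu emb"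
    and "function_in_H mu emb u"
    and "\<alpha> \<in> borel_measurable (restrict_space borel {0..T})"
    and "l \<in> borel_measurable (restrict_space borel {0..T})"
    and "\<And>t. t \<in> {0..T} \<Longrightarrow> l t \<ge> 0"
  shows "SURE_defined M mu Xu emb (\<lambda>t w. soft_xi \<alpha> l t (X t w)) \<and>
    (AE w in M. SURE M mu Xu emb (\<lambda>t w. soft_xi \<alpha> l t (X t w)) w =
       ereal (\<integral>t. cov M Xu t t \<partial>mu)
       + enn2ereal (\<integral>\<^sup>+t. ennreal (min (\<bar>X t w - \<alpha> t\<bar>\<^sup>2) ((l t)\<^sup>2)) \<partial>mu)
       - ereal (2 * (\<integral>t. indicator {t. \<bar>X t w - \<alpha> t\<bar> \<le> l t} t * cov M Xu t t \<partial>mu)))"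
proof -
  have space_mu: "space mu = {0..T}"
    using sets_eq_imp_space_eq[OF assms(4)] by (simp add: space_restrict_space)
  have X_eq: "X t w = u t + Xu t w" if "t \<in> space mu" "w \<in> space M" for t w
    using that assms(6) by (simp add: space_mu)
  have l_nonneg: "l t \<ge> 0" if "t \<in> space mu" for t using that assms(14) by (simp add: space_mu)
  have [measurable]: "u \<in> borel_measurable mu" using assms(11) by (simp add: function_in_H_def)
  have [measurable]: "\<alpha> \<in> borel_measurable mu" "l \<in> borel_measurable mu"
    using assms(12,13) measurable_cong_sets[OF assms(4) refl] by blast+
  have Xm: "(\<lambda>z. X (fst z) (snd z)) \<in> borel_measurable (mu \<Otimes>\<^sub>M M)"
    using assms(5) by (simp add: case_prod_beta')
  note [measurable] = Xm
  \<comment> \<open>Joint measurability is given for \<open>X\<close>; subtracting \<open>u\<close>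
    carries it over to \<open>Xu\<close> on the product space, where the decomposition
    holds.\<close>
  have "(\<lambda>(t, w). Xu t w) \<in> borel_measurable (mu \<Otimes>\<^sub>M M)"
  proof -
    have "(\<lambda>z. X (fst z) (snd z) - u (fst z)) \<in> borel_measurable (mu \<Otimes>\<^sub>M M)" by measurable
    moreover have "X (fst z) (snd z) - u (fst z) = (case z of (t, w) \<Rightarrow> Xu t w)"
      if "z \<in> space (mu \<Otimes>\<^sub>M M)" for z
      using that X_eq by (auto simp: space_pair_measure)
    ultimately show ?thesis by (simp cong: measurable_cong)
  qed
  then interpret gaussian_completion M mu Xu emb
    using assms by (intro gaussian_completion.intro gaussian_completion_axioms.intro) (simp_all add: space_mu)
  define \<xi> where "\<xi> t w = soft_xi \<alpha> l t (X t w)" for t w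
  \<comment> \<open>An explicit jointly measurable version; \<open>D_trace\<close> is an unspecified
    one and is compared with it below.\<close>
  define V where "V t w = (if \<bar>X t w - \<alpha> t\<bar> \<le> l t then - cov M Xu t t else 0)" for t w
  have [measurable]: "(\<lambda>t. cov M Xu t t) \<in> borel_measurable mu"
    using assms(9) by (rule borel_measurable_integrable)
  have \<xi>m: "(\<lambda>(t, w). \<xi> t w) \<in> borel_measurable (mu \<Otimes>\<^sub>M M)"
    unfolding \<xi>_def soft_xi_def case_prod_beta' by measurable
  have Vm [measurable]: "(\<lambda>(t, w). V t w) \<in> borel_measurable (mu \<Otimes>\<^sub>M M)"
    unfolding V_def case_prod_beta' by measurable
  have D: "AE t in mu. \<xi> t \<in> Dom_nabla M mu Xu emb \<and>
      (AE w in M. V t w = malliavin_D M mu Xu emb t (\<xi> t) w)"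
    using AE_Y_eq_I
  proof (rule AE_mp, intro AE_I2 impI)
    fix t assume t: "t \<in> space mu" and "\<exists>\<eta>. AE w in M. I \<eta> w = Xu t w"
    then obtain h where h: "AE w in M. I h w = Xu t w" by blast
    \<comment> \<open>The kinks of the threshold in terms of \<open>X t\<close> are
      \<open>\<alpha> t - l t\<close> and \<open>\<alpha> t + l t\<close>; subtracting
      \<open>u t\<close> makes them kinks in terms of \<open>Xu t\<close>.\<close>
    define lo hi where "lo = \<alpha> t - l t - u t" and "hi = \<alpha> t + l t - u t"
    have lohi: "lo \<le> hi" using l_nonneg[OF t] by (simp add: lo_def hi_def)
    have \<xi>t: "\<xi> t \<in> borel_measurable M"
      using measurable_compose[OF measurable_Pair1'[OF t] \<xi>m] by simp
    have FY: "AE w in M. \<xi> t w = (\<bar>Xu t w - hi\<bar> - \<bar>Xu t w - lo\<bar>) / 2"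
    proof (rule AE_I2)
      fix w assume "w \<in> space M"
      then have "\<xi> t w = (\<bar>u t + Xu t w - (\<alpha> t + l t)\<bar> - \<bar>u t + Xu t w - (\<alpha> t - l t)\<bar>) / 2"
        using X_eq[OF t] soft_xi_eq[of l t, OF l_nonneg[OF t]] by (simp add: \<xi>_def)
      then show "\<xi> t w = (\<bar>Xu t w - hi\<bar> - \<bar>Xu t w - lo\<bar>) / 2"
        by (simp add: lo_def hi_def algebra_simps)
    qed
    note D = malliavin_D_threshold[OF t h lohi \<xi>t FY]
    have "AE w in M. V t w = malliavin_D M mu Xu emb t (\<xi> t) w"
      using D(2) AE_space
    proof eventually_elim
      case (elim w)
      have "\<bar>X t w - \<alpha> t\<bar> \<le> l t \<longleftrightarrow> Xu t w \<in> {lo..hi}"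
        using X_eq[OF t elim(2)] by (auto simp: lo_def hi_def abs_le_iff)
      then show ?case unfolding elim(1) V_def by (auto split: split_indicator)
    qed
    with D(1) show "\<xi> t \<in> Dom_nabla M mu Xu emb \<and>
      (AE w in M. V t w = malliavin_D M mu Xu emb t (\<xi> t) w)" by blast
  qed
  then have V: "D_version M mu Xu emb \<xi> V"
    using Vm by (auto simp: D_version_def)
  have "D_version M mu Xu emb \<xi> (D_trace M mu Xu emb \<xi>)"
    unfolding D_trace_def by (rule someI[of "D_version M mu Xu emb \<xi>", OF V])
  note trace_m = this[unfolded D_version_def, THEN conjunct1]
  have slice: "(\<lambda>t. W t w) \<in> borel_measurable mu"
    if "(\<lambda>(t, w). W t w) \<in> borel_measurable (mu \<Otimes>\<^sub>M M)" "w \<in> space M" for W :: "real \<Rightarrow> 'w \<Rightarrow> real" and w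
    using measurable_compose[OF measurable_Pair2'[OF that(2)] that(1)] by simp
  have trace: "AE w in M. AE t in mu. V t w = D_trace M mu Xu emb \<xi> t w"
    by (rule D_version_unique[OF V \<open>D_version M mu Xu emb \<xi> (D_trace M mu Xu emb \<xi>)\<close>])
  \<comment> \<open>\<open>V\<close> is dominated by the variance for every \<open>w\<close>; the
    integrability required by \<open>SURE_defined\<close> then passes to \<open>D_trace\<close>
    along almost sure equality.\<close>
  have Vint: "integrable mu (\<lambda>t. V t w)" if "w \<in> space M" for w
    by (rule Bochner_Integration.integrable_bound[OF assms(9) slice[OF Vm that]]) (simp add: V_def)
  have "AE w in M. integrable mu (\<lambda>t. D_trace M mu Xu emb \<xi> t w)"
    using trace AE_space
  proof eventually_elim
    case (elim w)
    show ?case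
      by (rule integrable_cong_AE_imp[OF Vint[OF elim(2)] slice[OF trace_m elim(2)] elim(1)])
  qed
  then have defined: "SURE_defined M mu Xu emb \<xi>"
    using \<xi>m V D by (auto simp: SURE_defined_def)
  have "AE w in M. SURE M mu Xu emb \<xi> w =
       ereal (\<integral>t. cov M Xu t t \<partial>mu)
       + enn2ereal (\<integral>\<^sup>+t. ennreal (min (\<bar>X t w - \<alpha> t\<bar>\<^sup>2) ((l t)\<^sup>2)) \<partial>mu)
       - ereal (2 * (\<integral>t. indicator {t. \<bar>X t w - \<alpha> t\<bar> \<le> l t} t * cov M Xu t t \<partial>mu))"
    using trace AE_space
  proof eventually_elim
    case (elim w)
    have "(\<integral>t. D_trace M mu Xu emb \<xi> t w \<partial>mu) = (\<integral>t. V t w \<partial>mu)"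
      using elim(1) by (intro integral_cong_AE slice[OF Vm elim(2)] slice[OF trace_m elim(2)]) auto
    also have "\<dots> = (\<integral>t. - (indicator {t. \<bar>X t w - \<alpha> t\<bar> \<le> l t} t * cov M Xu t t) \<partial>mu)"
      by (intro Bochner_Integration.integral_cong refl) (simp add: V_def split: split_indicator)
    also have "\<dots> = - (\<integral>t. indicator {t. \<bar>X t w - \<alpha> t\<bar> \<le> l t} t * cov M Xu t t \<partial>mu)"
      by simp
    finally have trace_int: "(\<integral>t. D_trace M mu Xu emb \<xi> t w \<partial>mu)
        = - (\<integral>t. indicator {t. \<bar>X t w - \<alpha> t\<bar> \<le> l t} t * cov M Xu t t \<partial>mu)" .
    have "(\<integral>\<^sup>+t. ennreal (\<bar>\<xi> t w\<bar>\<^sup>2) \<partial>mu) = (\<integral>\<^sup>+t. ennreal (min (\<bar>X t w - \<alpha> t\<bar>\<^sup>2) ((l t)\<^sup>2)) \<partial>mu)"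
      unfolding \<xi>_def by (intro nn_integral_cong) (simp only: soft_xi_square[of l, OF l_nonneg])
    \<comment> \<open>The middle term may be infinite, but the trace term is a finite real, so its
      sign can be moved outside \<open>ereal\<close>.\<close>
    then show ?case
      unfolding SURE_def trace_int by (simp add: minus_ereal_def)
  qed
  then show ?thesis
    using defined unfolding \<xi>_def[abs_def] by blast
qed

end
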